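(* Let $n\ge 3$. For any $w\in W^c(\tilde B_n)$, the expressions for $I(w)$ and $J(w)$ defined in the context are reduced, and they are reduced expressions of fully commutative elements of $W(\tilde B_{n+1})$. The maps thus defined, $$I,J:W^c(\tilde B_n)\longrightarrow W^c(\tilde B_{n+1}),$$ are injective, preserve the affine length and satisfy $$l(I(w))=l(J(w))=l(w)+L(w)\ \text{ for } w\in W^c_2(\tilde B_n),\qquad l(I(w))=l(J(w))=l(w)+2L(w)\ \text{ for } w\in W^c_1(\tilde B_n).$$ The injections $I$ and $J$ map first type (resp. second type) elements to first type (resp. second type) elements, and their images intersect exactly on $I(W^c_1(\tilde B_n)\sqcup W^c(D_n))$.
   Context: For $N\ge 2$, $W(\tilde B_{N+1})$ is the Coxeter group with generators $\sigma_1,\sigma_{\bar 1},\sigma_2,\dots,\sigma_N,t_{N+1}$, where $\sigma_i\sigma_{i+1}$ has order 3 for $1\le i\le N-1$, $\sigma_{\bar 1}\sigma_2$ has order 3, $\sigma_Nt_{N+1}$ has order 4, and all other pairs of distinct generators commute. $W(D_{N+1})$ is its parabolic subgroup generated by $\sigma_1,\sigma_{\bar 1},\sigma_2,\dots,\sigma_N$ (with $D_3:=A_3$). $W^c(\cdot)$ denotes the set of fully commutative elements, i.e. those for which one can pass from any reduced expression to any other using only commutation relations between generators. $l$ is Coxeter length; the affine length $L(w)$ of $w\in W(\tilde B_{N+1})$ is the number of occurrences of $t_{N+1}$ in any reduced expression of $w$. Notation: for $j\ge i\ge 2$, $\langle i,j]=\sigma_i\sigma_{i+1}\cdots\sigma_j$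 and $\langle -i,j]=\sigma_i\cdots\sigma_2\sigma_1\sigma_{\bar 1}\sigma_2\cdots\sigma_j$; for $k\ge 1$, $\langle 1,k]=\sigma_1\sigma_2\cdots\sigma_k$, $\langle -1,k]=\sigma_{\bar 1}\sigma_2\cdots\sigma_k$, $\langle 0,k]=\sigma_1\sigma_{\bar 1}\sigma_2\cdots\sigma_k$; $\langle N+1,N]=1$. Form (S) in $W^c(D_{N+1})$: every element has a unique reduced expression $\langle m_1,n_1]\cdots\langle m_r,n_r]$ with $r\ge0$, $N\ge n_1>\dots>n_r\ge 1$, $|m_i|\le n_i$, the occurrences of $1$ and $-1$ alternating, and either $m_1>\dots>m_s>|m_{s+1}|=\dots=|m_r|=1$ for some $0\le s\le r$, or $m_1>\dots>m_{r-1}>-m_r\ge 0$, $m_{r-1}>1$, $m_r\ne -1$ (conditions on $m_{r-1}$ void for $r=1$). Normal forms: every $w\in W^c(\tilde B_{N+1})$ with $L(w)\ge 2$ has a unique expression of exactly one of the following two kinds. First type: $w=\langle i,N]\,t_{N+1}(\langle -N,N]\,t_{N+1})^k\langle f,N]^{-1}$ with $k\ge1$, $-N\le i,f\le N+1$. Second type: $w=\langle i_1,N]t_{N+1}\cdots\langle i_p,N]t_{N+1}\langle j_1,N]t_{N+1}\cdots\langle j_k,N]t_{N+1}\,w_r$ with $p,k\ge0$, $p+k\ge2$, $w_r\in W^c(D_{N+1})$, where: if $k>0$, there is an integer $a$ with $j_s=(-1)^{a+s}$ ($1\le s\le k$) and $w_r=\langle(-1)^{a+k+1},r_1]\cdots\langle(-1)^{a+k+u},r_u]$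 with $u\ge 0$, $1\le r_u<\dots<r_1\le N$; if $p>0$, $N+1\ge i_1>\dots>i_{p-1}>|i_p|$, $|i_p|\ne1$ and $i_{p-1}>1$ (when $p\ge 2$); if $p>0$ and $i_p\le0$, then $k=0$, $w_r=1$, $i_p\ne -N$; if $k=0$ and $i_p>0$, $w_r$ has form (S) with $|m_1|<i_p$ (or $w_r=1$). Every $w\in W^c(\tilde B_{N+1})$ with $L(w)=1$ has a unique normal form $\langle i,N]\,t_{N+1}\,v$ with $-N\le i\le N+1$ and $v\in W^c(D_{N+1})$ written in form (S). $W^c_1(\tilde B_n)$ is the set of first type fully commutative elements of $W(\tilde B_n)$ together with the fully commutative elements of affine length 1; $W^c_2(\tilde B_n)$ is the set of second type elements; so $W^c(\tilde B_n)=W^c_1(\tilde B_n)\sqcup W^c_2(\tilde B_n)\sqcup W^c(D_n)$ (take $N=n-1$ above). Definition of $I,J$: if $w\in W^c_2(\tilde B_n)$, $I(w)$ (resp. $J(w)$) is obtained by substituting $\sigma_nt_{n+1}$ (resp. $t_{n+1}\sigma_n$) for each $t_n$ in the normal form of $w$; if $w\in W^c_1(\tilde B_n)$, $I(w)=J(w)$ is obtained by substituting $\sigma_nt_{n+1}\sigma_n$ for each $t_n$ in the normal form of $w$; if $w\in W^c(D_n)$, $I(w)=J(w)=w$. *)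

theory Defs
  imports "HOL-Algebra.Generated_Groups"
begin

section \<open>Coxeter groups\<close>

text \<open>
  A Coxeter matrix is a function m on pairs of generators, with m s s = 1; the value 0 stands for
  infinity. The Coxeter group over the generating set S is the quotient of the words over S by the
  congruence generated by (s t)^(m s t) = 1. The relations with s = t make the generators
  involutions, so this monoid presentation defines a group. An element is thus the set of all words
  that express it, and "u is an expression of w" is written u \<in> w.
\<close>

definition cox_step :: "('g \<Rightarrow> 'g \<Rightarrow> nat) \<Rightarrow> 'g set \<Rightarrow> 'g list \<Rightarrow> 'g list \<Rightarrow> bool" where
  "cox_step m S u v \<longleftrightarrow>
     (\<exists>x\<in>lists S. \<exists>y\<in>lists S. \<exists>s\<in>S. \<exists>t\<in>S.
        u = x @ concat (replicate (m s t) [s, t]) @ y \<and> v = x @ y)"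

definition cox_rel :: "('g \<Rightarrow> 'g \<Rightarrow> nat) \<Rightarrow> 'g set \<Rightarrow> ('g list \<times> 'g list) set" where
  "cox_rel m S = {(u, v). u \<in> lists S \<and> v \<in> lists S \<and> equivclp (cox_step m S) u v}"

definition cox_class :: "('g \<Rightarrow> 'g \<Rightarrow> nat) \<Rightarrow> 'g set \<Rightarrow> 'g list \<Rightarrow> 'g list set" where
  "cox_class m S u = cox_rel m S `` {u}"

definition coxeter_group :: "('g \<Rightarrow> 'g \<Rightarrow> nat) \<Rightarrow> 'g set \<Rightarrow> 'g list set monoid" where
  "coxeter_group m S =
     \<lparr>carrier = lists S // cox_rel m S,
      mult = (\<lambda>A B. \<Union>a\<in>A. \<Union>b\<in>B. cox_class m S (a @ b)),
      one = cox_class m S []\<rparr>"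

definition cox_length :: "'g list set \<Rightarrow> nat" where
  "cox_length w = (LEAST k. \<exists>u\<in>w. length u = k)"

definition reduced_expr :: "'g list set \<Rightarrow> 'g list \<Rightarrow> bool" where
  "reduced_expr w u \<longleftrightarrow> u \<in> w \<and> length u = cox_length w"

definition reduced_word :: "('g \<Rightarrow> 'g \<Rightarrow> nat) \<Rightarrow> 'g set \<Rightarrow> 'g list \<Rightarrow> bool" where
  "reduced_word m S u \<longleftrightarrow> u \<in> lists S \<and> reduced_expr (cox_class m S u) u"

definition commutation_step :: "('g \<Rightarrow> 'g \<Rightarrow> nat) \<Rightarrow> 'g list \<Rightarrow> 'g list \<Rightarrow> bool" where
  "commutation_step m u v \<longleftrightarrow>
     (\<exists>x y s t. m s t = 2 \<and> u = x @ [s, t] @ y \<and> v = x @ [t, s] @ y)"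

definition fully_commutative :: "('g \<Rightarrow> 'g \<Rightarrow> nat) \<Rightarrow> 'g list set \<Rightarrow> bool" where
  "fully_commutative m w \<longleftrightarrow>
     (\<forall>u v. reduced_expr w u \<and> reduced_expr w v \<longrightarrow> (commutation_step m)\<^sup>*\<^sup>* u v)"

lemma cox_step_lists:
  assumes "cox_step m S u v"
  shows "u \<in> lists S \<and> v \<in> lists S"
proof -
  obtain x y s t where *: "x \<in> lists S" "y \<in> lists S" "s \<in> S" "t \<in> S"
      "u = x @ concat (replicate (m s t) [s, t]) @ y" "v = x @ y"
    using assms unfolding cox_step_def by blast
  have "concat (replicate k [s, t]) \<in> lists S" for k
    using *(3,4) by (induction k) simp_all
  then show ?thesis using *(1,2) unfolding *(5,6) append_in_lists_conv by blast
qed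

lemma cox_step_context:
  assumes "cox_step m S u v" "a \<in> lists S" "b \<in> lists S"
  shows "cox_step m S (a @ u @ b) (a @ v @ b)"
proof -
  obtain x y s t where *: "x \<in> lists S" "y \<in> lists S" "s \<in> S" "t \<in> S"
      "u = x @ concat (replicate (m s t) [s, t]) @ y" "v = x @ y"
    using assms(1) unfolding cox_step_def by blast
  have "a @ x \<in> lists S" "y @ b \<in> lists S" using * assms by auto
  moreover have "a @ u @ b = (a @ x) @ concat (replicate (m s t) [s, t]) @ (y @ b)"
      "a @ v @ b = (a @ x) @ (y @ b)" using * by auto
  ultimately show ?thesis using *(3,4) unfolding cox_step_def by blast
qed

lemma equiv_cox_rel: "equiv (lists S) (cox_rel m S)"
proof (rule equivI)
  show "cox_rel m S \<subseteq> lists S \<times> lists S" by (auto simp: cox_rel_def)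
  show "refl_on (lists S) (cox_rel m S)"
    by (auto simp: refl_on_def cox_rel_def)
  show "sym (cox_rel m S)"
    unfolding sym_def cox_rel_def using equivclp_sym[of "cox_step m S"] by blast
  show "trans (cox_rel m S)"
    unfolding trans_def cox_rel_def using equivclp_trans[of "cox_step m S"] by blast
qed

lemma cox_rel_context:
  assumes "(u, v) \<in> cox_rel m S" "a \<in> lists S" "b \<in> lists S"
  shows "(a @ u @ b, a @ v @ b) \<in> cox_rel m S"
proof -
  have "equivclp (cox_step m S) u v" using assms by (auto simp: cox_rel_def)
  then have "equivclp (cox_step m S) (a @ u @ b) (a @ v @ b)"
  proof (induction rule: equivclp_induct)
    case base
    show ?case by simp
  next
    case (step y z)
    then have "equivclp (cox_step m S) (a @ y @ b) (a @ z @ b)"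
      using cox_step_context[of m S _ _ a b] assms(2,3) equivclp_sym r_into_equivclp by metis
    with step.IH show ?case by (rule equivclp_trans)
  qed
  then show ?thesis using assms by (auto simp: cox_rel_def)
qed

lemma cox_rel_append:
  assumes "(u, u') \<in> cox_rel m S" "(v, v') \<in> cox_rel m S"
  shows "(u @ v, u' @ v') \<in> cox_rel m S"
proof -
  have l: "u \<in> lists S" "u' \<in> lists S" "v \<in> lists S" "v' \<in> lists S"
    using assms by (auto simp: cox_rel_def)
  have "(u @ v, u' @ v) \<in> cox_rel m S"
    using cox_rel_context[OF assms(1), of "[]" v] l by simp
  moreover have "(u' @ v, u' @ v') \<in> cox_rel m S"
    using cox_rel_context[OF assms(2), of u' "[]"] l by simp
  ultimately show ?thesis using equiv_cox_rel by (metis equivE transE)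
qed

lemma cox_class_eq_iff:
  assumes "u \<in> lists S" "v \<in> lists S"
  shows "cox_class m S u = cox_class m S v \<longleftrightarrow> (u, v) \<in> cox_rel m S"
  unfolding cox_class_def using assms by (rule eq_equiv_class_iff[OF equiv_cox_rel])

lemma cox_class_self: "u \<in> lists S \<Longrightarrow> u \<in> cox_class m S u"
  unfolding cox_class_def by (rule equiv_class_self[OF equiv_cox_rel])

lemma carrier_coxeter_group: "carrier (coxeter_group m S) = cox_class m S ` lists S"
  by (auto simp: coxeter_group_def quotient_def cox_class_def)

lemma mult_cox_class:
  assumes "u \<in> lists S" "v \<in> lists S"
  shows "cox_class m S u \<otimes>\<^bsub>coxeter_group m S\<^esub> cox_class m S v = cox_class m S (u @ v)"
proof -
  have "cox_class m S (a @ b) = cox_class m S (u @ v)"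
    if "a \<in> cox_class m S u" "b \<in> cox_class m S v" for a b
  proof -
    have "(u, a) \<in> cox_rel m S" "(v, b) \<in> cox_rel m S"
      using that by (auto simp: cox_class_def)
    then have "(u @ v, a @ b) \<in> cox_rel m S" by (rule cox_rel_append)
    then show ?thesis
      unfolding cox_class_def using equiv_class_eq[OF equiv_cox_rel] by metis
  qed
  then have "(\<Union>a\<in>cox_class m S u. \<Union>b\<in>cox_class m S v. cox_class m S (a @ b)) =
      (\<Union>a\<in>cox_class m S u. \<Union>b\<in>cox_class m S v. cox_class m S (u @ v))"
    by (intro SUP_cong refl)
  also have "\<dots> = cox_class m S (u @ v)"
    using cox_class_self[OF assms(1), of m] cox_class_self[OF assms(2), of m] by blast
  finally show ?thesis by (simp add: coxeter_group_def)
qed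

lemma one_coxeter_group: "\<one>\<^bsub>coxeter_group m S\<^esub> = cox_class m S []"
  by (simp add: coxeter_group_def)

lemma cox_rel_rev_cancel:
  assumes "\<And>s. s \<in> S \<Longrightarrow> m s s = 1" "u \<in> lists S"
  shows "(rev u @ u, []) \<in> cox_rel m S"
  using assms(2)
proof (induction u)
  case Nil
  show ?case by (auto simp: cox_rel_def)
next
  case (Cons s u)
  then have s: "s \<in> S" and u: "u \<in> lists S" and r: "rev u \<in> lists S"
    by (auto simp: lists_eq_set)
  have "rev (s # u) @ s # u = rev u @ concat (replicate (m s s) [s, s]) @ u"
    using assms(1)[OF s] by simp
  then have "cox_step m S (rev (s # u) @ s # u) (rev u @ u)"
    unfolding cox_step_def using s u r by blast
  then have "(rev (s # u) @ s # u, rev u @ u) \<in> cox_rel m S"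
    using cox_step_lists[of m S "rev (s # u) @ s # u" "rev u @ u"]
    by (simp only: cox_rel_def mem_Collect_eq case_prod_conv r_into_equivclp simp_thms)
  with Cons.IH show ?case using equiv_cox_rel by (metis equivE transE)
qed

lemma group_coxeter_group:
  assumes "\<And>s. s \<in> S \<Longrightarrow> m s s = 1"
  shows "group (coxeter_group m S)"
proof (rule groupI)
  fix x y z
  assume "x \<in> carrier (coxeter_group m S)" "y \<in> carrier (coxeter_group m S)"
  then obtain a b where ab: "a \<in> lists S" "x = cox_class m S a" "b \<in> lists S" "y = cox_class m S b"
    unfolding carrier_coxeter_group by blast
  then have abl: "a @ b \<in> lists S" by simp
  show "x \<otimes>\<^bsub>coxeter_group m S\<^esub> y \<in> carrier (coxeter_group m S)"
    unfolding ab(2,4) mult_cox_class[OF ab(1,3)] carrier_coxeter_group using abl by (rule imageI)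
  assume "z \<in> carrier (coxeter_group m S)"
  then obtain c where c: "c \<in> lists S" "z = cox_class m S c"
    unfolding carrier_coxeter_group by blast
  then have bcl: "b @ c \<in> lists S" using ab by simp
  show "x \<otimes>\<^bsub>coxeter_group m S\<^esub> y \<otimes>\<^bsub>coxeter_group m S\<^esub> z =
      x \<otimes>\<^bsub>coxeter_group m S\<^esub> (y \<otimes>\<^bsub>coxeter_group m S\<^esub> z)"
    unfolding ab(2,4) c(2) mult_cox_class[OF ab(1,3)] mult_cox_class[OF ab(3) c(1)]
      mult_cox_class[OF abl c(1)] mult_cox_class[OF ab(1) bcl] append_assoc ..
next
  show "\<one>\<^bsub>coxeter_group m S\<^esub> \<in> carrier (coxeter_group m S)"
    unfolding carrier_coxeter_group one_coxeter_group by (rule imageI) simp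
next
  fix x assume "x \<in> carrier (coxeter_group m S)"
  then obtain u where u: "u \<in> lists S" "x = cox_class m S u"
    unfolding carrier_coxeter_group by blast
  show "\<one>\<^bsub>coxeter_group m S\<^esub> \<otimes>\<^bsub>coxeter_group m S\<^esub> x = x"
    unfolding one_coxeter_group u(2) mult_cox_class[OF lists.Nil u(1)] append_Nil ..
  have r: "rev u \<in> lists S" using u(1) by (simp add: lists_eq_set)
  then have ru: "rev u @ u \<in> lists S" using u(1) by simp
  have "cox_class m S (rev u) \<otimes>\<^bsub>coxeter_group m S\<^esub> x = \<one>\<^bsub>coxeter_group m S\<^esub>"
    unfolding one_coxeter_group u(2) mult_cox_class[OF r u(1)] cox_class_eq_iff[OF ru lists.Nil]
    using assms u(1) by (rule cox_rel_rev_cancel)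
  moreover have "cox_class m S (rev u) \<in> carrier (coxeter_group m S)"
    unfolding carrier_coxeter_group using r by (rule imageI)
  ultimately show "\<exists>y\<in>carrier (coxeter_group m S).
      y \<otimes>\<^bsub>coxeter_group m S\<^esub> x = \<one>\<^bsub>coxeter_group m S\<^esub>" ..
qed


section \<open>The groups of type B-tilde\<close>

text \<open>
  Sigma i, SigmaBar and Tgen n are the generators \<sigma>_i, \<sigma>_(bar 1) and t_n. The type B-tilde is indexed
  by its subscript n \<ge> 3, so that N = n - 1.
\<close>

datatype gen = Sigma nat | SigmaBar | Tgen nat

definition gens_D :: "nat \<Rightarrow> gen set" where
  "gens_D n = insert SigmaBar (Sigma ` {1..n - 1})"

definition gens_B :: "nat \<Rightarrow> gen set" where
  "gens_B n = insert (Tgen n) (gens_D n)"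

definition cox_B :: "nat \<Rightarrow> gen \<Rightarrow> gen \<Rightarrow> nat" where
  "cox_B n s t =
     (if s = t then 1
      else if {s, t} = {Sigma (n - 1), Tgen n} then 4
      else if {s, t} = {SigmaBar, Sigma 2} then 3
      else if \<exists>i. 1 \<le> i \<and> i + 1 \<le> n - 1 \<and> {s, t} = {Sigma i, Sigma (i + 1)} then 3
      else 2)"

definition W_B :: "nat \<Rightarrow> gen list set monoid" where
  "W_B n = coxeter_group (cox_B n) (gens_B n)"

abbreviation class_B :: "nat \<Rightarrow> gen list \<Rightarrow> gen list set" where
  "class_B n \<equiv> cox_class (cox_B n) (gens_B n)"

lemma group_W_B: "group (W_B n)"
  unfolding W_B_def by (rule group_coxeter_group) (simp add: cox_B_def)

definition W_D :: "nat \<Rightarrow> gen list set set" where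
  "W_D n = generate (W_B n) ((\<lambda>s. class_B n [s]) ` gens_D n)"

definition Wc_B :: "nat \<Rightarrow> gen list set set" where
  "Wc_B n = {w \<in> carrier (W_B n). fully_commutative (cox_B n) w}"

text \<open>
  Reduced expressions of elements of a parabolic subgroup only use its generators, so full
  commutativity in W(D_n) and in W(B-tilde_n) agree.
\<close>

definition Wc_D :: "nat \<Rightarrow> gen list set set" where
  "Wc_D n = {w \<in> W_D n. fully_commutative (cox_B n) w}"

definition affine_length :: "nat \<Rightarrow> gen list set \<Rightarrow> nat" where
  "affine_length n w = (THE k. \<forall>u. reduced_expr w u \<longrightarrow> count_list u (Tgen n) = k)"


section \<open>Normal forms\<close>

text \<open>The word of \<langle>m, j]. For m = j + 1 \<ge> 2 this is the empty word.\<close>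

definition bracket :: "int \<Rightarrow> nat \<Rightarrow> gen list" where
  "bracket m j =
     (if m \<ge> 1 then map Sigma [nat m..<Suc j]
      else if m = 0 then Sigma 1 # SigmaBar # map Sigma [2..<Suc j]
      else if m = - 1 then SigmaBar # map Sigma [2..<Suc j]
      else rev (map Sigma [2..<Suc (nat (- m))]) @ Sigma 1 # SigmaBar # map Sigma [2..<Suc j])"

text \<open>
  Form (S) with parameters m_1, ..., m_r and n_1, ..., n_r. In the first alternative the chain
  m_1 > ... > m_s > |m_(s+1)| = ... = 1 is read as m_1 > ... > m_s > 1 also for s = r.
\<close>

definition form_S :: "nat \<Rightarrow> int list \<Rightarrow> nat list \<Rightarrow> bool" where
  "form_S N ms ns \<longleftrightarrow>
     length ms = length ns \<and>
     sorted_wrt (>) ns \<and> set ns \<subseteq> {1..N} \<and>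
     (\<forall>i<length ms. \<bar>ms ! i\<bar> \<le> int (ns ! i)) \<and>
     successively (\<noteq>) (filter (\<lambda>m. \<bar>m\<bar> = 1) ms) \<and>
     ((\<exists>s\<le>length ms. sorted_wrt (>) (take s ms) \<and> (\<forall>m\<in>set (take s ms). m > 1) \<and>
                     (\<forall>m\<in>set (drop s ms). \<bar>m\<bar> = 1)) \<or>
      (ms \<noteq> [] \<and> sorted_wrt (>) (butlast ms) \<and>
       (\<forall>m\<in>set (butlast ms). m > - last ms \<and> m > 1) \<and>
       - last ms \<ge> 0 \<and> last ms \<noteq> - 1))"

definition word_S :: "int list \<Rightarrow> nat list \<Rightarrow> gen list" where
  "word_S ms ns = concat (map2 bracket ms ns)"

definition NF_D :: "nat \<Rightarrow> gen list set" where
  "NF_D n = {word_S ms ns | ms ns. form_S (n - 1) ms ns}"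

definition bracket_t :: "nat \<Rightarrow> int \<Rightarrow> gen list" where
  "bracket_t n i = bracket i (n - 1) @ [Tgen n]"

definition NF_one :: "nat \<Rightarrow> gen list set" where
  "NF_one n = {bracket_t n i @ v | i v. - int (n - 1) \<le> i \<and> i \<le> int n \<and> v \<in> NF_D n}"

definition NF_first :: "nat \<Rightarrow> gen list set" where
  "NF_first n =
     {bracket_t n i @ concat (replicate k (bracket_t n (- int (n - 1)))) @ rev (bracket f (n - 1))
      | i k f. 1 \<le> k \<and> - int (n - 1) \<le> i \<and> i \<le> int n \<and> - int (n - 1) \<le> f \<and> f \<le> int n}"

text \<open>
  In the second type, is = [i_1, ..., i_p] and js = [j_1, ..., j_k] (list positions start at 0). The
  integer a matters only modulo 2, hence may be taken to be a natural number.
\<close>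

definition NF_second :: "nat \<Rightarrow> gen list set" where
  "NF_second n =
     {concat (map (bracket_t n) is) @ concat (map (bracket_t n) js) @ v | is js v.
        length is + length js \<ge> 2 \<and>
        v \<in> NF_D n \<and>
        (js \<noteq> [] \<longrightarrow>
           (\<exists>a::nat. (\<forall>s\<in>{1..length js}. js ! (s - 1) = (- 1) ^ (a + s)) \<and>
              (\<exists>rs. sorted_wrt (>) rs \<and> set rs \<subseteq> {1..n - 1} \<and>
                 v = word_S (map (\<lambda>q. (- 1) ^ (a + length js + q)) [1..<Suc (length rs)]) rs))) \<and>
        (is \<noteq> [] \<longrightarrow>
           set is \<subseteq> {- int (n - 1)..int n} \<and>
           sorted_wrt (>) (butlast is) \<and> \<bar>last is\<bar> \<noteq> 1 \<and>
           (length is \<ge> 2 \<longrightarrow> is ! (length is - 2) > \<bar>last is\<bar> \<and> is ! (length is - 2) > 1)) \<and>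
        (is \<noteq> [] \<and> last is \<le> 0 \<longrightarrow> js = [] \<and> v = [] \<and> last is \<noteq> - int (n - 1)) \<and>
        (js = [] \<and> last is > 0 \<longrightarrow>
           (\<exists>ms ns. form_S (n - 1) ms ns \<and> v = word_S ms ns \<and>
                    (ms \<noteq> [] \<longrightarrow> \<bar>hd ms\<bar> < last is)))}"

definition first_type :: "nat \<Rightarrow> gen list set set" where
  "first_type n = {w \<in> Wc_B n. affine_length n w \<ge> 2 \<and> (\<exists>u\<in>w. u \<in> NF_first n)}"

definition Wc1 :: "nat \<Rightarrow> gen list set set" where
  "Wc1 n = first_type n \<union> {w \<in> Wc_B n. affine_length n w = 1}"

definition Wc2 :: "nat \<Rightarrow> gen list set set" where
  "Wc2 n = {w \<in> Wc_B n. affine_length n w \<ge> 2 \<and> (\<exists>u\<in>w. u \<in> NF_second n)}"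

definition normal_form :: "nat \<Rightarrow> gen list set \<Rightarrow> gen list" where
  "normal_form n w =
     (THE u. u \<in> w \<and>
        u \<in> (if w \<in> Wc_D n then NF_D n
             else if affine_length n w = 1 then NF_one n
             else NF_first n \<union> NF_second n))"


section \<open>The maps I and J\<close>

definition subst_t :: "nat \<Rightarrow> gen list \<Rightarrow> gen list \<Rightarrow> gen list" where
  "subst_t n r u = concat (map (\<lambda>s. if s = Tgen n then r else [s]) u)"

definition I_expr :: "nat \<Rightarrow> gen list set \<Rightarrow> gen list" where
  "I_expr n w =
     (if w \<in> Wc2 n then subst_t n [Sigma n, Tgen (n + 1)] (normal_form n w)
      else if w \<in> Wc1 n then subst_t n [Sigma n, Tgen (n + 1), Sigma n] (normal_form n w)
      else normal_form n w)"

definition J_expr :: "nat \<Rightarrow> gen list set \<Rightarrow> gen list" where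
  "J_expr n w =
     (if w \<in> Wc2 n then subst_t n [Tgen (n + 1), Sigma n] (normal_form n w)
      else if w \<in> Wc1 n then subst_t n [Sigma n, Tgen (n + 1), Sigma n] (normal_form n w)
      else normal_form n w)"

text \<open>
  On W^c(D_n) these maps are the inclusion W(D_n) \<subseteq> W(D_(n+1)), which sends the class of a word in
  W(B-tilde_n) to the class of the same word in W(B-tilde_(n+1)).
\<close>

definition I_map :: "nat \<Rightarrow> gen list set \<Rightarrow> gen list set" where
  "I_map n w = class_B (n + 1) (I_expr n w)"

definition J_map :: "nat \<Rightarrow> gen list set \<Rightarrow> gen list set" where
  "J_map n w = class_B (n + 1) (J_expr n w)"

end

theory Submission
  imports Defs "HOL-Library.Multiset"
begin

text \<open>
  Call a word good if no commutations turn it into a word with a factor s s or with a braid of length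
  at least 3. The exchange condition shows that a good word is reduced and that the reduced
  expressions of its element are exactly the words of its commutation class; so the good words are
  the reduced expressions of fully commutative elements. Goodness can be read off from the letters
  between consecutive occurrences of each generator.

  Using commutations only, a good word becomes \<langle>i_1, N] t ... \<langle>i_L, N] t v with v a product of
  brackets, and goodness constrains consecutive brackets so strongly that only the normal forms
  remain. Normal forms are separated by an action on the integer lattice, because the brackets
  represent the cosets of a parabolic subgroup.

  In a normal form of the second type, no two consecutive \<sigma>_N enclose a single t_n alone, and in one of
  the first type two consecutive t_n enclose two \<sigma>_N; therefore the substitutions preserve goodness. They
  turn normal forms into normal forms, for J after moving each t_(n+1) to the left of its block.
  Deleting t_(n+1) and renaming \<sigma>_n to t_n recovers the commutation class of the original word, which
  gives injectivity. Finally, the letters \<sigma>_n and t_(n+1) alternate in both images of a second type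
  element, starting with \<sigma>_n for I and with t_(n+1) for J, so the two images differ.
\<close>

section \<open>Fully commutative elements\<close>

text \<open>Words are controlled in two ways. The exchange condition comes from the presentation
  alone: the parity with which a reflection is attached to the prefixes of a word is unchanged by
  the relations. That short alternating words stay distinct in the group is invisible there and
  comes from a concrete action, which only has to separate a few elements and cosets. The obstacle
  in passing from n to n + 1 is that the label 4 moves from the edge between \<sigma>_(n-1) and t_n
  to the edge between \<sigma>_n and t_(n+1), while the old edge gets label 3. A generator may
  enclose a single neighbour only along an edge labelled 4, so such places must gain a second
  neighbour. In the second type only t_n encloses a single neighbour, in the first type only
  \<sigma>_(n-1); this asymmetry is why the first type needs the longer word \<sigma>_n t_(n+1)
  \<sigma>_n. Elements of affine length 1 behave like the first type, since a single t_n encloses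
  nothing. Their candidate normal forms, however, include words that are not good, so their
  uniqueness has to be argued in the group and not by commutations.\<close>

text \<open>The last three assumptions say that s t has order exactly m s t.\<close>

locale small_coxeter =
  fixes m :: "'g \<Rightarrow> 'g \<Rightarrow> nat" and S :: "'g set"
  assumes m_sym: "m s t = m t s"
    and m_one: "m s t = 1 \<longleftrightarrow> s = t"
    and m_range: "m s t \<in> {1, 2, 3, 4}"
    and gen_neq: "s \<in> S \<Longrightarrow> t \<in> S \<Longrightarrow> s \<noteq> t \<Longrightarrow> ([s], [t]) \<notin> cox_rel m S"
    and gen_order3: "s \<in> S \<Longrightarrow> t \<in> S \<Longrightarrow> 3 \<le> m s t \<Longrightarrow> ([s, t], [t, s]) \<notin> cox_rel m S"
    and gen_order4: "s \<in> S \<Longrightarrow> t \<in> S \<Longrightarrow> m s t = 4 \<Longrightarrow> ([s, t, s], [t, s, t]) \<notin> cox_rel m S"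
begin

section \<open>Calculation with words modulo the defining relations\<close>

abbreviation eqv :: "'g list \<Rightarrow> 'g list \<Rightarrow> bool" (infix "\<approx>" 50) where
  "u \<approx> v \<equiv> (u, v) \<in> cox_rel m S"

abbreviation ceq :: "'g list \<Rightarrow> 'g list \<Rightarrow> bool" (infix "\<sim>" 50) where
  "u \<sim> v \<equiv> (commutation_step m)\<^sup>*\<^sup>* u v"

abbreviation cls :: "'g list \<Rightarrow> 'g list set" where "cls \<equiv> cox_class m S"

lemma eqvD: "u \<approx> v \<Longrightarrow> u \<in> lists S \<and> v \<in> lists S"
  by (auto simp: cox_rel_def)

lemma eqv_refl: "u \<in> lists S \<Longrightarrow> u \<approx> u"
  by (auto simp: cox_rel_def)

lemma eqv_sym: "u \<approx> v \<Longrightarrow> v \<approx> u"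
  using equiv_cox_rel by (metis equivE symE)

lemma eqv_trans [trans]: "u \<approx> v \<Longrightarrow> v \<approx> w \<Longrightarrow> u \<approx> w"
  using equiv_cox_rel by (metis equivE transE)

lemma step_eqv: "cox_step m S u v \<Longrightarrow> u \<approx> v"
  using cox_step_lists[of m S u v] by (auto simp: cox_rel_def)

lemma cls_eq_iff: "u \<in> lists S \<Longrightarrow> v \<in> lists S \<Longrightarrow> cls u = cls v \<longleftrightarrow> u \<approx> v"
  by (rule cox_class_eq_iff)

lemma mem_cls_iff: "v \<in> cls u \<longleftrightarrow> u \<approx> v"
  by (simp add: cox_class_def)

lemma eqv_context: "u \<approx> v \<Longrightarrow> a \<in> lists S \<Longrightarrow> b \<in> lists S \<Longrightarrow> a @ u @ b \<approx> a @ v @ b"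
  by (rule cox_rel_context)

lemma eqv_left: "u \<approx> v \<Longrightarrow> a \<in> lists S \<Longrightarrow> a @ u \<approx> a @ v"
  using eqv_context[of u v a "[]"] by simp

lemma eqv_right: "u \<approx> v \<Longrightarrow> b \<in> lists S \<Longrightarrow> u @ b \<approx> v @ b"
  using eqv_context[of u v "[]" b] by simp

lemma eqv_Cons: "u \<approx> v \<Longrightarrow> a \<in> S \<Longrightarrow> a # u \<approx> a # v"
  using eqv_left[of u v "[a]"] by simp

lemma rev_lists: "u \<in> lists S \<Longrightarrow> rev u \<in> lists S"
  by (simp add: lists_eq_set)

lemma rev_cancel: "u \<in> lists S \<Longrightarrow> rev u @ u \<approx> []"
  using cox_rel_rev_cancel[of S m u] m_one by simp

lemma rev_cancel': "u \<in> lists S \<Longrightarrow> u @ rev u \<approx> []"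
  using rev_cancel[of "rev u"] rev_lists by simp

lemma eqv_cancel_left:
  assumes "a @ u \<approx> a @ v"
  shows "u \<approx> v"
proof -
  have l: "a \<in> lists S" "u \<in> lists S" "v \<in> lists S" using eqvD[OF assms] by auto
  have "u \<approx> (rev a @ a) @ u"
    using eqv_sym[OF eqv_right[OF rev_cancel[OF l(1)] l(2)]] by simp
  also have "(rev a @ a) @ u \<approx> rev a @ a @ v"
    using eqv_left[OF assms rev_lists[OF l(1)]] by simp
  also have "rev a @ a @ v \<approx> v"
    using eqv_right[OF rev_cancel[OF l(1)] l(3)] by simp
  finally show ?thesis .
qed

lemma eqv_cancel_Cons: "a # u \<approx> a # v \<Longrightarrow> u \<approx> v"
  using eqv_cancel_left[of "[a]"] by simp

text \<open>Generators are involutions, so reversing a word inverts its element. Right cancellation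
  follows from left cancellation in this way.\<close>

lemma eqv_rev:
  assumes "u \<approx> v"
  shows "rev u \<approx> rev v"
proof -
  have l: "u \<in> lists S" "v \<in> lists S" using eqvD[OF assms] by auto
  have "u @ rev u \<approx> u @ rev v"
  proof -
    have "u @ rev v \<approx> v @ rev v" using eqv_right[OF assms rev_lists[OF l(2)]] .
    also have "v @ rev v \<approx> []" using rev_cancel'[OF l(2)] .
    also have "[] \<approx> u @ rev u" using eqv_sym[OF rev_cancel'[OF l(1)]] .
    finally show ?thesis by (rule eqv_sym)
  qed
  then show ?thesis by (rule eqv_cancel_left)
qed

lemma eqv_cancel_right:
  assumes "u @ b \<approx> v @ b"
  shows "u \<approx> v"
proof -
  have "rev b @ rev u \<approx> rev b @ rev v" using eqv_rev[OF assms] by simp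
  then have "rev (rev u) \<approx> rev (rev v)" using eqv_rev eqv_cancel_left by blast
  then show ?thesis by simp
qed

lemma eqv_square: "s \<in> S \<Longrightarrow> s # s # u \<approx> v \<longleftrightarrow> u \<approx> v" if "u \<in> lists S"
proof -
  assume s: "s \<in> S"
  have "[s, s] @ u \<approx> [] @ u" using eqv_right[OF rev_cancel[of "[s]"] that] s by simp
  then show ?thesis using eqv_sym eqv_trans by (metis append_Cons append_Nil)
qed

lemma eqv_move:
  assumes "s # u \<approx> v"
  shows "u \<approx> s # v"
proof -
  have l: "s \<in> S" "u \<in> lists S" using eqvD[OF assms] by auto
  have "s # s # u \<approx> s # v" using eqv_Cons[OF assms] l by simp
  then show ?thesis using eqv_square[OF l(2) l(1)] by simp
qed

lemma eqv_braid_power: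
  assumes "s \<in> S" "t \<in> S"
  shows "concat (replicate (m s t) [s, t]) \<approx> []"
proof -
  have "cox_step m S (concat (replicate (m s t) [s, t])) []"
    unfolding cox_step_def using assms
    by (intro bexI[of _ "[]"] bexI[of _ s] bexI[of _ t]) auto
  then show ?thesis by (rule step_eqv)
qed

lemma eqv_commute:
  assumes "s \<in> S" "t \<in> S" "m s t = 2"
  shows "[s, t] \<approx> [t, s]"
proof -
  have "[s, t, s, t] \<approx> []" using eqv_braid_power[OF assms(1,2)] assms(3)
    by (simp add: numeral_2_eq_2)
  then have "[s, t] \<approx> [t, s]" using eqv_move[THEN eqv_move, of s t "[s,t]" "[]"] eqv_sym by blast
  then show ?thesis .
qed

lemma eqv_braid3:
  assumes "s \<in> S" "t \<in> S" "m s t = 3"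
  shows "[s, t, s] \<approx> [t, s, t]"
proof -
  have "[s, t, s, t, s, t] \<approx> []" using eqv_braid_power[OF assms(1,2)] assms(3)
    by (simp add: numeral_3_eq_3)
  then show ?thesis
    using eqv_move[THEN eqv_move, THEN eqv_move, of s t s "[t,s,t]" "[]"] eqv_sym by blast
qed

lemma eqv_braid4:
  assumes "s \<in> S" "t \<in> S" "m s t = 4"
  shows "[s, t, s, t] \<approx> [t, s, t, s]"
proof -
  have 4: "(4::nat) = Suc (Suc (Suc (Suc 0)))" by simp
  have "[s, t, s, t, s, t, s, t] \<approx> []" using eqv_braid_power[OF assms(1,2)] assms(3)
    by (simp add: 4)
  then show ?thesis
    using eqv_move[THEN eqv_move, THEN eqv_move, THEN eqv_move, of s t s t "[s,t,s,t]" "[]"] eqv_sym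
    by blast
qed

subsection \<open>The exchange condition\<close>

text \<open>The reflections attached to the successive prefixes of a word, conjugated by
  \<open>p\<close>. The accumulated prefix makes the list additive under concatenation; the parity
  of each reflection in it is the classical invariant behind the exchange condition.\<close>

fun reflections :: "'g list \<Rightarrow> 'g list \<Rightarrow> 'g list set list" where
  "reflections p [] = []"
| "reflections p (s # u) = cls (p @ [s] @ rev p) # reflections (p @ [s]) u"

lemma reflections_append: "reflections p (u @ v) = reflections p u @ reflections (p @ u) v"
  by (induction u arbitrary: p) auto

lemma reflections_cong:
  assumes "p \<approx> q" "u \<in> lists S"
  shows "reflections p u = reflections q u"
  using assms
proof (induction u arbitrary: p q)
  case (Cons s u)
  then have s: "s \<in> S" and l: "p \<in> lists S" "q \<in> lists S" using eqvD by auto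
  have "p @ [s] @ rev p \<approx> q @ [s] @ rev q"
  proof -
    have "p @ [s] @ rev p \<approx> q @ [s] @ rev p"
      by (rule eqv_right[OF Cons.prems(1)]) (use s l rev_lists in auto)
    also have "q @ [s] @ rev p \<approx> q @ [s] @ rev q"
      using eqv_left[OF eqv_rev[OF Cons.prems(1)], of "q @ [s]"] s l by simp
    finally show ?thesis .
  qed
  moreover have "p @ [s] \<approx> q @ [s]" using eqv_right Cons.prems(1) s by simp
  ultimately show ?case using Cons.IH[of "p @ [s]" "q @ [s]"] Cons.prems s l rev_lists
    by (auto simp: cls_eq_iff)
qed simp

text \<open>With m = \<open>m s t\<close>, the list has 2m entries. Those at positions i and i + m
  differ by a factor (s t)^m inside the conjugate, so they are equal in the group and every class is
  met an even number of times.\<close>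

lemma reflections_power:
  assumes "s \<in> S" "t \<in> S" "p \<in> lists S"
  shows "even (count_list (reflections p (concat (replicate (m s t) [s, t]))) X)"
proof -
  let ?D = "concat (replicate (m s t) [s, t])"
  have *: "cls (p @ a @ b @ rev p) = cls (p @ b @ rev p)"
    if "a = ?D" "b \<in> lists S" for a b
  proof -
    have l: "a \<in> lists S" using eqv_braid_power[OF assms(1,2)] eqvD that(1) by blast
    have "a \<approx> []" using eqv_braid_power[OF assms(1,2)] that(1) by simp
    then have "p @ a @ (b @ rev p) \<approx> p @ [] @ (b @ rev p)"
      by (rule eqv_context) (use assms that rev_lists in auto)
    then show ?thesis using assms that rev_lists l by (simp add: cls_eq_iff)
  qed
  consider "m s t = 1" | "m s t = 2" | "m s t = 3" | "m s t = 4" using m_range[of s t] by auto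
  then show ?thesis
  proof cases
    case 1
    then have "s = t" using m_one by simp
    then show ?thesis using 1 *[of "[s,t]" "[t]"] assms by simp
  next
    case 2
    then have "m s t = Suc (Suc 0)" by simp
    then show ?thesis
      using *[of "[s,t,s,t]" "[s]"] *[of "[s,t,s,t]" "[s,t,s]"] assms
      by simp
  next
    case 3
    then have "m s t = Suc (Suc (Suc 0))" by simp
    then show ?thesis
      using *[of "[s,t,s,t,s,t]" "[s]"] *[of "[s,t,s,t,s,t]" "[s,t,s]"]
        *[of "[s,t,s,t,s,t]" "[s,t,s,t,s]"] assms
      by simp
  next
    case 4
    then have "m s t = Suc (Suc (Suc (Suc 0)))" by simp
    then show ?thesis
      using *[of "[s,t,s,t,s,t,s,t]" "[s]"] *[of "[s,t,s,t,s,t,s,t]" "[s,t,s]"]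
        *[of "[s,t,s,t,s,t,s,t]" "[s,t,s,t,s]"] *[of "[s,t,s,t,s,t,s,t]" "[s,t,s,t,s,t,s]"] assms
      by simp
  qed
qed

text \<open>Inserting a trivial power adds an even number of occurrences and leaves the later
  entries alone, because the prefix in front of them is unchanged in the group.\<close>

lemma reflections_parity:
  assumes "u \<approx> v" "p \<in> lists S"
  shows "even (count_list (reflections p u) X) = even (count_list (reflections p v) X)"
proof -
  have *: "even (count_list (reflections p a) X) = even (count_list (reflections p b) X)"
    if "cox_step m S a b" for a b
  proof -
    obtain x y s t where *: "x \<in> lists S" "y \<in> lists S" "s \<in> S" "t \<in> S"
        "a = x @ concat (replicate (m s t) [s, t]) @ y" "b = x @ y"
      using \<open>cox_step m S a b\<close> unfolding cox_step_def by blast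
    let ?D = "concat (replicate (m s t) [s, t])"
    have "(p @ x) @ ?D \<approx> (p @ x) @ []"
      using eqv_braid_power[OF *(3,4)] by (rule eqv_left) (use * assms in auto)
    then have "reflections (p @ x @ ?D) y = reflections (p @ x) y"
      using reflections_cong[of "(p @ x) @ ?D" "p @ x" y] * by simp
    then show ?thesis
      using reflections_power[OF *(3,4), of "p @ x" X] * assms
      by (simp add: reflections_append)
  qed
  have "equivclp (cox_step m S) u v" using assms by (auto simp: cox_rel_def)
  then show ?thesis
  proof (induction rule: equivclp_induct)
    case (step y z)
    then show ?case using *[of y z] *[of z y] by blast
  qed simp
qed

lemma reflections_memE:
  assumes "X \<in> set (reflections p u)"
  obtains u1 x u2 where "u = u1 @ x # u2" "X = cls (p @ u1 @ [x] @ rev u1 @ rev p)"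
  using assms
proof (induction u arbitrary: p thesis)
  case (Cons s u)
  show ?case
  proof (cases "X = cls (p @ [s] @ rev p)")
    case True
    then show ?thesis using Cons.prems(1)[of "[]" s u] by simp
  next
    case False
    then have "X \<in> set (reflections (p @ [s]) u)" using Cons.prems by auto
    then obtain u1 x u2 where "u = u1 @ x # u2" "X = cls ((p @ [s]) @ u1 @ [x] @ rev u1 @ rev (p @ [s]))"
      using Cons.IH by blast
    then show ?thesis using Cons.prems(1)[of "s # u1" x u2] by simp
  qed
qed simp

text \<open>Conjugation by \<open>s\<close> is injective and fixes the reflection \<open>s\<close>,
  so the occurrences of \<open>s\<close> stay where they are.\<close>

lemma count_reflections_conj:
  assumes "s \<in> S" "v \<in> lists S" "p \<in> lists S"
  shows "count_list (reflections (s # p) v) (cls [s]) = count_list (reflections p v) (cls [s])"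
  using assms
proof (induction v arbitrary: p)
  case (Cons x v)
  let ?w = "p @ [x] @ rev p"
  have l: "?w \<in> lists S" using Cons.prems rev_lists by auto
  have "s # ?w @ [s] \<approx> [s] \<longleftrightarrow> ?w \<approx> [s]"
  proof
    assume "s # ?w @ [s] \<approx> [s]"
    then have "?w @ [s] \<approx> [s] @ [s]" using eqv_move by fastforce
    then show "?w \<approx> [s]" by (rule eqv_cancel_right)
  next
    assume "?w \<approx> [s]"
    then have "[s] @ ?w @ [s] \<approx> [s] @ [s] @ [s]"
      by (rule eqv_context) (use Cons.prems in auto)
    moreover have "[s, s, s] \<approx> [s]" using eqv_square[of "[s]" s "[s]"] eqv_refl Cons.prems by simp
    ultimately show "s # ?w @ [s] \<approx> [s]" using eqv_trans by auto
  qed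
  then have "cls (s # ?w @ [s]) = cls [s] \<longleftrightarrow> cls ?w = cls [s]"
    using l Cons.prems by (subst (1 2) cls_eq_iff) auto
  moreover have "count_list (reflections (s # p @ [x]) v) (cls [s]) =
      count_list (reflections (p @ [x]) v) (cls [s])"
    using Cons.IH[of "p @ [x]"] Cons.prems by simp
  ultimately show ?case by simp
qed simp

lemma reduced_word_iff:
  "reduced_word m S u \<longleftrightarrow> u \<in> lists S \<and> (\<forall>v. u \<approx> v \<longrightarrow> length u \<le> length v)"
proof -
  have "cox_length (cls u) = length u \<longleftrightarrow> (\<forall>v. u \<approx> v \<longrightarrow> length u \<le> length v)"
    if "u \<in> lists S"
  proof -
    have u: "\<exists>v\<in>cls u. length v = length u" using cox_class_self[OF that] by blast
    have "cox_length (cls u) \<le> length v" if "v \<in> cls u" for v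
      unfolding cox_length_def by (rule Least_le) (use that in blast)
    moreover have "\<exists>v\<in>cls u. length v = cox_length (cls u)"
      unfolding cox_length_def using LeastI[of "\<lambda>k. \<exists>v\<in>cls u. length v = k"] u by blast
    ultimately show ?thesis using u unfolding mem_cls_iff[symmetric]
      by (metis le_antisym)
  qed
  then show ?thesis
    unfolding reduced_word_def reduced_expr_def using cox_class_self by metis
qed

text \<open>The deleted letter is the one whose reflection equals \<open>s\<close>. The relation for
  the prefix \<open>u1\<close> is part of the conclusion because it later shows that
  \<open>u1\<close> is not a short alternating word.\<close>

lemma exchange:
  assumes "reduced_word m S u" "s \<in> S" "\<not> reduced_word m S (s # u)"
  obtains u1 x u2 where "u = u1 @ x # u2" "s # u1 \<approx> u1 @ [x]" "u \<approx> s # u1 @ u2"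
proof -
  have u: "u \<in> lists S" "\<And>v. u \<approx> v \<Longrightarrow> length u \<le> length v"
    using assms(1) by (auto simp: reduced_word_iff)
  obtain v where v: "s # u \<approx> v" "length v \<le> length u"
    using assms u by (auto simp: reduced_word_iff not_le)
  then have vl: "v \<in> lists S" using eqvD by blast
  have uv: "u \<approx> s # v" using eqv_move[OF v(1)] .
  \<comment> \<open>Otherwise \<open>s\<close> occurs an even number of times for \<open>u\<close>,
    hence for \<open>s # v\<close>, hence an odd number of times for \<open>v\<close>. Then
    \<open>s # v\<close> equals \<open>v\<close> with one letter deleted, an expression shorter than
    the reduced word \<open>u\<close>.\<close>
  have "cls [s] \<in> set (reflections [] u)"
  proof (rule ccontr)
    assume "cls [s] \<notin> set (reflections [] u)"
    then have "count_list (reflections [] u) (cls [s]) = 0" by (simp add: count_list_0_iff)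
    then have "even (count_list (reflections [] (s # v)) (cls [s]))"
      using reflections_parity[OF uv, of "[]" "cls [s]"] by (metis even_zero lists.Nil)
    moreover have "count_list (reflections [] (s # v)) (cls [s]) =
        Suc (count_list (reflections [] v) (cls [s]))"
      using count_reflections_conj[OF assms(2) vl, of "[]"] by simp
    ultimately have "cls [s] \<in> set (reflections [] v)"
      by (metis count_notin even_Suc even_zero)
    then obtain v1 x v2 where v12: "v = v1 @ x # v2" "cls [s] = cls (v1 @ [x] @ rev v1)"
      using reflections_memE[of "cls [s]" "[]" v] by (metis append.right_neutral append_Nil rev.simps(1))
    have l: "v1 \<in> lists S" "x \<in> S" "v2 \<in> lists S" using vl v12 by auto
    have "[s] \<approx> v1 @ [x] @ rev v1"
      using v12(2) l assms(2) rev_lists by (subst (asm) cls_eq_iff) auto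
    then have "[s] @ v1 @ [x] @ v2 \<approx> (v1 @ [x] @ rev v1) @ v1 @ [x] @ v2"
      by (rule eqv_right) (use l in auto)
    also have "(v1 @ [x] @ rev v1) @ v1 @ [x] @ v2 \<approx> v1 @ [x] @ [x] @ v2"
      using eqv_context[OF rev_cancel[OF l(1)], of "v1 @ [x]" "[x] @ v2"] l by simp
    also have "v1 @ [x] @ [x] @ v2 \<approx> v1 @ v2"
      using eqv_context[OF rev_cancel[of "[x]"], of v1 v2] l by simp
    finally have "u \<approx> v1 @ v2" using uv v12(1) eqv_trans by simp
    then have "length u \<le> length (v1 @ v2)" using u by blast
    then show False using v(2) v12(1) by simp
  qed
  then obtain u1 x u2 where u12: "u = u1 @ x # u2" "cls [s] = cls (u1 @ [x] @ rev u1)"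
    using reflections_memE[of "cls [s]" "[]" u] by (metis append.right_neutral append_Nil rev.simps(1))
  have l: "u1 \<in> lists S" "x \<in> S" using u u12 by auto
  have "[s] \<approx> u1 @ [x] @ rev u1"
    using u12(2) l assms(2) rev_lists by (subst (asm) cls_eq_iff) auto
  then have "[s] @ u1 \<approx> (u1 @ [x] @ rev u1) @ u1" by (rule eqv_right) (use l in auto)
  also have "(u1 @ [x] @ rev u1) @ u1 \<approx> u1 @ [x]"
    using eqv_left[OF rev_cancel[OF l(1)], of "u1 @ [x]"] l by simp
  finally have su1: "s # u1 \<approx> u1 @ [x]" by simp
  have "u2 \<in> lists S" using u u12 by simp
  then have "(u1 @ [x]) @ u2 \<approx> (s # u1) @ u2" using eqv_right[OF eqv_sym[OF su1]] by blast
  then show thesis using that u12(1) su1 by simp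
qed

end

context small_coxeter
begin

subsection \<open>Commutation classes\<close>

lemma step_context:
  "commutation_step m u v \<Longrightarrow> commutation_step m (a @ u @ b) (a @ v @ b)"
  unfolding commutation_step_def by (metis append.assoc)

lemma step_sym: "commutation_step m u v \<Longrightarrow> commutation_step m v u"
  unfolding commutation_step_def using m_sym by metis

lemma ceq_sym: "u \<sim> v \<Longrightarrow> v \<sim> u"
  by (metis step_sym symp_rtranclp sympD sympI)

lemma ceq_trans [trans]: "u \<sim> v \<Longrightarrow> v \<sim> w \<Longrightarrow> u \<sim> w"
  by (rule rtranclp_trans)

lemma ceq_context: "u \<sim> v \<Longrightarrow> a @ u @ b \<sim> a @ v @ b"
proof (induction rule: rtranclp_induct)
  case (step y z)
  then show ?case using step_context[OF step(2), of a b] by (meson rtranclp.rtrancl_into_rtrancl)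
qed simp

lemma ceq_left: "u \<sim> v \<Longrightarrow> a @ u \<sim> a @ v"
  using ceq_context[of u v a "[]"] by simp

lemma ceq_right: "u \<sim> v \<Longrightarrow> u @ b \<sim> v @ b"
  using ceq_context[of u v "[]" b] by simp

lemma ceq_Cons: "u \<sim> v \<Longrightarrow> s # u \<sim> s # v"
  using ceq_left[of u v "[s]"] by simp

lemma ceq_swap: "m s t = 2 \<Longrightarrow> s # t # u \<sim> t # s # u"
  unfolding commutation_step_def by (rule r_into_rtranclp) (metis append_Cons append_Nil)

lemma ceq_shift: "(\<And>x. x \<in> set a \<Longrightarrow> m s x = 2) \<Longrightarrow> s # a @ b \<sim> a @ s # b"
proof (induction a)
  case (Cons x a)
  have "s # x # a @ b \<sim> x # s # a @ b" by (rule ceq_swap) (simp add: Cons.prems)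
  also have "x # s # a @ b \<sim> x # a @ s # b" by (rule ceq_Cons) (use Cons in simp)
  finally show ?case by simp
qed simp

lemma ceq_mset: "u \<sim> v \<Longrightarrow> mset u = mset v"
proof (induction rule: rtranclp_induct)
  case (step y z)
  then show ?case by (auto simp: commutation_step_def)
qed simp

lemma ceq_length: "u \<sim> v \<Longrightarrow> length u = length v"
  using ceq_mset mset_eq_length by blast

lemma ceq_set: "u \<sim> v \<Longrightarrow> set u = set v"
  using ceq_mset mset_eq_setD by blast

lemma ceq_count: "u \<sim> v \<Longrightarrow> count_list u x = count_list v x"
  using ceq_mset count_mset by metis

lemma ceq_lists: "u \<sim> v \<Longrightarrow> u \<in> lists S \<Longrightarrow> v \<in> lists S"
  using ceq_set by (auto simp: lists_eq_set)

lemma ceq_filter: "u \<sim> v \<Longrightarrow> filter P u \<sim> filter P v"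
proof (induction rule: rtranclp_induct)
  case (step y z)
  obtain a b s t where "m s t = 2" "y = a @ [s, t] @ b" "z = a @ [t, s] @ b"
    using step(2) unfolding commutation_step_def by blast
  then have "filter P y \<sim> filter P z"
    using ceq_left[OF ceq_swap[of s t "filter P b"], of "filter P a"] by auto
  with step.IH show ?case by (rule ceq_trans)
qed simp

text \<open>Letters that do not commute never pass each other. This refutes equivalence after a
  braid move and, later, separates the images of the two maps.\<close>

lemma ceq_projection:
  assumes "u \<sim> v" "m s t \<noteq> 2"
  shows "filter (\<lambda>x. x \<in> {s, t}) u = filter (\<lambda>x. x \<in> {s, t}) v"
  using assms(1)
proof (induction rule: rtranclp_induct)
  case (step y z)
  obtain a b p q where "m p q = 2" "y = a @ [p, q] @ b" "z = a @ [q, p] @ b"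
    using step(2) unfolding commutation_step_def by blast
  then show ?case using step.IH assms(2) m_sym[of p q] m_one[of p q] by auto
qed simp

text \<open>This yields left cancellation for commutation classes. Swapped letters differ, so a swap
  does not change which occurrence of \<open>s\<close> is the first.\<close>

lemma ceq_remove1: "u \<sim> v \<Longrightarrow> remove1 s u \<sim> remove1 s v"
proof (induction rule: rtranclp_induct)
  case (step y z)
  obtain a b p q where pq: "m p q = 2" "y = a @ [p, q] @ b" "z = a @ [q, p] @ b"
    using step(2) unfolding commutation_step_def by blast
  have "p \<noteq> q" using pq(1) m_one[of p q] by auto
  then have "remove1 s y \<sim> remove1 s z"
    using pq(1) by (auto simp: pq(2,3) remove1_append intro!: ceq_left ceq_swap)
  with step.IH show ?case by (rule ceq_trans)
qed simp

lemma ceq_cancel_Cons: "s # u \<sim> s # v \<Longrightarrow> u \<sim> v"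
  using ceq_remove1[of "s # u" "s # v" s] by simp

lemma ceq_cancel_left: "a @ u \<sim> a @ v \<Longrightarrow> u \<sim> v"
  by (induction a) (auto dest: ceq_cancel_Cons)

lemma ceq_eqv:
  assumes "u \<sim> v" "u \<in> lists S"
  shows "u \<approx> v"
  using assms(1)
proof (induction rule: rtranclp_induct)
  case base
  show ?case using assms(2) by (rule eqv_refl)
next
  case (step y z)
  obtain a b s t where *: "m s t = 2" "y = a @ [s, t] @ b" "z = a @ [t, s] @ b"
    using step(2) unfolding commutation_step_def by blast
  have "y \<in> lists S" using ceq_lists[OF step(1) assms(2)] .
  then have "y \<approx> z" using eqv_context[OF eqv_commute[of s t], of a b] * by auto
  with step.IH show ?case by (rule eqv_trans)
qed

subsection \<open>A local criterion for full commutativity\<close>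

text \<open>Meant for the rest \<open>u\<close> of a word behind an occurrence of \<open>s\<close>.
  If \<open>s\<close> does not recur the list has no significance, so the conditions built on it are
  guarded by membership in \<open>u\<close>.\<close>

definition nbs :: "'g \<Rightarrow> 'g list \<Rightarrow> 'g list" where
  "nbs s u = filter (\<lambda>x. 3 \<le> m s x) (takeWhile (\<lambda>x. x \<noteq> s) u)"

definition after :: "'g \<Rightarrow> 'g list \<Rightarrow> 'g list" where
  "after x u = tl (dropWhile (\<lambda>y. y \<noteq> x) u)"

definition ok :: "'g \<Rightarrow> 'g list \<Rightarrow> bool" where
  "ok s u \<longleftrightarrow> (s \<in> set u \<longrightarrow>
     2 \<le> length (nbs s u) \<or>
     (\<exists>x. nbs s u = [x] \<and> m s x = 4 \<and> \<not> (x \<in> set (after x u) \<and> nbs x (after x u) = [s])))"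

text \<open>The only neighbour x between two consecutive occurrences of s can be brought into the factor
  s x s by commutations, so x must be joined to s by an edge labelled 4, and s x s must not extend to
  s x s x.\<close>

fun fc :: "'g list \<Rightarrow> bool" where
  "fc [] \<longleftrightarrow> True"
| "fc (s # u) \<longleftrightarrow> ok s u \<and> fc u"

lemma nbs_Nil [simp]: "nbs s [] = []"
  by (simp add: nbs_def)

lemma nbs_Cons [simp]:
  "nbs s (x # u) = (if x = s then [] else if 3 \<le> m s x then x # nbs s u else nbs s u)"
  unfolding nbs_def takeWhile.simps by (cases "x = s"; cases "3 \<le> m s x") (simp_all only: filter.simps not_True_eq_False not_False_eq_True if_True if_False simp_thms)

lemma nbs_append: "nbs s (a @ b) = (if s \<in> set a then nbs s a else nbs s a @ nbs s b)"
  by (induction a) auto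

lemma after_Cons [simp]: "after x (y # u) = (if y = x then u else after x u)"
  by (simp add: after_def)

lemma nbs_notin: "s \<notin> set a \<Longrightarrow> nbs s a = filter (\<lambda>x. 3 \<le> m s x) a"
  by (induction a) auto

lemma not_adjacent_iff: "\<not> 3 \<le> m s x \<longleftrightarrow> m s x = 2 \<or> s = x"
  using m_range[of s x] m_one[of s x] by auto

lemma step_nbs:
  assumes "m p q = 2"
  shows "mset (nbs s (a @ p # q # b)) = mset (nbs s (a @ q # p # b))"
proof -
  have "p \<noteq> q" "m q p = 2" using assms m_one[of p q] m_sym[of p q] by auto
  then show ?thesis using assms by (induction a) auto
qed

lemma step_after:
  assumes "m p q = 2"
  shows "mset (nbs x (after x (a @ p # q # b))) = mset (nbs x (after x (a @ q # p # b))) \<and>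
    (x \<in> set (after x (a @ p # q # b)) \<longleftrightarrow> x \<in> set (after x (a @ q # p # b)))"
proof -
  have "p \<noteq> q" "m q p = 2" using assms m_one[of p q] m_sym[of p q] by auto
  then show ?thesis using assms step_nbs[OF assms, of x] by (induction a) auto
qed

text \<open>The condition sees the neighbour lists only through a length and two singletons, hence
  only as multisets. A swap can at most reorder them, which makes goodness invariant under
  commutations.\<close>

lemma ok_mset: "ok s u \<longleftrightarrow> (s \<in> set u \<longrightarrow>
     2 \<le> size (mset (nbs s u)) \<or>
     (\<exists>x. mset (nbs s u) = {#x#} \<and> m s x = 4 \<and>
       \<not> (x \<in> set (after x u) \<and> mset (nbs x (after x u)) = {#s#})))"
  by (simp add: ok_def)

lemma step_ok:
  assumes "m p q = 2"
  shows "ok s (a @ p # q # b) = ok s (a @ q # p # b)"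
  unfolding ok_mset
  by (simp add: step_nbs[OF assms, of s a b] step_after[OF assms, of _ a b] insert_commute)

lemma ok_skip:
  assumes "m p q = 2"
  shows "ok p (q # b) = ok p b"
proof -
  have "p \<noteq> q" using assms m_one[of p q] by auto
  then show ?thesis using assms unfolding ok_def by auto
qed

lemma step_fc: "commutation_step m u v \<Longrightarrow> fc u = fc v"
proof -
  assume "commutation_step m u v"
  then obtain a b p q where *: "m p q = 2" "u = a @ p # q # b" "v = a @ q # p # b"
    unfolding commutation_step_def by auto
  have qp: "m q p = 2" using *(1) m_sym[of q p] by simp
  have "fc (a @ p # q # b) = fc (a @ q # p # b)"
    by (induction a) (use step_ok[OF *(1)] ok_skip[OF *(1)] ok_skip[OF qp] in auto)
  then show ?thesis using * by simp
qed

lemma ceq_fc: "u \<sim> v \<Longrightarrow> fc u = fc v"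
  by (induction rule: rtranclp_induct) (auto simp: step_fc)

lemma fc_appendD: "fc (a @ b) \<Longrightarrow> fc b"
  by (induction a) auto

definition has_braid :: "'g list \<Rightarrow> bool" where
  "has_braid u \<longleftrightarrow> (\<exists>a b s x. u = a @ [s, s] @ b \<or> m s x = 3 \<and> u = a @ [s, x, s] @ b \<or>
     m s x = 4 \<and> u = a @ [s, x, s, x] @ b)"

lemma fc_not_has_braid:
  assumes "fc u"
  shows "\<not> has_braid u"
proof
  assume "has_braid u"
  then obtain a b s x where *: "u = a @ [s, s] @ b \<or> m s x = 3 \<and> u = a @ [s, x, s] @ b \<or>
      m s x = 4 \<and> u = a @ [s, x, s, x] @ b"
    unfolding has_braid_def by blast
  then have "fc ([s, s] @ b) \<or> m s x = 3 \<and> fc ([s, x, s] @ b) \<or> m s x = 4 \<and> fc ([s, x, s, x] @ b)"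
    using assms fc_appendD by metis
  moreover have "m x s = m s x" "m s x = 3 \<Longrightarrow> s \<noteq> x" "m s x = 4 \<Longrightarrow> s \<noteq> x"
    using m_sym[of x s] m_one[of s x] by auto
  ultimately show False by (auto simp: ok_def)
qed

lemma filter_eq_Nil_commute:
  "filter (\<lambda>x. 3 \<le> m s x) a = [] \<Longrightarrow> s \<notin> set a \<Longrightarrow> x \<in> set a \<Longrightarrow> m s x = 2"
  using not_adjacent_iff by (auto simp: filter_empty_conv)

text \<open>Commuting letters are moved out of the way. With no neighbour the two \<open>s\<close>
  meet; with one neighbour \<open>x\<close> the factor \<open>s x s\<close> appears, and for label 4
  the failure of the last clause brings the next \<open>x\<close> behind it.\<close>

lemma not_ok_has_braid:
  assumes "\<not> ok s u"
  shows "\<exists>v. s # u \<sim> v \<and> has_braid v"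
proof -
  have s: "s \<in> set u" using assms by (auto simp: ok_def)
  then obtain P Q where u: "u = P @ s # Q" and P: "s \<notin> set P" by (meson split_list_first)
  have nb: "nbs s u = filter (\<lambda>x. 3 \<le> m s x) P"
    using P by (simp add: u nbs_append nbs_notin)
  have "length (nbs s u) < 2" using assms s by (auto simp: ok_def)
  then consider "nbs s u = []" | x where "nbs s u = [x]"
    by (cases "nbs s u"; cases "tl (nbs s u)") auto
  then show ?thesis
  proof cases
    case 1
    then have "s # P @ s # Q \<sim> P @ s # s # Q"
      using nb P by (intro ceq_shift) (auto intro: filter_eq_Nil_commute)
    moreover have "has_braid (P @ s # s # Q)" unfolding has_braid_def by auto
    ultimately show ?thesis using u by auto
  next
    case 2
    then obtain P1 P2 where P12: "P = P1 @ x # P2" "filter (\<lambda>x. 3 \<le> m s x) P1 = []"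
        "filter (\<lambda>x. 3 \<le> m s x) P2 = []" "3 \<le> m s x"
      using nb by (auto simp: filter_eq_Cons_iff filter_empty_conv eq_commute[of "[]"])
    have c1: "m s y = 2" if "y \<in> set P1" for y
      using filter_eq_Nil_commute[OF P12(2)] P P12(1) that by auto
    have c2: "m s y = 2" if "y \<in> set P2" for y
      using filter_eq_Nil_commute[OF P12(3)] P P12(1) that by auto
    have "s # P1 @ x # P2 @ s # Q \<sim> P1 @ s # x # P2 @ s # Q"
      by (rule ceq_shift) (rule c1)
    also have "P1 @ s # x # P2 @ s # Q \<sim> P1 @ s # x # s # P2 @ Q"
      by (intro ceq_left ceq_Cons ceq_sym[OF ceq_shift] c2)
    finally have sx: "s # u \<sim> P1 @ [s, x, s] @ P2 @ Q" by (simp add: u P12)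
    have "m s x = 3 \<or> m s x = 4" using P12(4) m_range[of s x] by auto
    then show ?thesis
    proof
      assume "m s x = 3"
      then have "has_braid (P1 @ [s, x, s] @ P2 @ Q)" unfolding has_braid_def by blast
      then show ?thesis using sx by blast
    next
      assume 4: "m s x = 4"
      have x12: "x \<notin> set P1" "x \<notin> set P2" using P12 by (auto simp: filter_empty_conv)
      have xs: "x \<noteq> s" using P12 P by auto
      have "after x (A @ x # B) = B" if "x \<notin> set A" for A B
        using that by (induction A) auto
      then have aft: "after x u = P2 @ s # Q" using x12 by (simp add: u P12)
      have "x \<in> set (after x u)" and nx: "nbs x (after x u) = [s]"
        using assms s 2 4 by (auto simp: ok_def)
      then have "x \<in> set Q" using aft x12 xs by auto
      then obtain Q1 Q2 where Q: "Q = Q1 @ x # Q2" and Q1: "x \<notin> set Q1" by (meson split_list_first)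
      have "3 \<le> m x s" using 4 m_sym[of x s] by simp
      \<comment> \<open>Before its next occurrence, \<open>x\<close> meets no neighbour except the
        recurring \<open>s\<close>; everything else in between commutes with
        \<open>x\<close>.\<close>
      then have f: "filter (\<lambda>y. 3 \<le> m x y) P2 @ s # filter (\<lambda>y. 3 \<le> m x y) Q1 = [s]"
        using nx x12 Q1 xs by (auto simp: aft Q nbs_append nbs_notin split: if_splits)
      then have "filter (\<lambda>y. 3 \<le> m x y) P2 = []" "filter (\<lambda>y. 3 \<le> m x y) Q1 = []"
        by (auto simp: append_eq_Cons_conv)
      then have c3: "m x y = 2" if "y \<in> set (P2 @ Q1)" for y
        using that filter_eq_Nil_commute[OF _ x12(2), of y] filter_eq_Nil_commute[OF _ Q1, of y]
        by (metis Un_iff set_append)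
      have "P1 @ [s, x, s] @ (P2 @ Q1) @ x # Q2 \<sim> P1 @ [s, x, s] @ x # (P2 @ Q1) @ Q2"
        by (intro ceq_left ceq_sym[OF ceq_shift] c3)
      with sx have "s # u \<sim> P1 @ [s, x, s, x] @ P2 @ Q1 @ Q2"
        using ceq_trans by (simp add: Q)
      then show ?thesis using 4 unfolding has_braid_def by blast
    qed
  qed
qed

lemma fc_iff: "fc u \<longleftrightarrow> (\<forall>v. u \<sim> v \<longrightarrow> \<not> has_braid v)"
proof
  show "fc u \<Longrightarrow> \<forall>v. u \<sim> v \<longrightarrow> \<not> has_braid v" using ceq_fc fc_not_has_braid by blast
  have "\<exists>v. u \<sim> v \<and> has_braid v" if "\<not> fc u"
    using that
  proof (induction u)
    case (Cons s u)
    show ?case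
    proof (cases "fc u")
      case True
      then show ?thesis using Cons.prems not_ok_has_braid by simp
    next
      case False
      then obtain v where v: "u \<sim> v" "has_braid v" using Cons.IH by blast
      have "has_braid (s # v)" using v(2) unfolding has_braid_def by (metis append_Cons)
      then show ?thesis using ceq_Cons[OF v(1)] by blast
    qed
  qed simp
  then show "\<forall>v. u \<sim> v \<longrightarrow> \<not> has_braid v \<Longrightarrow> fc u" by blast
qed

text \<open>The argument of Tits and Matsumoto by induction on the length. Two expressions with
  different first letters \<open>s\<close> and \<open>r\<close> are compared by repeated exchange,
  which produces an expression starting with the alternating word of length \<open>m r s\<close>. By
  induction it is reached by commutations, so labels 3 and 4 contradict goodness.\<close>

lemma fc_reduced:
  assumes "u \<in> lists S" "fc u"
  shows "reduced_word m S u \<and> (\<forall>v. u \<approx> v \<longrightarrow> length v = length u \<longrightarrow> u \<sim> v)"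
  using assms
proof (induction u rule: length_induct)
  case (1 u)
  show ?case
  proof (cases u)
    case Nil
    then show ?thesis by (simp add: reduced_word_iff)
  next
    case (Cons s u')
    then have s: "s \<in> S" and u': "u' \<in> lists S" and f': "fc u'" using 1(2,3) by auto
    have red': "reduced_word m S u'" using 1(1) Cons u' f' by auto
    have IH: "w \<sim> y" if "w \<approx> y" "length w = length y" "length w \<le> length u'" "fc w" for w y
      using 1(1)[rule_format, of w] that Cons eqvD[OF that(1)] by auto
    have red: "reduced_word m S u"
    proof (rule ccontr)
      assume "\<not> reduced_word m S u"
      then obtain u1 x u2 where "u' = u1 @ x # u2" "u' \<approx> s # u1 @ u2"
        using exchange[OF red' s] Cons by blast
      \<comment> \<open>By induction the exchanged word is reached by commutations, so
        \<open>u\<close> would acquire the forbidden factor \<open>s s\<close>.\<close>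
      then have "u' \<sim> s # u1 @ u2" using IH[of u' "s # u1 @ u2"] f' by simp
      then have "u \<sim> [] @ [s, s] @ u1 @ u2" using Cons ceq_Cons by simp
      then show False using 1(3) fc_iff unfolding has_braid_def by blast
    qed
    have red_len: "reduced_word m S z" if "u \<approx> z" "length z = length u" for z
      using red that eqv_sym eqv_trans eqvD[OF that(1)] unfolding reduced_word_iff by metis
    have "u \<sim> v" if uv: "u \<approx> v" and len: "length v = length u" for v
    proof -
      obtain r v' where v: "v = r # v'" using len Cons by (cases v) auto
      have r: "r \<in> S" and v': "v' \<in> lists S" using eqvD[OF uv] v by auto
      show ?thesis
      proof (cases "r = s")
        case True
        then have "u' \<approx> v'" using uv v Cons eqv_cancel_Cons by simp
        then have "u' \<sim> v'" using IH[of u' v'] len v Cons f' by simp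
        then show ?thesis using v Cons True ceq_Cons by simp
      next
        case False
        have not_red: "\<not> reduced_word m S (p # z)"
          if "u \<approx> z" "length z = length u" "u \<approx> p # w" "length w < length u" for p z w
        proof
          assume *: "reduced_word m S (p # z)"
          have "p \<in> S" using eqvD[OF that(3)] by simp
          have "z \<approx> p # w" using that(1,3) eqv_sym eqv_trans by blast
          then have "p # z \<approx> w" using eqv_move eqv_sym by blast
          then show False using * that unfolding reduced_word_iff by fastforce
        qed
        obtain u1 x u2 where e1: "u = u1 @ x # u2" "r # u1 \<approx> u1 @ [x]" "u \<approx> r # u1 @ u2"
          using exchange[OF red r not_red[of u r v']] uv v len Cons 1(2) eqv_refl by auto
        \<comment> \<open>An empty \<open>u1\<close> would make \<open>r\<close> and
          \<open>s\<close> equal in the group.\<close>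
        have "u1 \<noteq> []" using e1 Cons False gen_neq[OF r s] by auto
        then obtain w1 where w1: "u1 = s # w1" using e1(1) Cons by (cases u1) auto
        define y where "y = w1 @ u2"
        have z: "u \<approx> r # s # y" and ylen: "length y + 2 = length u" "length y < length u'"
          using e1 w1 Cons by (auto simp: y_def)
        have yl: "y \<in> lists S" using eqvD[OF z] by simp
        \<comment> \<open>When \<open>s\<close> is exchanged into \<open>r # s # y\<close>, neither
          of the first two letters is deleted: the group would satisfy s = r or s r = r s. So
          \<open>r s\<close> survives behind the new \<open>s\<close>.\<close>
        have rs3: "u \<approx> s # r # s # y' \<and> length y' + 3 = length u \<and> y' \<in> lists S"
          if z: "u \<approx> r # s # y" and ylen: "length y + 2 = length u" and m3: "3 \<le> m r s"
            and y': "z1 @ x # z2 = r # s # y" "s # z1 \<approx> z1 @ [x]" "r # s # y \<approx> s # z1 @ z2"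
              "y' = tl (tl z1) @ z2" for y z1 x z2 y'
        proof -
          consider "z1 = []" "x = r" | "z1 = [r]" "x = s"
            | y1 where "z1 = r # s # y1"
            using y'(1) by (cases z1; cases "tl z1") auto
          then show ?thesis
          proof cases
            case 3
            then have "u \<approx> s # r # s # y'" using eqv_trans[OF z y'(3)] y'(4) by simp
            moreover have "length y' + 3 = length u" using 3 y' ylen by auto
            ultimately show ?thesis using eqvD by fastforce
          next
            case 1
            then show ?thesis using y' gen_neq[OF s r] False by auto
          next
            case 2
            then show ?thesis using y' gen_order3[OF r s m3] eqv_sym by auto
          qed
        qed
        have "m r s = 2 \<or> 3 \<le> m r s" using False not_adjacent_iff by blast
        then show ?thesis
        proof
          assume m2: "m r s = 2"
          have "r # s # y \<approx> s # r # y"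
            using eqv_right[OF eqv_commute[OF r s m2] yl] by simp
          then have "s # u' \<approx> s # r # y" using eqv_trans[OF z] Cons by simp
          then have "u' \<approx> r # y" by (rule eqv_cancel_Cons)
          then have "u' \<sim> r # y" using IH[of u' "r # y"] f' ylen Cons by simp
          then have "u \<sim> s # r # y" using Cons ceq_Cons by simp
          also have "s # r # y \<sim> r # s # y" using m2 m_sym by (intro ceq_swap) metis
          finally have us: "u \<sim> r # s # y" .
          then have "fc (s # y)" using 1(3) ceq_fc by fastforce
          moreover have "s # y \<approx> v'"
            using z uv v eqv_sym eqv_trans eqv_cancel_Cons by metis
          ultimately have "s # y \<sim> v'" using IH[of "s # y" v'] ylen len v Cons by simp
          then show ?thesis using us v ceq_Cons ceq_trans by metis
        next
          assume m3: "3 \<le> m r s"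
          have lz: "length (r # s # y) = length u" using ylen by simp
          obtain z1 x z2 where z1: "r # s # y = z1 @ x # z2" "s # z1 \<approx> z1 @ [x]"
              "r # s # y \<approx> s # z1 @ z2"
            using exchange[OF red_len[OF z lz] s not_red[OF z lz, of s u']] 1(2) Cons eqv_refl
            by auto
          obtain y' where y': "u \<approx> s # r # s # y'" "length y' + 3 = length u" "y' \<in> lists S"
            using rs3[OF z ylen(1) m3 z1(1)[symmetric] z1(2,3)] by blast
          have "s # u' \<approx> s # r # s # y'" using y' Cons by simp
          then have "u' \<approx> r # s # y'" by (rule eqv_cancel_Cons)
          then have "u' \<sim> r # s # y'" using IH[of u' "r # s # y'"] f' y' Cons by simp
          then have us: "u \<sim> s # r # s # y'" using Cons ceq_Cons by simp
          show ?thesis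
          proof (cases "m s r = 3")
            case True
            then have "has_braid ([] @ [s, r, s] @ y')" unfolding has_braid_def by blast
            then show ?thesis using us 1(3) fc_iff by auto
          next
            case m4: False
            then have m4: "m s r = 4" using m3 m_sym[of s r] m_range[of r s] by auto
            have lz: "length (s # r # s # y') = length u" using y' by simp
            \<comment> \<open>Label 4 takes one more exchange, now of \<open>r\<close>. Deleting one
              of the first three letters would give r s an order below 4.\<close>
            obtain z1 x z2 where z2: "s # r # s # y' = z1 @ x # z2" "r # z1 \<approx> z1 @ [x]"
                "s # r # s # y' \<approx> r # z1 @ z2"
              using exchange[OF red_len[OF y'(1) lz] r not_red[OF y'(1) lz, of r v']] uv v len
              by auto
            consider "z1 = []" "x = s" | "z1 = [s]" "x = r" | "z1 = [s, r]" "x = s"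
              | y1 where "z1 = s # r # s # y1" "y' = y1 @ x # z2"
              using z2(1) by (cases z1; cases "tl z1"; cases "tl (tl z1)") auto
            then show ?thesis
            proof cases
              case 1
              then show ?thesis using z2 gen_neq[OF r s] False by auto
            next
              case 2
              then show ?thesis using z2 gen_order3[OF r s m3] by auto
            next
              case 3
              then show ?thesis using z2 gen_order4[OF s r m4] eqv_sym by auto
            next
              case 4
              define y'' where "y'' = y1 @ z2"
              have "u \<approx> r # s # r # s # y''" using eqv_trans[OF y'(1) z2(3)] 4(1) by (simp add: y''_def)
              moreover have "r # s # r # s # y'' \<approx> s # r # s # r # y''"
                using eqv_right[OF eqv_sym[OF eqv_braid4[OF s r m4]], of y''] y'(3) 4(2)
                by (simp add: y''_def)
              ultimately have "s # u' \<approx> s # r # s # r # y''" using Cons eqv_trans by metis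
              then have "u' \<approx> r # s # r # y''" by (rule eqv_cancel_Cons)
              moreover have "length u' = length (r # s # r # y'')"
                using y'(2) 4 Cons by (simp add: y''_def)
              ultimately have "u' \<sim> r # s # r # y''" using IH f' by blast
              then have "u \<sim> [] @ [s, r, s, r] @ y''" using Cons ceq_Cons by simp
              then show ?thesis using 1(3) m4 fc_iff unfolding has_braid_def by blast
            qed
          qed
        qed
      qed
    qed
    then show ?thesis using red by blast
  qed
qed

section \<open>From good words to elements of the group\<close>

lemma reduced_expr_cls_iff:
  assumes "u \<in> lists S" "fc u"
  shows "reduced_expr (cls u) v \<longleftrightarrow> u \<sim> v"
proof -
  have "cox_length (cls u) = length u"
    using fc_reduced[OF assms] by (simp add: reduced_word_def reduced_expr_def)
  then have "reduced_expr (cls u) v \<longleftrightarrow> u \<approx> v \<and> length v = length u"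
    by (auto simp: reduced_expr_def mem_cls_iff)
  then show ?thesis
    using fc_reduced[OF assms] ceq_eqv[OF _ assms(1)] ceq_length by metis
qed

lemma fc_fully_commutative:
  assumes "u \<in> lists S" "fc u"
  shows "fully_commutative m (cls u)"
  unfolding fully_commutative_def reduced_expr_cls_iff[OF assms]
  using ceq_sym ceq_trans by blast

lemma cls_eq_cls_iff_ceq:
  assumes "u \<in> lists S" "v \<in> lists S" "fc u" "fc v"
  shows "cls u = cls v \<longleftrightarrow> u \<sim> v"
proof
  assume "cls u = cls v"
  moreover have "reduced_expr (cls v) v" using reduced_expr_cls_iff assms by blast
  ultimately show "u \<sim> v" using reduced_expr_cls_iff assms by metis
next
  assume "u \<sim> v"
  then show "cls u = cls v" using ceq_eqv assms cls_eq_iff by blast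
qed

text \<open>If commutations reach a braid, the braid move gives another reduced expression. Its
  projection to the two letters of the braid is different, so commutations cannot connect the
  two.\<close>

lemma fully_commutative_fc:
  assumes "fully_commutative m (cls u)" "reduced_word m S u"
  shows "fc u"
proof (rule ccontr)
  assume "\<not> fc u"
  then obtain v where v: "u \<sim> v" "has_braid v" using fc_iff by blast
  have ul: "u \<in> lists S" and ru: "reduced_expr (cls u) u"
    using assms(2) by (simp_all only: reduced_word_def)
  have len: "length u \<le> length w" if "u \<approx> w" for w
    using assms(2) that unfolding reduced_word_iff by blast
  have uv: "u \<approx> v" using ceq_eqv[OF v(1) ul] .
  have vl: "v \<in> lists S" and luv: "length u = length v" using ceq_lists[OF v(1) ul] ceq_length[OF v(1)] .
  \<comment> \<open>A factor \<open>s s\<close> contradicts reducedness. In the two remaining cases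
    \<open>p\<close> and \<open>q\<close> are the two sides of the braid relation.\<close>
  have ex: "\<exists>a b s x p q. m s x \<noteq> 2 \<and> v = a @ p @ b \<and> p \<approx> q \<and> length p = length q \<and>
      filter (\<lambda>y. y \<in> {s, x}) p \<noteq> filter (\<lambda>y. y \<in> {s, x}) q"
  proof -
    obtain a b s x where *: "v = a @ [s, s] @ b \<or> m s x = 3 \<and> v = a @ [s, x, s] @ b \<or>
        m s x = 4 \<and> v = a @ [s, x, s, x] @ b"
      using v(2) unfolding has_braid_def by blast
    then consider "v = a @ [s, s] @ b" | "m s x = 3" "v = a @ [s, x, s] @ b"
      | "m s x = 4" "v = a @ [s, x, s, x] @ b" by blast
    then show ?thesis
    proof cases
      case 1
      have l: "a \<in> lists S" "s \<in> S" "b \<in> lists S" using vl 1 by auto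
      have "a @ [s, s] @ b \<approx> a @ [] @ b"
        by (rule eqv_context) (use rev_cancel[of "[s]"] l in auto)
      then have "u \<approx> a @ b" using eqv_trans[OF uv, of "a @ b"] 1 by simp
      then show ?thesis using len[of "a @ b"] luv 1 by simp
    next
      case 2
      then have "s \<noteq> x" "s \<in> S" "x \<in> S" using m_one[of s x] vl by auto
      then show ?thesis using 2 eqv_braid3[of s x]
        by (intro exI[of _ a] exI[of _ b] exI[of _ s] exI[of _ x] exI[of _ "[s,x,s]"]
            exI[of _ "[x,s,x]"]) auto
    next
      case 3
      then have "s \<noteq> x" "s \<in> S" "x \<in> S" using m_one[of s x] vl by auto
      then show ?thesis using 3 eqv_braid4[of s x]
        by (intro exI[of _ a] exI[of _ b] exI[of _ s] exI[of _ x] exI[of _ "[s,x,s,x]"]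
            exI[of _ "[x,s,x,s]"]) auto
    qed
  qed
  then obtain a b s x p q where *: "m s x \<noteq> 2" "v = a @ p @ b" "p \<approx> q" "length p = length q"
      "filter (\<lambda>y. y \<in> {s, x}) p \<noteq> filter (\<lambda>y. y \<in> {s, x}) q"
    by blast
  have "v \<approx> a @ q @ b" using eqv_context[OF *(3), of a b] vl * by simp
  then have "u \<approx> a @ q @ b" by (rule eqv_trans[OF uv])
  moreover have "length (a @ q @ b) = length u" using luv * by simp
  ultimately have "reduced_expr (cls u) (a @ q @ b)"
    using ru by (simp add: reduced_expr_def mem_cls_iff)
  then have "u \<sim> a @ q @ b" using assms(1) ru unfolding fully_commutative_def by blast
  then have "a @ p @ b \<sim> a @ q @ b" using v(1) *(2) ceq_sym ceq_trans by blast
  from ceq_projection[OF this *(1)] *(5) show False by simp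
qed

lemma reduced_word_exists:
  assumes "w \<in> carrier (coxeter_group m S)"
  obtains u where "u \<in> lists S" "w = cls u" "reduced_word m S u"
proof -
  obtain v where v: "v \<in> lists S" "w = cls v" using assms unfolding carrier_coxeter_group by auto
  have "v \<in> w" using cox_class_self[OF v(1)] v(2) by simp
  then have "\<exists>k. \<exists>u\<in>w. length u = k" by blast
  then have "\<exists>u\<in>w. length u = cox_length w"
    unfolding cox_length_def by (rule LeastI_ex)
  then obtain u where u: "u \<in> w" "length u = cox_length w" ..
  then have "v \<approx> u" using v by (simp add: mem_cls_iff)
  then have "u \<in> lists S" "w = cls u" using eqvD[of v u] v cls_eq_iff[of v u] by auto
  then show thesis using that u by (simp add: reduced_word_def reduced_expr_def)
qed

text \<open>Letter by letter, the reduced word is either extended or, by exchange, loses one of its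
  letters; letters outside \<open>T\<close> never appear. This later shows that good words of
  elements of \<open>W_D\<close> are free of t_n.\<close>

lemma reduced_in_parabolic:
  assumes "v \<in> lists T" "T \<subseteq> S"
  shows "\<exists>u\<in>lists T. v \<approx> u \<and> reduced_word m S u"
  using assms(1)
proof (induction v)
  case Nil
  show ?case using eqv_refl[of "[]"] by (auto simp: reduced_word_iff)
next
  case (Cons s v)
  then obtain u where u: "u \<in> lists T" "v \<approx> u" "reduced_word m S u" by auto
  have s: "s \<in> S" "s \<in> T" using Cons assms by auto
  have su: "s # v \<approx> s # u" using eqv_Cons[OF u(2) s(1)] .
  show ?case
  proof (cases "reduced_word m S (s # u)")
    case True
    then show ?thesis using su u s by (intro bexI[of _ "s # u"]) auto
  next
    case False
    then obtain u1 x u2 where e: "u = u1 @ x # u2" "u \<approx> s # u1 @ u2"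
      using exchange[OF u(3) s(1)] by blast
    have eq: "s # u \<approx> u1 @ u2" using eqv_move[OF eqv_sym[OF e(2)]] eqv_sym by blast
    have "length (u1 @ u2) \<le> length w" if "u1 @ u2 \<approx> w" for w
    proof -
      have "u \<approx> s # w" using e(2) eqv_Cons[OF that s(1)] eqv_trans by simp
      then have "length u \<le> length (s # w)" using u(3) by (simp only: reduced_word_iff)
      then show ?thesis using e(1) by simp
    qed
    then have "reduced_word m S (u1 @ u2)" using eqvD[OF eq] by (simp add: reduced_word_iff)
    moreover have "u1 @ u2 \<in> lists T" using u e by simp
    ultimately show ?thesis using eqv_trans[OF su eq] by blast
  qed
qed

end

section \<open>The affine action of type B-tilde\<close>

lemma cox_B_simps:
  "cox_B n (Sigma i) (Sigma j) =
     (if i = j then 1 else if (j = i + 1 \<or> i = j + 1) \<and> 1 \<le> i \<and> 1 \<le> j \<and> i \<le> n - 1 \<and> j \<le> n - 1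
      then 3 else 2)"
  "cox_B n (Sigma i) SigmaBar = (if i = 2 then 3 else 2)"
  "cox_B n SigmaBar (Sigma i) = (if i = 2 then 3 else 2)"
  "cox_B n (Sigma i) (Tgen j) = (if i = n - 1 \<and> j = n then 4 else 2)"
  "cox_B n (Tgen j) (Sigma i) = (if i = n - 1 \<and> j = n then 4 else 2)"
  "cox_B n SigmaBar SigmaBar = 1"
  "cox_B n SigmaBar (Tgen j) = 2"
  "cox_B n (Tgen j) SigmaBar = 2"
  "cox_B n (Tgen i) (Tgen j) = (if i = j then 1 else 2)"
  by (auto simp: cox_B_def doubleton_eq_iff)

text \<open>Unlike the other generators, t_n moves the origin: this is what separates the words with a
  single t_n below.\<close>

fun act1 :: "gen \<Rightarrow> (nat \<Rightarrow> int) \<Rightarrow> nat \<Rightarrow> int" where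
  "act1 (Sigma i) p = p(i := p (i + 1), i + 1 := p i)"
| "act1 SigmaBar p = p(1 := - p 2, 2 := - p 1)"
| "act1 (Tgen j) p = p(j := 1 - p j)"

abbreviation act :: "gen list \<Rightarrow> (nat \<Rightarrow> int) \<Rightarrow> nat \<Rightarrow> int" where
  "act \<equiv> foldr act1"

lemma gens_B_cases:
  assumes "s \<in> gens_B n"
  obtains i where "s = Sigma i" "1 \<le> i" "i \<le> n - 1" | "s = SigmaBar" | "s = Tgen n"
  using assms by (auto simp: gens_B_def gens_D_def)

lemma act_power:
  assumes "s \<in> gens_B n" "t \<in> gens_B n" "3 \<le> n"
  shows "act (concat (replicate (cox_B n s t) [s, t])) p = p"
  using assms by (elim gens_B_cases) (auto simp: cox_B_simps fun_eq_iff eval_nat_numeral)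

lemma act_cong:
  assumes "3 \<le> n" "(u, v) \<in> cox_rel (cox_B n) (gens_B n)"
  shows "act u = act v"
proof -
  have step: "act a = act b" if "cox_step (cox_B n) (gens_B n) a b" for a b
    using that act_power[OF _ _ assms(1)] unfolding cox_step_def by fastforce
  have "equivclp (cox_step (cox_B n) (gens_B n)) u v" using assms(2) by (simp add: cox_rel_def)
  then show ?thesis
  proof (induction rule: equivclp_induct)
    case (step y z)
    then show ?case using \<open>\<And>a b. _ \<Longrightarrow> act a = act b\<close>[of y z] \<open>\<And>a b. _ \<Longrightarrow> act a = act b\<close>[of z y]
      by metis
  qed simp
qed

text \<open>The test point is \<open>int\<close>: its coordinates 1, ..., n have distinct absolute
  values, so one well-chosen coordinate tells two generators apart. The two lemmas on orders use the
  same point.\<close>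

lemma act_gen_neq:
  assumes "s \<in> gens_B n" "t \<in> gens_B n" "s \<noteq> t" "3 \<le> n"
  shows "act1 s int \<noteq> act1 t int"
proof
  assume eq: "act1 s int = act1 t int"
  show False
    using assms(1)
  proof (cases rule: gens_B_cases)
    case (1 i)
    show ?thesis using assms(2)
    proof (cases rule: gens_B_cases)
      case (1 j)
      then show ?thesis using fun_cong[OF eq, of i] \<open>s = Sigma i\<close> assms(3)
        by (auto split: if_splits)
    next
      case 2
      then show ?thesis using fun_cong[OF eq, of 1] \<open>s = Sigma i\<close> by (auto split: if_splits)
    next
      case 3
      then show ?thesis using fun_cong[OF eq, of n] \<open>s = Sigma i\<close> \<open>3 \<le> n\<close> by (auto split: if_splits)
    qed
  next
    case 2
    show ?thesis using assms(2)
    proof (cases rule: gens_B_cases)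
      case (1 j)
      then show ?thesis using fun_cong[OF eq, of 1] \<open>s = SigmaBar\<close> by (auto split: if_splits)
    next
      case 2
      then show ?thesis using \<open>s = SigmaBar\<close> assms(3) by simp
    next
      case 3
      then show ?thesis using fun_cong[OF eq, of 1] \<open>s = SigmaBar\<close> \<open>3 \<le> n\<close> by auto
    qed
  next
    case 3
    show ?thesis using assms(2)
    proof (cases rule: gens_B_cases)
      case (1 j)
      then show ?thesis using fun_cong[OF eq, of n] \<open>s = Tgen n\<close> \<open>3 \<le> n\<close> by (auto split: if_splits)
    next
      case 2
      then show ?thesis using fun_cong[OF eq, of 1] \<open>s = Tgen n\<close> \<open>3 \<le> n\<close> by auto
    next
      case 3
      then show ?thesis using \<open>s = Tgen n\<close> assms(3) by simp
    qed
  qed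
qed

lemma cox_B_3_cases:
  assumes "s \<in> gens_B n" "t \<in> gens_B n" "3 \<le> cox_B n s t"
  obtains i where "s = Sigma i" "t = Sigma (i + 1)" | i where "t = Sigma i" "s = Sigma (i + 1)"
  | "s = Sigma 2" "t = SigmaBar" | "t = Sigma 2" "s = SigmaBar"
  | "s = Sigma (n - 1)" "t = Tgen n" | "t = Sigma (n - 1)" "s = Tgen n"
  using assms by (cases s; cases t) (auto simp: cox_B_simps split: if_splits)

lemma act_order3:
  assumes "s \<in> gens_B n" "t \<in> gens_B n" "3 \<le> cox_B n s t" "3 \<le> n"
  shows "act [s, t] int \<noteq> act [t, s] int"
proof
  assume eq: "act [s, t] int = act [t, s] int"
  show False
    using assms(1-3)
  proof (cases rule: cox_B_3_cases)
    case (1 i)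
    then show ?thesis using fun_cong[OF eq, of i] by simp
  next
    case (2 i)
    then show ?thesis using fun_cong[OF eq, of i] by simp
  next
    case 3
    then show ?thesis using fun_cong[OF eq, of 1] by simp
  next
    case 4
    then show ?thesis using fun_cong[OF eq, of 1] by simp
  next
    case 5
    then show ?thesis using fun_cong[OF eq, of "n - 1"] assms(4) by (auto split: if_splits)
  next
    case 6
    then show ?thesis using fun_cong[OF eq, of "n - 1"] assms(4) by (auto split: if_splits)
  qed
qed

lemma act_order4:
  assumes "s \<in> gens_B n" "t \<in> gens_B n" "cox_B n s t = 4" "3 \<le> n"
  shows "act [s, t, s] int \<noteq> act [t, s, t] int"
proof
  assume eq: "act [s, t, s] int = act [t, s, t] int"
  show False
    using assms fun_cong[OF eq, of "n - 1"]
    by (elim gens_B_cases) (auto simp: cox_B_simps split: if_splits)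
qed

locale btilde =
  fixes n :: nat
  assumes n3: "3 \<le> n"
begin

sublocale small_coxeter "cox_B n" "gens_B n"
proof
  fix s t
  show "cox_B n s t = cox_B n t s" by (cases s; cases t) (auto simp: cox_B_simps)
  show "cox_B n s t = 1 \<longleftrightarrow> s = t" by (cases s; cases t) (auto simp: cox_B_simps)
  show "cox_B n s t \<in> {1, 2, 3, 4}" by (cases s; cases t) (auto simp: cox_B_simps)
  assume st: "s \<in> gens_B n" "t \<in> gens_B n"
  show "([s], [t]) \<notin> cox_rel (cox_B n) (gens_B n)" if "s \<noteq> t"
    using act_cong[OF n3, of "[s]" "[t]"] act_gen_neq[OF st that n3] by auto
  show "([s, t], [t, s]) \<notin> cox_rel (cox_B n) (gens_B n)" if "3 \<le> cox_B n s t"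
    using act_cong[OF n3, of "[s, t]" "[t, s]"] act_order3[OF st that n3] by metis
  show "([s, t, s], [t, s, t]) \<notin> cox_rel (cox_B n) (gens_B n)" if "cox_B n s t = 4"
    using act_cong[OF n3, of "[s, t, s]" "[t, s, t]"] act_order4[OF st that n3] by metis
qed

end

abbreviation (in btilde) eqv_B :: "gen list \<Rightarrow> gen list \<Rightarrow> bool" (infix "\<approx>" 50) where
  "u \<approx> v \<equiv> (u, v) \<in> cox_rel (cox_B n) (gens_B n)"

abbreviation (in btilde) ceq_B :: "gen list \<Rightarrow> gen list \<Rightarrow> bool" (infix "\<sim>" 50) where
  "u \<sim> v \<equiv> (commutation_step (cox_B n))\<^sup>*\<^sup>* u v"

subsection \<open>Brackets are coset representatives\<close>

text \<open>The value at 0 has to be empty: \<open>D_letters (k - 1)\<close> bounds what may follow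
  a bracket with top \<open>k\<close>, and a bracket with top 1 exhausts both \<sigma>_1 and
  \<open>SigmaBar\<close>.\<close>

definition D_letters :: "nat \<Rightarrow> gen set" where
  "D_letters k = (if k = 0 then {} else insert SigmaBar (Sigma ` {1..k}))"

lemma gens_D_letters: "2 \<le> n \<Longrightarrow> gens_D n = D_letters (n - 1)"
  by (auto simp: gens_D_def D_letters_def)

lemma D_letters_mono: "j \<le> k \<Longrightarrow> D_letters j \<subseteq> D_letters k"
  by (auto simp: D_letters_def)

definition unit_vec :: "int \<Rightarrow> nat \<Rightarrow> int" where
  "unit_vec c = (\<lambda>x. if int x = \<bar>c\<bar> then sgn c else 0)"

lemma unit_vec_inject: "c \<noteq> 0 \<Longrightarrow> unit_vec c = unit_vec d \<Longrightarrow> c = d"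
proof -
  assume c: "c \<noteq> 0" and eq: "unit_vec c = unit_vec d"
  have "unit_vec c (nat \<bar>c\<bar>) = sgn c" by (simp add: unit_vec_def)
  then have "unit_vec d (nat \<bar>c\<bar>) = sgn c" using eq by simp
  then show "c = d" using c by (auto simp: unit_vec_def sgn_if split: if_splits)
qed

lemma act1_unit_vec:
  "1 \<le> i \<Longrightarrow> act1 (Sigma i) (unit_vec (int i + 1)) = unit_vec (int i)"
  "1 \<le> i \<Longrightarrow> act1 (Sigma i) (unit_vec (- int i)) = unit_vec (- int i - 1)"
  "act1 SigmaBar (unit_vec 2) = unit_vec (- 1)"
  "act1 SigmaBar (unit_vec 1) = unit_vec (- 2)"
  by (auto simp: unit_vec_def fun_eq_iff sgn_if)

lemma act1_fix_unit_vec: "s \<in> D_letters k \<Longrightarrow> int k + 1 < c \<Longrightarrow> act1 s (unit_vec c) = unit_vec c"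
  by (auto simp: D_letters_def unit_vec_def fun_eq_iff split: if_splits)

lemma act_fix_unit_vec:
  "u \<in> lists (D_letters k) \<Longrightarrow> int k + 1 < c \<Longrightarrow> act u (unit_vec c) = unit_vec c"
  by (induction u) (auto simp: act1_fix_unit_vec)

lemma act_fix_zero: "u \<in> lists (D_letters k) \<Longrightarrow> act u (\<lambda>_. 0) = (\<lambda>_. 0)"
  by (induction u) (auto simp: D_letters_def fun_eq_iff split: if_splits)

lemma act_ascending:
  "1 \<le> a \<Longrightarrow> a \<le> b \<Longrightarrow> act (map Sigma [a..<b]) (unit_vec (int b)) = unit_vec (int a)"
proof (induction "b - a" arbitrary: a)
  case (Suc d)
  then have "[a..<b] = a # [Suc a..<b]" by (simp add: upt_conv_Cons)
  moreover have "act (map Sigma [Suc a..<b]) (unit_vec (int b)) = unit_vec (int a + 1)"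
    using Suc.hyps(1)[of "Suc a"] Suc.hyps(2) Suc.prems by (simp add: add.commute)
  ultimately show ?case using act1_unit_vec(1)[of a] Suc.prems by (simp del: act1.simps)
qed simp

lemma act_descending:
  "1 \<le> j \<Longrightarrow> act (rev (map Sigma [2..<Suc j])) (unit_vec (- 2)) = unit_vec (- int j - 1)"
proof (induction j)
  case (Suc j)
  show ?case
  proof (cases "j = 0")
    case False
    then have "act (rev (map Sigma [2..<Suc (Suc j)])) (unit_vec (- 2)) =
        act1 (Sigma (Suc j)) (unit_vec (- int j - 1))"
      using Suc by (simp del: act1.simps)
    moreover have "- int j - 1 = - int (Suc j)" by simp
    ultimately show ?thesis using act1_unit_vec(2)[of "Suc j"] by simp
  qed simp
qed simp

text \<open>The signed index to which the bracket with index \<open>m\<close> and top k sends the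
  unit vector of index k + 1. As \<open>m\<close> runs from -k to k + 1, each of the 2k + 2 signed
  unit vectors up to index k + 1 is hit once, so brackets represent the cosets of the stabilizer.
  The index 0 goes to -2, since \<open>SigmaBar\<close> leads to -1 and \<sigma>_1 then to
  -2.\<close>

definition bracket_image :: "int \<Rightarrow> int" where
  "bracket_image m = (if m \<ge> 1 then m else if m = 0 then - 2 else if m = - 1 then - 1 else m - 1)"

lemma bracket_image_inject: "bracket_image m = bracket_image m' \<Longrightarrow> m = m'"
  by (auto simp: bracket_image_def split: if_splits)

lemma bracket_image_neq_0: "bracket_image m \<noteq> 0"
  by (auto simp: bracket_image_def split: if_splits)

lemma act_bracket:
  assumes "1 \<le> k" "m \<le> int k + 1"
  shows "act (bracket m k) (unit_vec (int k + 1)) = unit_vec (bracket_image m)"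
proof -
  have a: "act (map Sigma [i..<Suc k]) (unit_vec (int k + 1)) = unit_vec (int i)"
    if "1 \<le> i" "i \<le> Suc k" for i
    using act_ascending[OF that] by (simp add: add.commute)
  consider "m \<ge> 1" | "m = 0" | "m = -1" | "m \<le> -2" by linarith
  then show ?thesis
  proof cases
    case 1
    then show ?thesis using a[of "nat m"] assms by (simp add: bracket_def bracket_image_def)
  next
    case 2
    then show ?thesis using a[of 2] assms act1_unit_vec(3) act1_unit_vec(2)[of 1]
      by (simp add: bracket_def bracket_image_def del: act1.simps)
  next
    case 3
    then show ?thesis using a[of 2] assms act1_unit_vec(3)
      by (simp add: bracket_def bracket_image_def del: act1.simps)
  next
    case 4
    then show ?thesis
      using a[of 2] assms act1_unit_vec(3) act1_unit_vec(2)[of 1] act_descending[of "nat (- m)"]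
      by (simp add: bracket_def bracket_image_def del: act1.simps)
  qed
qed

lemma bracket_inject:
  assumes "1 \<le> k" "m \<le> int k + 1" "m' \<le> int k + 1"
    "act (bracket m k) (unit_vec (int k + 1)) = act (bracket m' k) (unit_vec (int k + 1))"
  shows "m = m'"
  using assms act_bracket unit_vec_inject[OF bracket_image_neq_0] bracket_image_inject by metis

lemma set_bracket:
  assumes "1 \<le> k" "- int k \<le> m" "m \<le> int k + 1"
  shows "set (bracket m k) \<subseteq> D_letters k"
  using assms by (auto simp: bracket_def D_letters_def)

lemma bracket_lists:
  "1 \<le> k \<Longrightarrow> - int k \<le> m \<Longrightarrow> m \<le> int k + 1 \<Longrightarrow> bracket m k \<in> lists (D_letters k)"
  using set_bracket by (simp add: lists_eq_set)

lemma bracket_empty: "1 \<le> k \<Longrightarrow> bracket (int k + 1) k = []"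
  by (simp add: bracket_def)

text \<open>The value f j = j + 1 encodes a missing bracket with top j.\<close>

fun brackets :: "(nat \<Rightarrow> int) \<Rightarrow> nat \<Rightarrow> gen list" where
  "brackets f 0 = []"
| "brackets f (Suc k) = bracket (f (Suc k)) (Suc k) @ brackets f k"

definition valid_tops :: "(nat \<Rightarrow> int) \<Rightarrow> nat \<Rightarrow> bool" where
  "valid_tops f k \<longleftrightarrow> (\<forall>j\<in>{1..k}. - int j \<le> f j \<and> f j \<le> int j + 1)"

lemma valid_topsD: "valid_tops f k \<Longrightarrow> 1 \<le> j \<Longrightarrow> j \<le> k \<Longrightarrow> - int j \<le> f j \<and> f j \<le> int j + 1"
  by (auto simp: valid_tops_def)

lemma brackets_cong: "(\<And>j. 1 \<le> j \<Longrightarrow> j \<le> k \<Longrightarrow> f j = g j) \<Longrightarrow> brackets f k = brackets g k"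
  by (induction k) auto

lemma brackets_lists: "valid_tops f k \<Longrightarrow> brackets f k \<in> lists (D_letters k)"
proof (induction k)
  case (Suc k)
  have "bracket (f (Suc k)) (Suc k) \<in> lists (D_letters (Suc k))"
    by (rule bracket_lists) (use valid_topsD[OF Suc.prems, of "Suc k"] in auto)
  moreover have "brackets f k \<in> lists (D_letters k)"
    by (rule Suc.IH) (use Suc.prems in \<open>auto simp: valid_tops_def\<close>)
  ultimately show ?case using D_letters_mono[of k "Suc k"] by (auto simp: lists_eq_set)
qed simp

text \<open>The size conditions of form (S) alone. What remains of form (S) concerns adjacent
  indices and is captured later by \<open>follows\<close>.\<close>

definition tops_ok :: "int list \<Rightarrow> nat list \<Rightarrow> nat \<Rightarrow> bool" where
  "tops_ok ms ns k \<longleftrightarrow> list_all2 (\<lambda>m j. \<bar>m\<bar> \<le> int j) ms ns \<and> sorted_wrt (>) ns \<and> set ns \<subseteq> {1..k}"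

lemma tops_ok_Nil [simp]: "tops_ok [] [] k"
  by (simp add: tops_ok_def)

lemma word_S_Nil [simp]: "word_S [] ns = []"
  by (simp add: word_S_def)

lemma word_S_Cons [simp]: "word_S (a # ms) (b # ns) = bracket a b @ word_S ms ns"
  by (simp add: word_S_def)

lemma tops_ok_Cons:
  "tops_ok (a # ms) ns k \<longleftrightarrow> (\<exists>b ns'. ns = b # ns' \<and> \<bar>a\<bar> \<le> int b \<and> 1 \<le> b \<and> b \<le> k \<and> tops_ok ms ns' (b - 1))"
proof
  assume "tops_ok (a # ms) ns k"
  then obtain b ns' where ns: "ns = b # ns'" and *: "list_all2 (\<lambda>m j. \<bar>m\<bar> \<le> int j) ms ns'"
      "\<bar>a\<bar> \<le> int b" "\<forall>y\<in>set ns'. y < b" "sorted_wrt (>) ns'" "set (b # ns') \<subseteq> {1..k}"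
    by (auto simp: tops_ok_def list_all2_Cons1)
  have "set ns' \<subseteq> {1..b - 1}" using *(3,5) by fastforce
  then show "\<exists>b ns'. ns = b # ns' \<and> \<bar>a\<bar> \<le> int b \<and> 1 \<le> b \<and> b \<le> k \<and> tops_ok ms ns' (b - 1)"
    using ns * by (auto simp: tops_ok_def)
next
  assume "\<exists>b ns'. ns = b # ns' \<and> \<bar>a\<bar> \<le> int b \<and> 1 \<le> b \<and> b \<le> k \<and> tops_ok ms ns' (b - 1)"
  then show "tops_ok (a # ms) ns k" by (fastforce simp: tops_ok_def)
qed

lemma tops_ok_mono: "tops_ok ms ns j \<Longrightarrow> j \<le> k \<Longrightarrow> tops_ok ms ns k"
  by (auto simp: tops_ok_def)

lemma tops_ok_NilD: "tops_ok [] ns k \<Longrightarrow> ns = []"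
  by (simp add: tops_ok_def)

lemma tops_ok_0: "tops_ok ms ns 0 \<Longrightarrow> ms = [] \<and> ns = []"
  by (auto simp: tops_ok_def)

text \<open>Two encodings of a product of brackets: lists as in form (S), and a function with one
  possibly missing bracket for every top. The latter makes uniqueness and left multiplication plain
  inductions on \<open>k\<close>.\<close>

lemma word_S_brackets:
  assumes "tops_ok ms ns k"
  shows "\<exists>f. valid_tops f k \<and> word_S ms ns = brackets f k"
  using assms
proof (induction k arbitrary: ms ns)
  case 0
  then have "ms = []" using tops_ok_0 by blast
  then show ?case by (auto simp: valid_tops_def)
next
  case (Suc k)
  have "\<exists>c ms' ns'. - int (Suc k) \<le> c \<and> c \<le> int (Suc k) + 1 \<and> tops_ok ms' ns' k \<and>
      word_S ms ns = bracket c (Suc k) @ word_S ms' ns'"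
  proof (cases "\<exists>a ms' ns'. ms = a # ms' \<and> ns = Suc k # ns'")
    case True
    then obtain a ms' ns' where ms: "ms = a # ms'" "ns = Suc k # ns'" by blast
    then have "\<bar>a\<bar> \<le> int (Suc k)" "tops_ok ms' ns' k" using Suc.prems by (auto simp: tops_ok_Cons)
    then show ?thesis using ms by (intro exI[of _ a] exI[of _ ms'] exI[of _ ns']) auto
  next
    case False
    have "tops_ok ms ns k"
    proof (cases ms)
      case Nil
      then show ?thesis using tops_ok_NilD[of ns "Suc k"] Suc.prems by auto
    next
      case (Cons a ms')
      then obtain b ns' where ns: "ns = b # ns'" and *: "\<bar>a\<bar> \<le> int b" "1 \<le> b" "b \<le> Suc k"
          "tops_ok ms' ns' (b - 1)"
        using Suc.prems tops_ok_Cons by blast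
      then have "b \<le> k" using False Cons by auto
      then show ?thesis using Cons ns * by (auto simp: tops_ok_Cons)
    qed
    then show ?thesis using bracket_empty[of "Suc k"]
      by (intro exI[of _ "int (Suc k) + 1"] exI[of _ ms] exI[of _ ns]) auto
  qed
  then obtain c ms' ns' where c: "- int (Suc k) \<le> c" "c \<le> int (Suc k) + 1" "tops_ok ms' ns' k"
      "word_S ms ns = bracket c (Suc k) @ word_S ms' ns'" by blast
  obtain f where f: "valid_tops f k" "word_S ms' ns' = brackets f k" using Suc.IH[OF c(3)] by blast
  have "brackets (f(Suc k := c)) k = brackets f k" by (rule brackets_cong) simp
  moreover have "valid_tops (f(Suc k := c)) (Suc k)"
    using f(1) c(1,2) unfolding valid_tops_def by auto
  ultimately show ?case using c(4) f(2)
    by (intro exI[of _ "f(Suc k := c)"]) (simp del: fun_upd_apply add: fun_upd_same)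
qed

lemma brackets_word_S:
  assumes "valid_tops f k"
  shows "\<exists>ms ns. tops_ok ms ns k \<and> brackets f k = word_S ms ns"
  using assms
proof (induction k)
  case (Suc k)
  then have "valid_tops f k" by (auto simp: valid_tops_def)
  then obtain ms ns where *: "tops_ok ms ns k" "brackets f k = word_S ms ns" using Suc.IH by blast
  have c: "- int (Suc k) \<le> f (Suc k)" "f (Suc k) \<le> int (Suc k) + 1"
    using valid_topsD[OF Suc.prems, of "Suc k"] by auto
  show ?case
  proof (cases "f (Suc k) = int (Suc k) + 1")
    case True
    then show ?thesis using * bracket_empty[of "Suc k"] tops_ok_mono[of ms ns k "Suc k"]
      by (intro exI[of _ ms] exI[of _ ns]) auto
  next
    case False
    then show ?thesis using * c
      by (intro exI[of _ "f (Suc k) # ms"] exI[of _ "Suc k # ns"]) (auto simp: tops_ok_Cons)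
  qed
next
  case 0
  show ?case by (intro exI[of _ "[]"]) simp
qed

lemma word_S_lists: "tops_ok ms ns k \<Longrightarrow> word_S ms ns \<in> lists (D_letters k)"
  using word_S_brackets brackets_lists by metis

lemma form_S_tops_ok: "form_S N ms ns \<Longrightarrow> tops_ok ms ns N"
  by (auto simp: form_S_def tops_ok_def list_all2_conv_all_nth)

context btilde
begin

lemma D_gens: "k \<le> n - 1 \<Longrightarrow> D_letters k \<subseteq> gens_B n"
  using D_letters_mono[of k "n - 1"] gens_D_letters[of n] n3 by (auto simp: gens_B_def)

lemma gens_B_letters: "gens_B n = insert (Tgen n) (D_letters (n - 1))"
  using gens_D_letters[of n] n3 by (simp add: gens_B_def)

lemma Tgen_notin_D_letters [simp]: "Tgen j \<notin> D_letters k"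
  by (auto simp: D_letters_def)

lemma D_lists_gens: "k \<le> n - 1 \<Longrightarrow> u \<in> lists (D_letters k) \<Longrightarrow> u \<in> lists (gens_B n)"
  using D_gens lists_mono by blast

lemma act_eqv: "u \<approx> v \<Longrightarrow> act u = act v"
  by (rule act_cong[OF n3])

text \<open>The unit vector just beyond the top is fixed by all lower brackets, so its image
  determines the top bracket, which is then cancelled.\<close>

lemma brackets_unique:
  assumes "valid_tops f k" "valid_tops g k" "k \<le> n - 1" "brackets f k \<approx> brackets g k"
  shows "brackets f k = brackets g k"
  using assms
proof (induction k)
  case (Suc k)
  have v: "valid_tops f k" "valid_tops g k" using Suc.prems by (auto simp: valid_tops_def)
  have fixed: "act (brackets h k) (unit_vec (int (Suc k) + 1)) = unit_vec (int (Suc k) + 1)"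
    if "valid_tops h k" for h
    using act_fix_unit_vec[OF brackets_lists[OF that]] by simp
  have "act (bracket (f (Suc k)) (Suc k)) (unit_vec (int (Suc k) + 1)) =
      act (bracket (g (Suc k)) (Suc k)) (unit_vec (int (Suc k) + 1))"
    using fun_cong[OF act_eqv[OF Suc.prems(4)], of "unit_vec (int (Suc k) + 1)"] fixed[OF v(1)] fixed[OF v(2)]
    by simp
  then have eq: "f (Suc k) = g (Suc k)"
    by (rule bracket_inject[rotated 3])
      (use valid_topsD[OF Suc.prems(1), of "Suc k"] valid_topsD[OF Suc.prems(2), of "Suc k"] in auto)
  then have "brackets f k \<approx> brackets g k" using Suc.prems(4) eqv_cancel_left by simp
  then have "brackets f k = brackets g k" using Suc v by simp
  then show ?case using eq by simp
qed simp

lemma NF_D_tops: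
  assumes "v \<in> NF_D n"
  obtains ms ns where "tops_ok ms ns (n - 1)" "v = word_S ms ns" "form_S (n - 1) ms ns"
  using assms form_S_tops_ok by (auto simp: NF_D_def)

lemma NF_D_lists: "v \<in> NF_D n \<Longrightarrow> v \<in> lists (D_letters (n - 1))"
  using NF_D_tops word_S_lists by metis

lemma NF_D_unique:
  assumes "u \<in> NF_D n" "v \<in> NF_D n" "u \<approx> v"
  shows "u = v"
proof -
  obtain f g where "valid_tops f (n - 1)" "u = brackets f (n - 1)"
      "valid_tops g (n - 1)" "v = brackets g (n - 1)"
    using assms NF_D_tops word_S_brackets by metis
  then show ?thesis using brackets_unique assms(3) by blast
qed

text \<open>Letters of type D fix the origin and t_n moves it to the n-th unit vector, so the image
  of the origin determines the bracket. The hypothesis is equality in the group because the words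
  compared here may fail to be good.\<close>

lemma bracket_t_cancel:
  assumes "i \<le> int n" "j \<le> int n" "u \<in> lists (D_letters (n - 1))" "v \<in> lists (D_letters (n - 1))"
    "bracket_t n i @ u \<approx> bracket_t n j @ v"
  shows "i = j \<and> u \<approx> v"
proof -
  have N: "int (n - 1) + 1 = int n" using n3 by simp
  have t: "act1 (Tgen n) (\<lambda>_. 0) = unit_vec (int n)"
    using n3 by (auto simp: unit_vec_def fun_eq_iff sgn_if)
  have "act (bracket i (n - 1)) (unit_vec (int n)) = act (bracket j (n - 1)) (unit_vec (int n))"
    using fun_cong[OF act_eqv[OF assms(5)], of "\<lambda>_. 0"] act_fix_zero[OF assms(3)]
      act_fix_zero[OF assms(4)] t
    by (simp add: bracket_t_def del: act1.simps)
  then have "i = j"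
    using bracket_inject[of "n - 1" i j] assms N n3 by simp
  then show ?thesis using assms(5) eqv_cancel_left by blast
qed

lemma bracket_t_lists:
  "- int (n - 1) \<le> i \<Longrightarrow> i \<le> int n \<Longrightarrow> bracket_t n i \<in> lists (gens_B n)"
proof -
  assume "- int (n - 1) \<le> i" "i \<le> int n"
  then have "bracket i (n - 1) \<in> lists (D_letters (n - 1))"
    by (intro bracket_lists) (use n3 in auto)
  then have "bracket i (n - 1) \<in> lists (gens_B n)" using D_lists_gens by blast
  then show ?thesis by (simp add: bracket_t_def gens_B_def)
qed

lemma t_notin_bracket: "- int (n - 1) \<le> i \<Longrightarrow> i \<le> int n \<Longrightarrow> Tgen n \<notin> set (bracket i (n - 1))"
proof -
  assume "- int (n - 1) \<le> i" "i \<le> int n"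
  then have "set (bracket i (n - 1)) \<subseteq> D_letters (n - 1)"
    by (intro set_bracket) (use n3 in auto)
  then show ?thesis by auto
qed

lemma t_commute_letters: "s \<in> gens_B n \<Longrightarrow> cox_B n (Tgen n) s = 2 \<Longrightarrow> s \<in> D_letters (n - 2)"
  using n3 by (auto simp: gens_B_letters D_letters_def cox_B_simps split: if_splits)

text \<open>A commutation moves only letters that fix the n-th unit vector across the first t_n, so the
  following is an invariant of the commutation class; it determines the first block.\<close>

definition first_t_image :: "gen list \<Rightarrow> nat \<Rightarrow> int" where
  "first_t_image u = act (takeWhile (\<lambda>s. s \<noteq> Tgen n) u) (unit_vec (int n))"

lemma first_t_image_ceq:
  assumes "u \<sim> v" "u \<in> lists (gens_B n)"
  shows "first_t_image u = first_t_image v"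
  using assms(1)
proof (induction rule: rtranclp_induct)
  case (step y z)
  obtain a b p q where *: "cox_B n p q = 2" "y = a @ [p, q] @ b" "z = a @ [q, p] @ b"
    using step(2) unfolding commutation_step_def by blast
  have "y \<in> lists (gens_B n)" using ceq_lists[OF step(1) assms(2)] .
  then have pq: "p \<in> gens_B n" "q \<in> gens_B n" "p \<noteq> q" using * m_one[of p q] by auto
  have fixed: "act1 s (unit_vec (int n)) = unit_vec (int n)"
    if "s \<in> gens_B n" "cox_B n (Tgen n) s = 2" for s
    by (rule act1_fix_unit_vec[OF t_commute_letters[OF that]]) (use n3 in auto)
  have "first_t_image y = first_t_image z"
  proof (cases "Tgen n \<in> set a")
    case True
    then show ?thesis unfolding first_t_image_def *(2,3) by (subst (1 2) takeWhile_append1) auto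
  next
    case False
    then have tw: "takeWhile (\<lambda>s. s \<noteq> Tgen n) (a @ w) = a @ takeWhile (\<lambda>s. s \<noteq> Tgen n) w" for w
      by (intro takeWhile_append2) auto
    consider "p = Tgen n" | "q = Tgen n" | "p \<noteq> Tgen n" "q \<noteq> Tgen n" by blast
    then show ?thesis
    proof cases
      case 1
      then show ?thesis using fixed[OF pq(2)] *(1) pq(3)
        by (auto simp: first_t_image_def *(2,3) tw simp del: act1.simps)
    next
      case 2
      then show ?thesis using fixed[OF pq(1)] *(1) pq(3) m_sym[of p q]
        by (auto simp: first_t_image_def *(2,3) tw simp del: act1.simps)
    next
      case 3
      have "act [p, q] = act [q, p]" using act_eqv[OF eqv_commute[OF pq(1,2) *(1)]] .
      then have "act1 p (act1 q x) = act1 q (act1 p x)" for x by (simp add: fun_eq_iff)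
      then show ?thesis using 3
        by (simp add: first_t_image_def *(2,3) tw del: act1.simps)
    qed
  qed
  with step.IH show ?case by simp
qed simp

text \<open>With several t_n the image of the origin no longer isolates the first block, so the
  invariant of the commutation class is used instead. Left cancellation then removes that
  block.\<close>

lemma bracket_t_blocks_unique:
  assumes "concat (map (bracket_t n) xs) @ u \<sim> concat (map (bracket_t n) ys) @ v"
    "set xs \<subseteq> {- int (n - 1)..int n}" "set ys \<subseteq> {- int (n - 1)..int n}"
    "u \<in> lists (D_letters (n - 1))" "v \<in> lists (D_letters (n - 1))"
  shows "xs = ys \<and> u \<sim> v"
  using assms
proof (induction xs arbitrary: ys)
  case Nil
  have "Tgen n \<notin> set (concat (map (bracket_t n) ys) @ v)"
    using ceq_set[OF Nil.prems(1)] Nil.prems(4) by (auto simp: lists_eq_set)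
  then have "ys = []" by (cases ys) (auto simp: bracket_t_def)
  then show ?case using Nil by simp
next
  case (Cons x xs)
  have "Tgen n \<in> set (concat (map (bracket_t n) ys) @ v)"
    using ceq_set[OF Cons.prems(1)] by (auto simp: bracket_t_def)
  then obtain y ys' where ys: "ys = y # ys'" using Cons.prems(5) by (cases ys) (auto simp: lists_eq_set)
  have im: "first_t_image (bracket_t n z @ w) = act (bracket z (n - 1)) (unit_vec (int n))"
    if "z \<in> {- int (n - 1)..int n}" for z w
    using t_notin_bracket[of z] that
    by (auto simp: first_t_image_def bracket_t_def takeWhile_append)
  have "concat (map (bracket_t n) (x # xs)) \<in> lists (gens_B n)"
    using Cons.prems(2) bracket_t_lists by (force simp: lists_eq_set)
  then have "concat (map (bracket_t n) (x # xs)) @ u \<in> lists (gens_B n)"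
    using D_lists_gens[of "n - 1" u] Cons.prems(4) by (simp del: concat.simps)
  from first_t_image_ceq[OF Cons.prems(1) this]
  have "act (bracket x (n - 1)) (unit_vec (int n)) = act (bracket y (n - 1)) (unit_vec (int n))"
    using im[of x] im[of y] Cons.prems ys by simp
  then have "x = y" using bracket_inject[of "n - 1" x y] Cons.prems ys n3 by simp
  then have "concat (map (bracket_t n) xs) @ u \<sim> concat (map (bracket_t n) ys') @ v"
    using Cons.prems(1) ys ceq_cancel_left[of "bracket_t n x"] by simp
  then show ?case using Cons.IH[of ys'] Cons.prems ys \<open>x = y\<close> by simp
qed

end

section \<open>Factorisations of brackets and the neighbours inside them\<close>

context small_coxeter
begin

text \<open>The test that excludes nearly all configurations below: a single enclosed neighbour is
  too little unless its edge has label 4.\<close>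

lemma not_fc_single:
  assumes "s \<notin> set P" "filter (\<lambda>x. 3 \<le> m s x) P = [] \<or> (\<exists>y. filter (\<lambda>x. 3 \<le> m s x) P = [y] \<and> m s y \<noteq> 4)"
  shows "\<not> fc (A @ s # P @ s # Q)"
proof -
  have "nbs s (P @ s # Q) = filter (\<lambda>x. 3 \<le> m s x) P"
    using assms(1) by (simp add: nbs_append nbs_notin)
  then have "\<not> ok s (P @ s # Q)" using assms(2) by (auto simp: ok_def)
  then show ?thesis using fc_appendD[of A "s # P @ s # Q"] by auto
qed

end

lemma upt_append: "a \<le> j \<Longrightarrow> j \<le> b \<Longrightarrow> [a..<b] = [a..<j] @ [j..<b]"
  using upt_add_eq_append[of a j "b - j"] by simp

lemma upt_split: "a \<le> j \<Longrightarrow> j < b \<Longrightarrow> [a..<b] = [a..<j] @ j # [Suc j..<b]"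
  using upt_append[of a j b] upt_conv_Cons[of j b] by simp

lemma bracket_pos: "1 \<le> a \<Longrightarrow> bracket (int a) k = map Sigma [a..<Suc k]"
  by (simp add: bracket_def)

lemma bracket_single: "1 \<le> k \<Longrightarrow> bracket (int k) k = [Sigma k]"
  by (simp add: bracket_pos)

lemma bracket_0: "bracket 0 k = Sigma 1 # SigmaBar # map Sigma [2..<Suc k]"
  by (simp add: bracket_def)

lemma bracket_m1: "bracket (- 1) k = SigmaBar # map Sigma [2..<Suc k]"
  by (simp add: bracket_def)

lemma bracket_neg:
  "2 \<le> j \<Longrightarrow> bracket (- int j) k =
     rev (map Sigma [2..<Suc j]) @ Sigma 1 # SigmaBar # map Sigma [2..<Suc k]"
  by (auto simp: bracket_def)

lemma bracket_cases:
  obtains a where "m = int a" "1 \<le> a" | "m = 0" | "m = -1" | j where "m = - int j" "2 \<le> j"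
proof -
  consider "m \<ge> 1" | "m = 0" | "m = -1" | "m \<le> -2" by linarith
  then show thesis
  proof cases
    case 1
    then show ?thesis using that(1)[of "nat m"] by simp
  next
    case 4
    then show ?thesis using that(4)[of "nat (- m)"] by simp
  qed (use that in auto)
qed

lemma bracket_snoc:
  assumes "2 \<le> k" "- int k < m" "m \<le> int k"
  shows "bracket m k = bracket m (k - 1) @ [Sigma k]"
  using assms by (cases k) (auto simp: bracket_def)

lemma bracket_last:
  assumes "2 \<le> k" "m \<le> int k"
  shows "\<exists>X. bracket m k = X @ [Sigma k]"
  using assms by (auto simp: bracket_def)

lemma bracket_extreme:
  assumes "2 \<le> k" "\<bar>m\<bar> = int k"
  shows "\<exists>X. bracket m k = Sigma k # X"
proof -
  have "m = int k \<or> m = - int k" using assms by linarith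
  then show ?thesis using assms by (auto simp: bracket_pos bracket_neg)
qed

context btilde
begin

lemma n2: "2 \<le> n - 1"
  using n3 by simp

abbreviation adj :: "gen \<Rightarrow> gen \<Rightarrow> bool" where "adj s x \<equiv> 3 \<le> cox_B n s x"

lemma filter_adj_ascending:
  assumes "1 \<le> a" "j \<le> n - 1"
  shows "filter (adj (Sigma j)) (map Sigma [a..<j]) = (if a < j then [Sigma (j - 1)] else [])"
proof (cases "a < j")
  case True
  then obtain i where i: "j = Suc i" "a \<le> i" by (cases j) auto
  have "filter (adj (Sigma j)) (map Sigma [a..<i]) = []"
    by (auto simp: filter_empty_conv cox_B_simps i)
  then show ?thesis using i assms by (simp add: cox_B_simps)
qed simp

lemma filter_adj_above:
  assumes "1 \<le> j" "k \<le> n - 1"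
  shows "filter (adj (Sigma j)) (map Sigma [Suc j..<Suc k]) = (if j < k then [Sigma (Suc j)] else [])"
proof (cases "j < k")
  case True
  then have "[Suc j..<Suc k] = Suc j # [Suc (Suc j)..<Suc k]" by (intro upt_conv_Cons) simp
  moreover have "filter (adj (Sigma j)) (map Sigma [Suc (Suc j)..<Suc k]) = []"
    by (auto simp: filter_empty_conv cox_B_simps)
  ultimately show ?thesis using True assms by (simp add: cox_B_simps)
qed simp

lemma filter_adj_above_rev:
  assumes "1 \<le> j" "k \<le> n - 1"
  shows "filter (adj (Sigma j)) (rev (map Sigma [Suc j..<Suc k])) = (if j < k then [Sigma (Suc j)] else [])"
  unfolding rev_filter[symmetric] filter_adj_above[OF assms] by simp

lemma filter_adj_bar:
  assumes "2 \<le> k"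
  shows "filter (adj SigmaBar) (map Sigma [2..<Suc k]) = [Sigma 2]"
proof -
  have "[2..<Suc k] = 2 # [3..<Suc k]" using assms by (simp add: upt_conv_Cons)
  moreover have "filter (adj SigmaBar) (map Sigma [3..<Suc k]) = []"
    by (auto simp: filter_empty_conv cox_B_simps)
  ultimately show ?thesis by (simp add: cox_B_simps)
qed

lemma filter_adj_bar_rev:
  "2 \<le> k \<Longrightarrow> filter (adj SigmaBar) (rev (map Sigma [2..<Suc k])) = [Sigma 2]"
  unfolding rev_filter[symmetric] filter_adj_bar by simp

subsection \<open>Existence of the block decomposition\<close>

text \<open>Either \<open>s\<close> extends the bracket, up to a swap of \<sigma>_1 and
  \<open>SigmaBar\<close>, or it passes to what follows, and there the smaller letter set drives the
  recursion. In every other position \<open>s\<close> recurs inside the bracket too early for a good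
  word.\<close>

lemma prepend_bracket:
  assumes k: "1 \<le> k" "k \<le> n - 1" and m: "- int k \<le> m" "m \<le> int k + 1"
    and s: "s \<in> D_letters k" and fc: "fc (s # bracket m k @ R)"
  shows "(\<exists>m'. - int k \<le> m' \<and> m' \<le> int k + 1 \<and> s # bracket m k \<sim> bracket m' k) \<or>
    s \<in> D_letters (k - 1) \<and> (\<forall>x\<in>set (bracket m k). cox_B n s x = 2)"
proof -
  have not_fc: False
    if "s # bracket m k @ R = s # P @ s # Q" "s \<notin> set P"
      "filter (adj s) P = [] \<or> (\<exists>y. filter (adj s) P = [y] \<and> cox_B n s y \<noteq> 4)" for P Q
    using not_fc_single[OF that(2,3), of "[]" Q] fc that(1) by simp
  show ?thesis
  proof (cases m rule: bracket_cases)
    case (1 a)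
    have B: "bracket m k = map Sigma [a..<Suc k]" using 1 bracket_pos by simp
    show ?thesis
    proof (cases s)
      case (Sigma j)
      then have j: "1 \<le> j" "j \<le> k" using s by (auto simp: D_letters_def split: if_splits)
      consider "a \<le> j" | "a = Suc j" | "Suc j < a" by linarith
      then show ?thesis
      proof cases
        case a: 1
        have "s # bracket m k @ R = s # map Sigma [a..<j] @ s # map Sigma [Suc j..<Suc k] @ R"
          unfolding B using upt_split[of a j "Suc k"] a j Sigma by (simp del: upt_Suc)
        then show ?thesis
          by (rule not_fc[elim_format])
            (use filter_adj_ascending[of a j] 1 j k Sigma in \<open>auto simp: cox_B_simps\<close>)
      next
        case 2
        then have "s # bracket m k = bracket (int j) k"
          unfolding B using j Sigma bracket_pos[of j k] by (simp add: upt_conv_Cons del: upt_Suc)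
        then show ?thesis using j by (intro disjI1 exI[of _ "int j"]) auto
      next
        case 3
        then have "s \<in> D_letters (k - 1)" using j 1 m Sigma by (auto simp: D_letters_def)
        then show ?thesis using 3 B Sigma by (auto simp: cox_B_simps)
      qed
    next
      case SigmaBar
      consider "a = 1" | "a = 2" | "3 \<le> a" using 1 by linarith
      then show ?thesis
      proof cases
        case a: 1
        \<comment> \<open>The definition of \<open>bracket 0\<close> fixes an order of the two
          commuting letters, so a swap is needed.\<close>
        have "s # bracket m k = SigmaBar # Sigma 1 # map Sigma [2..<Suc k]"
          unfolding B using a k SigmaBar by (simp add: upt_conv_Cons numeral_2_eq_2 del: upt_Suc)
        moreover have "SigmaBar # Sigma 1 # map Sigma [2..<Suc k] \<sim> bracket 0 k"
          unfolding bracket_0 by (rule ceq_swap) (simp add: cox_B_simps)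
        ultimately show ?thesis by (intro disjI1 exI[of _ 0]) auto
      next
        case a: 2
        then have "s # bracket m k = bracket (- 1) k" using B SigmaBar bracket_m1 by simp
        then show ?thesis using k by (intro disjI1 exI[of _ "- 1"]) auto
      next
        case 3
        then have "s \<in> D_letters (k - 1)" using 1 m SigmaBar by (auto simp: D_letters_def)
        then show ?thesis using 3 B SigmaBar by (auto simp: cox_B_simps)
      qed
    next
      case (Tgen j)
      then show ?thesis using s by simp
    qed
  next
    case 2
    have B: "bracket m k = Sigma 1 # SigmaBar # map Sigma [2..<Suc k]" using 2 bracket_0 by simp
    show ?thesis
    proof (cases s)
      case (Sigma j)
      then have j: "1 \<le> j" "j \<le> k" using s by (auto simp: D_letters_def split: if_splits)
      consider "j = 1" | "j = 2" | "3 \<le> j" using j by linarith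
      then show ?thesis
      proof cases
        case 1
        then show ?thesis using not_fc[of "[]" "SigmaBar # map Sigma [2..<Suc k] @ R"] B Sigma by simp
      next
        \<comment> \<open>The index jumps from 0 to -2, because -1 denotes the bracket that starts
          with \<open>SigmaBar\<close>.\<close>
        case j2: 2
        then have "s # bracket m k = bracket (- int 2) k"
          unfolding B using Sigma by (subst bracket_neg) auto
        then show ?thesis using j2 j by (intro disjI1 exI[of _ "- int 2"]) auto
      next
        case 3
        have "s # bracket m k @ R =
            s # (Sigma 1 # SigmaBar # map Sigma [2..<j]) @ s # map Sigma [Suc j..<Suc k] @ R"
          unfolding B using upt_split[of 2 j "Suc k"] 3 j Sigma by (simp del: upt_Suc)
        then show ?thesis
          by (rule not_fc[elim_format])
            (use filter_adj_ascending[of 2 j] 3 j k Sigma in \<open>auto simp: cox_B_simps\<close>)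
      qed
    next
      case SigmaBar
      then show ?thesis using not_fc[of "[Sigma 1]" "map Sigma [2..<Suc k] @ R"] B
        by (simp add: cox_B_simps)
    next
      case (Tgen j)
      then show ?thesis using s by simp
    qed
  next
    case 3
    have B: "bracket m k = SigmaBar # map Sigma [2..<Suc k]" using 3 bracket_m1 by simp
    show ?thesis
    proof (cases s)
      case (Sigma j)
      then have j: "1 \<le> j" "j \<le> k" using s by (auto simp: D_letters_def split: if_splits)
      show ?thesis
      proof (cases "j = 1")
        case True
        then have "s # bracket m k = bracket 0 k" using B Sigma bracket_0 by simp
        then show ?thesis using k by (intro disjI1 exI[of _ 0]) auto
      next
        case False
        then have j2: "2 \<le> j" using j by simp
        have "s # bracket m k @ R =
            s # (SigmaBar # map Sigma [2..<j]) @ s # map Sigma [Suc j..<Suc k] @ R"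
          unfolding B using upt_split[of 2 j "Suc k"] j2 j Sigma by (simp del: upt_Suc)
        then show ?thesis
          by (rule not_fc[elim_format])
            (use filter_adj_ascending[of 2 j] j2 j k Sigma in \<open>auto simp: cox_B_simps\<close>)
      qed
    next
      case SigmaBar
      then show ?thesis using not_fc[of "[]" "map Sigma [2..<Suc k] @ R"] B by simp
    next
      case (Tgen j)
      then show ?thesis using s by simp
    qed
  next
    case (4 i)
    have i: "i \<le> k" using 4 m by simp
    have B: "bracket m k = rev (map Sigma [2..<Suc i]) @ Sigma 1 # SigmaBar # map Sigma [2..<Suc k]"
      using 4 bracket_neg by simp
    show ?thesis
    proof (cases s)
      case (Sigma j)
      then have j: "1 \<le> j" "j \<le> k" using s by (auto simp: D_letters_def split: if_splits)
      consider "j = 1" | "2 \<le> j" "j \<le> i" | "j = Suc i" | "Suc i < j" using j by linarith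
      then show ?thesis
      proof cases
        case 1
        have f: "filter (adj s) (rev (map Sigma [2..<Suc i])) = [Sigma 2]"
          using filter_adj_above_rev[of 1 i] 1 4 i k Sigma by (simp add: numeral_2_eq_2 del: upt_Suc)
        have "s # bracket m k @ R =
            s # rev (map Sigma [2..<Suc i]) @ s # SigmaBar # map Sigma [2..<Suc k] @ R"
          using B 1 Sigma by (simp del: upt_Suc)
        then show ?thesis
          by (rule not_fc[elim_format])
            (use f 1 Sigma in \<open>auto simp: cox_B_simps simp del: upt_Suc\<close>)
      next
        case 2
        have "s # bracket m k @ R = s # rev (map Sigma [Suc j..<Suc i]) @ s #
            rev (map Sigma [2..<j]) @ Sigma 1 # SigmaBar # map Sigma [2..<Suc k] @ R"
          unfolding B using upt_split[of 2 j "Suc i"] 2 Sigma by (simp del: upt_Suc)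
        then show ?thesis
          by (rule not_fc[elim_format])
            (use filter_adj_above_rev[of j i] 2 i j k Sigma in \<open>auto simp: cox_B_simps simp del: upt_Suc\<close>)
      next
        case 3
        then have "s # bracket m k = bracket (- int j) k"
          unfolding B using Sigma 4 by (subst bracket_neg) auto
        then show ?thesis using j by (intro disjI1 exI[of _ "- int j"]) auto
      next
        case j2: 4
        have f: "filter (adj s) (rev (map Sigma [2..<Suc i])) = []"
          using j2 Sigma by (auto simp: filter_empty_conv cox_B_simps)
        have "s # bracket m k @ R = s # (rev (map Sigma [2..<Suc i]) @ Sigma 1 # SigmaBar #
            map Sigma [2..<j]) @ s # map Sigma [Suc j..<Suc k] @ R"
          unfolding B using upt_split[of 2 j "Suc k"] j2 4 j Sigma by (simp del: upt_Suc)
        then show ?thesis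
          by (rule not_fc[elim_format])
            (use f filter_adj_ascending[of 2 j] j2 4 j k Sigma in \<open>auto simp: cox_B_simps simp del: upt_Suc\<close>)
      qed
    next
      case SigmaBar
      have "s # bracket m k @ R =
          s # (rev (map Sigma [2..<Suc i]) @ [Sigma 1]) @ s # map Sigma [2..<Suc k] @ R"
        using B SigmaBar by simp
      then show ?thesis
        by (rule not_fc[elim_format])
          (use filter_adj_bar_rev[of i] 4 SigmaBar in \<open>auto simp: cox_B_simps simp del: upt_Suc\<close>)
    next
      case (Tgen j)
      then show ?thesis using s by simp
    qed
  qed
qed

lemma prepend_brackets:
  assumes "valid_tops f k" "k \<le> n - 1" "s \<in> D_letters k" "fc (s # brackets f k)"
  shows "\<exists>g. valid_tops g k \<and> s # brackets f k \<sim> brackets g k"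
  using assms
proof (induction k)
  case 0
  then show ?case by (simp add: D_letters_def)
next
  case (Suc k)
  have c: "- int (Suc k) \<le> f (Suc k)" "f (Suc k) \<le> int (Suc k) + 1"
    using valid_topsD[OF Suc.prems(1), of "Suc k"] by auto
  have v: "valid_tops f k" using Suc.prems(1) by (auto simp: valid_tops_def)
  have "fc (s # bracket (f (Suc k)) (Suc k) @ brackets f k)" using Suc.prems(4) by simp
  from prepend_bracket[OF _ Suc.prems(2) c Suc.prems(3) this]
  consider m' where "- int (Suc k) \<le> m'" "m' \<le> int (Suc k) + 1"
      "s # bracket (f (Suc k)) (Suc k) \<sim> bracket m' (Suc k)"
    | "s \<in> D_letters k" "\<forall>x\<in>set (bracket (f (Suc k)) (Suc k)). cox_B n s x = 2"
    by auto
  then show ?case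
  proof cases
    case 1
    have "brackets (f(Suc k := m')) k = brackets f k" by (rule brackets_cong) simp
    moreover have "valid_tops (f(Suc k := m')) (Suc k)"
      using v 1(1,2) unfolding valid_tops_def by auto
    moreover have "s # bracket (f (Suc k)) (Suc k) @ brackets f k \<sim> bracket m' (Suc k) @ brackets f k"
      using ceq_right[OF 1(3)] by simp
    ultimately show ?thesis
      by (intro exI[of _ "f(Suc k := m')"]) (simp del: fun_upd_apply add: fun_upd_same)
  next
    case 2
    have sh: "s # bracket (f (Suc k)) (Suc k) @ brackets f k \<sim> bracket (f (Suc k)) (Suc k) @ s # brackets f k"
      by (rule ceq_shift) (use 2 in auto)
    then have "fc (s # brackets f k)" using ceq_fc Suc.prems(4) fc_appendD by (metis brackets.simps(2))
    then obtain g where g: "valid_tops g k" "s # brackets f k \<sim> brackets g k"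
      using Suc.IH[OF v _ 2(1)] Suc.prems(2) by auto
    let ?g = "g(Suc k := f (Suc k))"
    have "brackets ?g k = brackets g k" by (rule brackets_cong) simp
    moreover have "valid_tops ?g (Suc k)" using g(1) c unfolding valid_tops_def by auto
    moreover have "s # brackets f (Suc k) \<sim> bracket (f (Suc k)) (Suc k) @ brackets g k"
      using ceq_trans[OF sh ceq_left[OF g(2)]] by simp
    ultimately show ?thesis
      by (intro exI[of _ ?g]) (simp del: fun_upd_apply add: fun_upd_same)
  qed
qed

lemma t_commute: "s \<in> D_letters (n - 2) \<Longrightarrow> cox_B n s (Tgen n) = 2"
  using n3 by (auto simp: D_letters_def cox_B_simps split: if_splits)

lemma prepend_blocks:
  assumes "set xs \<subseteq> {- int (n - 1)..int n}" "valid_tops f (n - 1)" "s \<in> gens_B n"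
    "fc (s # concat (map (bracket_t n) xs) @ brackets f (n - 1))"
  shows "\<exists>ys g. set ys \<subseteq> {- int (n - 1)..int n} \<and> valid_tops g (n - 1) \<and>
    s # concat (map (bracket_t n) xs) @ brackets f (n - 1) \<sim>
    concat (map (bracket_t n) ys) @ brackets g (n - 1)"
proof (cases "s = Tgen n")
  case True
  \<comment> \<open>Index n stands for the empty bracket, so a lone t_n is a block.\<close>
  have "bracket (int n) (n - 1) = []" using bracket_empty[of "n - 1"] n3 by simp
  then have "s # concat (map (bracket_t n) xs) = concat (map (bracket_t n) (int n # xs))"
    using True by (simp add: bracket_t_def)
  moreover have "set (int n # xs) \<subseteq> {- int (n - 1)..int n}" using assms(1) by simp
  ultimately show ?thesis using assms(2)
    by (intro exI[of _ "int n # xs"] exI[of _ f]) (metis append_Cons rtranclp.rtrancl_refl)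
next
  case False
  then have "s \<in> D_letters (n - 1)" using assms(3) gens_B_letters by auto
  then show ?thesis using assms(1,4)
  proof (induction xs)
    case Nil
    then obtain g where "valid_tops g (n - 1)" "s # brackets f (n - 1) \<sim> brackets g (n - 1)"
      using prepend_brackets[OF assms(2)] by auto
    then show ?case by (intro exI[of _ "[]"] exI[of _ g]) simp
  next
    case (Cons x xs)
    let ?R = "concat (map (bracket_t n) xs) @ brackets f (n - 1)"
    have x: "- int (n - 1) \<le> x" "x \<le> int (n - 1) + 1" using Cons.prems n3 by auto
    have f: "fc (s # bracket x (n - 1) @ Tgen n # ?R)" using Cons.prems(3) by (simp add: bracket_t_def[of n x])
    have n1: "1 \<le> n - 1" using n3 by simp
    from prepend_bracket[OF n1 le_refl x Cons.prems(1) f]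
    consider x' where "- int (n - 1) \<le> x'" "x' \<le> int (n - 1) + 1"
        "s # bracket x (n - 1) \<sim> bracket x' (n - 1)"
      | "s \<in> D_letters (n - 2)" "\<forall>y\<in>set (bracket x (n - 1)). cox_B n s y = 2"
      by (auto simp: numeral_2_eq_2)
    then show ?case
    proof cases
      case 1
      have "s # bracket x (n - 1) @ Tgen n # ?R \<sim> bracket x' (n - 1) @ Tgen n # ?R"
        using ceq_right[OF 1(3)] by simp
      then show ?thesis using 1 assms(2) Cons.prems(2) n3
        by (intro exI[of _ "x' # xs"] exI[of _ f]) (auto simp: bracket_t_def[of n x] bracket_t_def[of n x'])
    next
      case 2
      have "s # bracket_t n x @ ?R \<sim> bracket_t n x @ s # ?R"
        by (rule ceq_shift) (use 2 t_commute in \<open>auto simp: bracket_t_def\<close>)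
      then have sh: "s # concat (map (bracket_t n) (x # xs)) @ brackets f (n - 1) \<sim> bracket_t n x @ s # ?R"
        by simp
      then have "fc (s # ?R)" using ceq_fc[OF sh] Cons.prems(3) fc_appendD by blast
      then obtain ys g where g: "set ys \<subseteq> {- int (n - 1)..int n}" "valid_tops g (n - 1)"
          "s # ?R \<sim> concat (map (bracket_t n) ys) @ brackets g (n - 1)"
        using Cons.IH Cons.prems by auto
      have "s # concat (map (bracket_t n) (x # xs)) @ brackets f (n - 1) \<sim>
          concat (map (bracket_t n) (x # ys)) @ brackets g (n - 1)"
        using ceq_trans[OF sh ceq_left[OF g(3)]] by simp
      then show ?thesis using g Cons.prems(2) by (intro exI[of _ "x # ys"] exI[of _ g]) auto
    qed
  qed
qed

lemma block_decomposition:
  assumes "u \<in> lists (gens_B n)" "fc u"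
  obtains xs ms ns where "set xs \<subseteq> {- int (n - 1)..int n}" "tops_ok ms ns (n - 1)"
    "u \<sim> concat (map (bracket_t n) xs) @ word_S ms ns"
proof -
  have "\<exists>xs f. set xs \<subseteq> {- int (n - 1)..int n} \<and> valid_tops f (n - 1) \<and>
      u \<sim> concat (map (bracket_t n) xs) @ brackets f (n - 1)"
    using assms
  proof (induction u)
    case Nil
    have "brackets (\<lambda>j. int j + 1) k = []" for k
      using bracket_empty by (induction k) (auto simp del: of_nat_Suc)
    then show ?case
      by (intro exI[of _ "[]"] exI[of _ "\<lambda>j. int j + 1"]) (auto simp: valid_tops_def)
  next
    case (Cons s u)
    then obtain xs f where *: "set xs \<subseteq> {- int (n - 1)..int n}" "valid_tops f (n - 1)"
        "u \<sim> concat (map (bracket_t n) xs) @ brackets f (n - 1)" by auto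
    have su: "s # u \<sim> s # concat (map (bracket_t n) xs) @ brackets f (n - 1)"
      by (rule ceq_Cons[OF *(3)])
    then have f: "fc (s # concat (map (bracket_t n) xs) @ brackets f (n - 1))"
      using ceq_fc Cons.prems by blast
    have "s \<in> gens_B n" using Cons.hyps by simp
    from prepend_blocks[OF *(1,2) this f] obtain ys g where "set ys \<subseteq> {- int (n - 1)..int n}" "valid_tops g (n - 1)"
        "s # concat (map (bracket_t n) xs) @ brackets f (n - 1) \<sim>
         concat (map (bracket_t n) ys) @ brackets g (n - 1)"
      by blast
    then show ?case using ceq_trans[OF su] by blast
  qed
  then show thesis using that brackets_word_S by metis
qed

subsection \<open>Constraints on consecutive brackets\<close>

text \<open>The relation between the indices of consecutive brackets in a good word: descending in
  absolute value from indices at least 2, then alternating between 1 and -1. The index 0 and those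
  at most -2 have no successor, so they can only stand at the end.\<close>

definition follows :: "int \<Rightarrow> int \<Rightarrow> bool" where
  "follows x y \<longleftrightarrow> 2 \<le> x \<and> \<bar>y\<bar> < x \<or> \<bar>x\<bar> = 1 \<and> y = - x"

text \<open>Behind the last \<sigma>_j only \<sigma>_(j+1) is a neighbour: \<open>SigmaBar\<close>
  may come after \<sigma>_1 but commutes with it. For \<open>m = - 1\<close> the bracket contains no
  \<sigma>_1, whence the last assumption.\<close>

lemma bracket_last_Sigma:
  assumes "1 \<le> j" "j < k" "k \<le> n - 1" "m \<le> int j" "m \<noteq> - 1 \<or> 2 \<le> j"
  shows "\<exists>X Q. bracket m k = X @ Sigma j # Q \<and> Sigma j \<notin> set Q \<and>
    filter (adj (Sigma j)) Q = [Sigma (Suc j)]"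
proof -
  have u: "map Sigma [a..<Suc k] = map Sigma [a..<j] @ Sigma j # map Sigma [Suc j..<Suc k]"
    if "a \<le> j" for a
    using upt_split[of a j "Suc k"] that assms by simp
  have f: "filter (adj (Sigma j)) (map Sigma [Suc j..<Suc k]) = [Sigma (Suc j)]"
    using filter_adj_above[of j k] assms by simp
  show ?thesis
  proof (cases "j = 1 \<and> m \<le> 0")
    case True
    then have "m = 0 \<or> m \<le> - 2" using assms(5) by auto
    then have "\<exists>X. bracket m k = X @ Sigma 1 # SigmaBar # map Sigma [2..<Suc k]"
      by (cases m rule: bracket_cases) (auto simp: bracket_0 bracket_neg simp del: upt_Suc)
    then obtain X where "bracket m k = X @ Sigma 1 # SigmaBar # map Sigma [2..<Suc k]" ..
    moreover have "filter (adj (Sigma j)) (SigmaBar # map Sigma [2..<Suc k]) = [Sigma (Suc j)]"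
      using f True by (simp add: numeral_2_eq_2 cox_B_simps del: upt_Suc)
    moreover have "Sigma 1 \<notin> set (SigmaBar # map Sigma [2..<Suc k])" by auto
    ultimately show ?thesis using True by blast
  next
    case False
    have "\<exists>X. bracket m k = X @ map Sigma [j..<Suc k]"
    proof (cases m rule: bracket_cases)
      case (1 a)
      then show ?thesis using u[of a] u[of j] assms by (simp add: bracket_pos del: upt_Suc)
    next
      case 2
      then show ?thesis using u[of 2] u[of j] False assms by (simp add: bracket_0 del: upt_Suc)
    next
      case 3
      then show ?thesis using u[of 2] u[of j] False assms by (simp add: bracket_m1 del: upt_Suc)
    next
      case (4 i)
      then show ?thesis using u[of 2] u[of j] False assms by (simp add: bracket_neg del: upt_Suc)
    qed
    then obtain X where "bracket m k = X @ map Sigma [j..<Suc k]" ..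
    then have "bracket m k = X @ Sigma j # map Sigma [Suc j..<Suc k]"
      using u[of j] by simp
    moreover have "Sigma j \<notin> set (map Sigma [Suc j..<Suc k])" by auto
    ultimately show ?thesis using f by blast
  qed
qed

lemma bracket_last_SigmaBar:
  assumes "m \<le> 0"
  shows "\<exists>X. bracket m k = X @ SigmaBar # map Sigma [2..<Suc k]"
  using assms
  by (cases m rule: bracket_cases) (auto simp: bracket_0 bracket_m1 bracket_neg simp del: upt_Suc)

text \<open>If \<open>follows\<close> fails, the first letter of the second bracket, or its
  \<open>SigmaBar\<close>, also occurs in the first bracket, and the two occurrences enclose a
  single neighbour along an edge labelled 3. The letters of \<open>P\<close> lie above
  \<open>j\<close> and add no neighbour; for that the index \<open>m'\<close> must stay below
  \<open>j\<close> in absolute value.\<close>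

lemma consecutive_brackets:
  assumes fc: "fc (A @ bracket m k @ P @ bracket m' k' @ R)"
    and j: "2 \<le> j" "j \<le> k" "k \<le> n - 1" and P: "set P \<subseteq> insert (Tgen n) (Sigma ` {j<..})"
    and m': "\<bar>m'\<bar> < int j" "m' \<le> int k'"
  shows "follows m m'"
proof (rule ccontr)
  assume not_tr: "\<not> follows m m'"
  have bad_Sigma: False
    if l: "1 \<le> l" "l < j" "m \<le> int l" "m \<noteq> - 1 \<or> 2 \<le> l"
      and R': "bracket m' k' = Sigma l # R'" for l R'
  proof -
    have "l < k" using l j by simp
    then obtain X Q where Q: "bracket m k = X @ Sigma l # Q" "Sigma l \<notin> set Q"
        "filter (adj (Sigma l)) Q = [Sigma (Suc l)]"
      using bracket_last_Sigma[OF l(1) _ j(3) l(3,4)] by blast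
    have "\<not> adj (Sigma l) x \<and> x \<noteq> Sigma l" if "x \<in> set P" for x
      using that P l j by (auto simp: cox_B_simps)
    then have "Sigma l \<notin> set (Q @ P)" "filter (adj (Sigma l)) (Q @ P) = [Sigma (Suc l)]"
      using Q by (auto simp: filter_empty_conv)
    then have "\<not> fc ((A @ X) @ Sigma l # (Q @ P) @ Sigma l # R' @ R)"
      by (intro not_fc_single) (auto simp: cox_B_simps)
    then show False using fc Q(1) R' by simp
  qed
  have bad_bar: False
    if m0: "m \<le> 0" and R': "bracket m' k' = P' @ SigmaBar # R'" "P' = [] \<or> P' = [Sigma 1]" for P' R'
  proof -
    obtain X where X: "bracket m k = X @ SigmaBar # map Sigma [2..<Suc k]"
      using bracket_last_SigmaBar[OF m0] by blast
    let ?Q = "map Sigma [2..<Suc k] @ P @ P'"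
    have "\<not> adj SigmaBar x \<and> x \<noteq> SigmaBar" if "x \<in> set P" for x
      using that P j by (auto simp: cox_B_simps)
    moreover have "filter (adj SigmaBar) (map Sigma [2..<Suc k]) = [Sigma 2]"
      by (rule filter_adj_bar) (use j in simp)
    ultimately have "SigmaBar \<notin> set ?Q" "filter (adj SigmaBar) ?Q = [Sigma 2]"
      using R'(2) by (auto simp: cox_B_simps filter_empty_conv simp del: upt_Suc)
    then have "\<not> fc ((A @ X) @ SigmaBar # ?Q @ SigmaBar # R' @ R)"
      by (intro not_fc_single) (auto simp: cox_B_simps)
    then show False using fc X R'(1) by simp
  qed
  show False
  proof (cases m' rule: bracket_cases)
    case (1 a)
    then have "bracket m' k' = Sigma a # map Sigma [Suc a..<Suc k']"
      using m'(2) by (auto simp: bracket_pos upt_conv_Cons simp del: upt_Suc)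
    moreover have "m \<le> int a" "m \<noteq> - 1 \<or> 2 \<le> a" "a < j"
      using not_tr 1 m' by (auto simp: follows_def)
    ultimately show ?thesis using bad_Sigma 1 by blast
  next
    case 2
    have B: "bracket m' k' = Sigma 1 # SigmaBar # map Sigma [2..<Suc k']"
      using 2 bracket_0 by simp
    \<comment> \<open>For \<open>m \<le> 0\<close> it is \<open>SigmaBar\<close> that recurs, for
      \<open>m = 1\<close> it is \<sigma>_1.\<close>
    have "m \<le> 0 \<or> m = 1" using not_tr 2 by (auto simp: follows_def)
    then show ?thesis
      using bad_bar[of "[Sigma 1]" "map Sigma [2..<Suc k']"] bad_Sigma[OF _ _ _ _ B] B j
      by (auto simp del: upt_Suc)
  next
    case 3
    have "m \<le> 0" using not_tr 3 by (auto simp: follows_def)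
    then show ?thesis
      using bad_bar[of "[]" "map Sigma [2..<Suc k']"] 3 by (simp add: bracket_m1 del: upt_Suc)
  next
    case (4 a)
    have "[2..<Suc a] = [2..<a] @ [a]" using 4 by simp
    then have "bracket m' k' = Sigma a # rev (map Sigma [2..<a]) @ Sigma 1 # SigmaBar # map Sigma [2..<Suc k']"
      using 4 by (simp add: bracket_neg del: upt_Suc)
    moreover have "m \<le> int a" "a < j" using not_tr 4 m' by (auto simp: follows_def)
    ultimately show ?thesis using bad_Sigma 4 by auto
  qed
qed

text \<open>For these indices \<sigma>_N, where N = n - 1, occurs once in the bracket and the other
  letters commute with t_n, so commutations produce t_n \<sigma>_N t_n \<sigma>_N. The index -N,
  with \<sigma>_N at both ends, escapes.\<close>

lemma not_fc_t_bracket_t: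
  assumes "- int (n - 1) < i" "i \<le> int (n - 1)"
  shows "\<not> fc (A @ Tgen n # bracket i (n - 1) @ Tgen n # Sigma (n - 1) # R)"
proof
  let ?N = "n - 1"
  assume fc: "fc (A @ Tgen n # bracket i ?N @ Tgen n # Sigma ?N # R)"
  define X where "X = bracket i (n - 2)"
  have n2: "n - 1 - 1 = n - 2" by simp
  have X: "bracket i ?N = X @ [Sigma ?N]"
    using bracket_snoc[of ?N i] assms n3 unfolding X_def n2 by simp
  have "set X \<subseteq> D_letters (n - 2)"
    unfolding X_def by (rule set_bracket) (use assms n3 in auto)
  then have XD: "x \<in> D_letters (n - 2)" if "x \<in> set X" for x using that by blast
  then have "filter (adj (Tgen n)) X = []"
    using t_commute m_sym by (auto simp: filter_empty_conv)
  moreover have tX: "Tgen n \<notin> set X" using XD Tgen_notin_D_letters by blast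
  ultimately have nt: "nbs (Tgen n) (X @ Sigma ?N # Tgen n # W) = [Sigma ?N]" for W
    by (simp add: nbs_append nbs_notin cox_B_simps)
  have NX: "Sigma ?N \<notin> set X" using XD[of "Sigma ?N"] n3 by (auto simp: D_letters_def split: if_splits)
  have "after (Sigma ?N) (X @ Sigma ?N # W) = W" for W using NX by (induction X) auto
  then have "\<not> ok (Tgen n) (X @ Sigma ?N # Tgen n # Sigma ?N # R)"
    unfolding ok_def using nt by (auto simp: cox_B_simps)
  then show False using fc_appendD[OF fc] X by simp
qed

lemma not_fc_bracket_Sigma_t:
  assumes "i \<le> int (n - 1)"
  shows "\<not> fc (A @ bracket i (n - 1) @ Tgen n # Sigma (n - 1) # Tgen n # R)"
proof -
  obtain X where X: "bracket i (n - 1) = X @ [Sigma (n - 1)]"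
    using bracket_last[OF n2 assms] by blast
  have "has_braid ((A @ X) @ [Sigma (n - 1), Tgen n, Sigma (n - 1), Tgen n] @ R)"
    unfolding has_braid_def
    by (intro exI[of _ "A @ X"] exI[of _ R] exI[of _ "Sigma (n - 1)"] exI[of _ "Tgen n"])
      (simp add: cox_B_simps)
  then show ?thesis using fc_not_has_braid X by auto
qed

lemma follows_top: "\<bar>y\<bar> \<le> int (n - 1) \<Longrightarrow> follows (int n) y"
  using n3 by (auto simp: follows_def)

text \<open>The comparison of brackets covers |y| < N. Index n would put two t_n together, and index
  N gives \<sigma>_N t_n \<sigma>_N t_n unless the first bracket is empty. Index -N remains as the
  exception from which the first type arises.\<close>

lemma consecutive_blocks:
  assumes fc: "fc (A @ bracket_t n x @ bracket_t n y @ R)"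
    and "- int (n - 1) \<le> x" "x \<le> int n" "- int (n - 1) \<le> y" "y \<le> int n"
  shows "y \<le> int (n - 1) \<and> (follows x y \<or> y = - int (n - 1))"
proof -
  have "y \<noteq> int n"
  proof
    assume "y = int n"
    then have "bracket y (n - 1) = []" using bracket_empty[of "n - 1"] n3 by simp
    then have "has_braid (A @ bracket_t n x @ bracket_t n y @ R)"
      unfolding has_braid_def bracket_t_def
      by (intro exI[of _ "A @ bracket x (n - 1)"] exI[of _ R] exI[of _ "Tgen n"]) simp
    then show False using fc fc_not_has_braid by blast
  qed
  then have y: "y \<le> int (n - 1)" using assms by linarith
  have fc': "fc (A @ bracket x (n - 1) @ [Tgen n] @ bracket y (n - 1) @ Tgen n # R)"
    using fc by (simp add: bracket_t_def)
  consider "\<bar>y\<bar> < int (n - 1)" | "y = int (n - 1)" | "y = - int (n - 1)" using y assms by linarith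
  then show ?thesis
  proof cases
    case 1
    then show ?thesis
      using consecutive_brackets[OF fc' n2 le_refl le_refl _ 1 y] y by simp
  next
    case 2
    show ?thesis
    proof (cases "x = int n")
      case True
      then show ?thesis using follows_top[of y] 2 by simp
    next
      case False
      then have "x \<le> int (n - 1)" using assms by linarith
      moreover have "bracket y (n - 1) = [Sigma (n - 1)]" unfolding 2 by (rule bracket_single) (use n2 in simp)
      ultimately show ?thesis using not_fc_bracket_Sigma_t[of x A R] fc' by simp
    qed
  qed (use y in simp)
qed

text \<open>A bracket with |z| = N starts with \<sigma>_N, so t_n \<sigma>_N t_n \<sigma>_N arises
  around the block of \<open>y\<close> unless that block has two \<sigma>_N. The block of
  \<open>x\<close> supplies the first t_n.\<close>

lemma three_blocks:
  assumes fc: "fc (A @ bracket_t n x @ bracket_t n y @ bracket z (n - 1) @ R)"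
    and "- int (n - 1) \<le> y" "y \<le> int (n - 1)" "\<bar>z\<bar> = int (n - 1)"
  shows "y = - int (n - 1)"
proof (rule ccontr)
  assume "y \<noteq> - int (n - 1)"
  then have y: "- int (n - 1) < y" using assms by simp
  obtain X where "bracket z (n - 1) = Sigma (n - 1) # X"
    using bracket_extreme[OF n2 assms(4)] by blast
  then show False
    using not_fc_t_bracket_t[OF y assms(3), of "A @ bracket x (n - 1)" "X @ R"] fc
    by (simp add: bracket_t_def)
qed

text \<open>Index -N spreads in both directions: having no successor under \<open>follows\<close> it
  must be repeated, and by \<open>three_blocks\<close> it forces -N before it. The first block is
  exempt, as no t_n precedes it inside the pattern.\<close>

lemma blocks_first_type:
  assumes "fc (A @ concat (map (bracket_t n) (x # xs)) @ R)" "set (x # xs) \<subseteq> {- int (n - 1)..int n}"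
    "- int (n - 1) \<in> set xs"
  shows "xs = replicate (length xs) (- int (n - 1))"
  using assms
proof (induction xs arbitrary: x A)
  case (Cons y zs)
  have fcy: "fc ((A @ bracket_t n x) @ concat (map (bracket_t n) (y # zs)) @ R)"
    using Cons.prems(1) by simp
  have y: "y \<le> int (n - 1)"
    using consecutive_blocks[of A x y] Cons.prems by simp
  show ?case
  proof (cases zs)
    case Nil
    then show ?thesis using Cons.prems by simp
  next
    case zs: (Cons z zs')
    have yz: "follows y z \<or> z = - int (n - 1)"
      using consecutive_blocks[of "A @ bracket_t n x" y z] Cons.prems zs by simp
    have "- int (n - 1) \<in> set zs"
    proof (rule ccontr)
      assume *: "- int (n - 1) \<notin> set zs"
      then have "y = - int (n - 1)" "z \<noteq> - int (n - 1)" using Cons.prems zs by auto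
      then show False using yz n3 by (auto simp: follows_def)
    qed
    then have r: "zs = replicate (length zs) (- int (n - 1))"
      using Cons.IH[OF fcy] Cons.prems by simp
    then have "z = - int (n - 1)" using zs by simp
    moreover have "fc (A @ bracket_t n x @ bracket_t n y @ bracket z (n - 1) @
        Tgen n # concat (map (bracket_t n) zs') @ R)"
      using Cons.prems(1) zs by (simp add: bracket_t_def[of n z])
    ultimately have "y = - int (n - 1)"
      using three_blocks[of A x y z] y Cons.prems by auto
    then show ?thesis using r by simp
  qed
qed simp

lemma blocks_second_type:
  assumes "fc (A @ concat (map (bracket_t n) xs) @ R)" "set xs \<subseteq> {- int (n - 1)..int n}"
    "- int (n - 1) \<notin> set (tl xs)"
  shows "successively follows xs"
  using assms
proof (induction xs arbitrary: A)
  case (Cons x xs)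
  show ?case
  proof (cases xs)
    case (Cons y ys)
    have "follows x y"
      using consecutive_blocks[of A x y] Cons Cons.prems by auto
    moreover have "successively follows xs"
      using Cons.IH[of "A @ bracket_t n x"] Cons Cons.prems by auto
    ultimately show ?thesis using Cons by simp
  qed simp
qed simp

lemma word_S_follows:
  assumes "fc (A @ word_S ms ns)" "tops_ok ms ns k" "k \<le> n - 1"
  shows "successively follows ms"
  using assms
proof (induction ms arbitrary: A ns k)
  case (Cons a ms)
  obtain b ns' where ns: "ns = b # ns'" and b: "\<bar>a\<bar> \<le> int b" "1 \<le> b" "b \<le> k" "tops_ok ms ns' (b - 1)"
    using Cons.prems(2) by (auto simp: tops_ok_Cons)
  have s: "successively follows ms"
    using Cons.IH[of "A @ bracket a b" ns' "b - 1"] Cons.prems ns b by simp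
  show ?case
  proof (cases ms)
    case ms: (Cons c ms')
    then obtain d ns'' where d: "ns' = d # ns''" "\<bar>c\<bar> \<le> int d" "1 \<le> d" "d \<le> b - 1"
      using b(4) by (auto simp: tops_ok_Cons)
    have "fc (A @ bracket a b @ [] @ bracket c d @ word_S ms' ns'')"
      using Cons.prems(1) ns ms d by simp
    then have "follows a c"
      by (rule consecutive_brackets[where j = b]) (use d b Cons.prems in auto)
    then show ?thesis using s ms by simp
  qed simp
qed simp

text \<open>At |m| = N the comparison of two brackets says nothing. There the t_n of the block
  \<open>w\<close> yields a contradiction through \<open>three_blocks\<close>.\<close>

lemma last_block_follows:
  assumes fc: "fc (A @ bracket_t n w @ bracket_t n x @ word_S (m # ms) ns)"
    and x: "- int (n - 1) < x" "x \<le> int (n - 1)" and t: "tops_ok (m # ms) ns (n - 1)"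
  shows "follows x m"
proof -
  obtain b ns' where ns: "ns = b # ns'" and b: "\<bar>m\<bar> \<le> int b" "1 \<le> b" "b \<le> n - 1"
    using t by (auto simp: tops_ok_Cons)
  show ?thesis
  proof (cases "\<bar>m\<bar> < int (n - 1)")
    case True
    have "fc ((A @ bracket_t n w) @ bracket x (n - 1) @ [Tgen n] @ bracket m b @ word_S ms ns')"
      using fc ns by (simp add: bracket_t_def)
    then show ?thesis
      by (rule consecutive_brackets[where j = "n - 1"]) (use True b n3 in auto)
  next
    case False
    then have "b = n - 1" "\<bar>m\<bar> = int (n - 1)" using b by auto
    then show ?thesis
      using three_blocks[of A w x m "word_S ms ns'"] fc ns x by simp
  qed
qed

text \<open>The index -N admits no successor, so each bracket of the tail has to start exactly one
  step below the descending run written so far. The tail spells \<sigma>_N, \<sigma>_(N-1), ...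
  downwards and may turn upwards once, past \<sigma>_1 and \<open>SigmaBar\<close>: it is the
  reverse of one bracket, up to a swap.\<close>

lemma first_type_tail:
  assumes "fc (A @ bracket (- int (n - 1)) (n - 1) @ [Tgen n] @
      rev (map Sigma [Suc j..<Suc (n - 1)]) @ word_S ms ns)"
    "tops_ok ms ns j" "j \<le> n - 1"
  shows "\<exists>g. - int (n - 1) \<le> g \<and> g \<le> int n \<and>
    rev (map Sigma [Suc j..<Suc (n - 1)]) @ word_S ms ns \<sim> rev (bracket g (n - 1))"
  using assms
proof (induction j arbitrary: ms ns)
  case 0
  then have "ms = []" using tops_ok_0 by blast
  then show ?case
    by (intro exI[of _ 1]) (use n3 bracket_pos[of 1 "n - 1"] in \<open>simp del: upt_Suc\<close>)
next
  case (Suc i)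
  define j where "j = Suc i"
  let ?D = "rev (map Sigma [Suc j..<Suc (n - 1)])"
  show ?case
  proof (cases ms)
    \<comment> \<open>The run has stopped above \<sigma>_j and is the reverse of \<langle>j + 1, N];
      for j = N this is the empty word.\<close>
    case Nil
    then show ?thesis
      by (intro exI[of _ "int (Suc j)"])
        (use Suc.prems bracket_pos[of "Suc j" "n - 1"] j_def in \<open>auto simp del: upt_Suc of_nat_Suc\<close>)
  next
    case (Cons m ms')
    then obtain b ns' where ns: "ns = b # ns'" and b: "\<bar>m\<bar> \<le> int b" "1 \<le> b" "b \<le> j"
        "tops_ok ms' ns' (b - 1)"
      using Suc.prems(2) by (auto simp: tops_ok_Cons j_def)
    have fc: "fc (A @ bracket (- int (n - 1)) (n - 1) @ [Tgen n] @ ?D @ bracket m b @ word_S ms' ns')"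
      using Suc.prems(1) Cons ns by (simp add: j_def)
    have Dj: "map Sigma [j..<Suc (n - 1)] = Sigma j # map Sigma [Suc j..<Suc (n - 1)]"
      using Suc.prems(3) by (simp add: j_def upt_conv_Cons del: upt_Suc)
    show ?thesis
    proof (cases "j = 1")
      case True
      then have b1: "b = 1" using b by simp
      then have "ms' = []" using b(4) tops_ok_0 by simp
      \<comment> \<open>At the bottom the run may end with \<sigma>_1, with \<open>SigmaBar\<close>
        or with both.\<close>
      have m: "m = 1 \<or> m = 0 \<or> m = -1" using b(1) b1 by linarith
      have D1: "[Suc j..<Suc (n - 1)] = [2..<Suc (n - 1)]" using True by (simp add: numeral_2_eq_2)
      have "?D @ bracket m 1 \<sim> rev (bracket m (n - 1))"
        using m
      proof (elim disjE)
        assume "m = 1"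
        then show ?thesis using bracket_pos[of 1 "n - 1"] bracket_pos[of 1 1] Dj True
          by (simp del: upt_Suc) (simp add: upt_rec)
      next
        assume m0: "m = 0"
        have "?D @ [Sigma 1, SigmaBar] \<sim> ?D @ [SigmaBar, Sigma 1]"
          by (rule ceq_left, rule ceq_swap) (simp add: cox_B_simps)
        then show ?thesis using m0 D1 by (simp add: bracket_0 del: upt_Suc)
      next
        assume "m = -1"
        then show ?thesis using D1 by (simp add: bracket_m1 del: upt_Suc)
      qed
      then show ?thesis using Cons ns b1 \<open>ms' = []\<close> m n3
        by (intro exI[of _ m]) (auto simp: j_def[symmetric] simp del: upt_Suc)
    next
      case False
      then have j2: "2 \<le> j" by (simp add: j_def)
      have jn: "j \<le> n - 1" using Suc.prems j_def by simp
      have mj: "\<bar>m\<bar> = int j"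
      proof (rule ccontr)
        assume "\<bar>m\<bar> \<noteq> int j"
        then have m: "\<bar>m\<bar> < int j" "m \<le> int b" using b by linarith+
        \<comment> \<open>The letters in between lie above \<open>j\<close>, so \<langle>-N, N] can
          be compared directly with the next bracket, which its index forbids.\<close>
        have P: "set ([Tgen n] @ ?D) \<subseteq> insert (Tgen n) (Sigma ` {j<..})" by auto
        have "fc (A @ bracket (- int (n - 1)) (n - 1) @ ([Tgen n] @ ?D) @ bracket m b @ word_S ms' ns')"
          using fc by simp
        then have "follows (- int (n - 1)) m"
          by (rule consecutive_brackets[OF _ j2 jn le_refl P m])
        then show False using n3 by (auto simp: follows_def)
      qed
      then have bj: "b = j" using b by linarith
      show ?thesis
      proof (cases "m = int j")
        case True
        have "bracket m b = [Sigma j]" using True bj j2 by (simp add: bracket_pos)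
        then have eq: "?D @ word_S ms ns = rev (map Sigma [Suc i..<Suc (n - 1)]) @ word_S ms' ns'"
          using Cons ns Dj by (simp add: j_def del: upt_Suc)
        show ?thesis
          using Suc.IH[of ms' ns'] Suc.prems b(4) bj eq by (simp add: j_def del: upt_Suc)
      next
        case False
        then have mneg: "m = - int j" using mj by linarith
        have "ms' = []"
        proof (rule ccontr)
          assume "ms' \<noteq> []"
          then obtain c ms'' where ms': "ms' = c # ms''" by (cases ms') auto
          then obtain d ns'' where d: "ns' = d # ns''" "\<bar>c\<bar> \<le> int d" "d \<le> b - 1"
            using b(4) by (auto simp: tops_ok_Cons)
          have "fc ((A @ bracket (- int (n - 1)) (n - 1) @ [Tgen n] @ ?D) @ bracket m b @ [] @
              bracket c d @ word_S ms'' ns'')"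
            using fc ms' d by simp
          then have "follows m c"
            by (rule consecutive_brackets[where j = j]) (use d bj j2 jn in auto)
          then show False using mneg j2 by (auto simp: follows_def)
        qed
        have u: "map Sigma [2..<Suc (n - 1)] = map Sigma [2..<Suc j] @ map Sigma [Suc j..<Suc (n - 1)]"
          using upt_append[of 2 "Suc j" "Suc (n - 1)"] j2 jn by (simp del: upt_Suc)
        let ?E = "?D @ rev (map Sigma [2..<Suc j])"
        have "?E @ Sigma 1 # SigmaBar # map Sigma [2..<Suc j] \<sim> ?E @ SigmaBar # Sigma 1 # map Sigma [2..<Suc j]"
          by (rule ceq_left, rule ceq_swap) (simp add: cox_B_simps)
        moreover have "?D @ bracket m b = ?E @ Sigma 1 # SigmaBar # map Sigma [2..<Suc j]"
          using mneg bj j2 by (simp add: bracket_neg del: upt_Suc)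
        moreover have "rev (bracket m (n - 1)) = ?E @ SigmaBar # Sigma 1 # map Sigma [2..<Suc j]"
          using mneg j2 u by (simp add: bracket_neg del: upt_Suc)
        ultimately have "?D @ bracket m b \<sim> rev (bracket m (n - 1))" by simp
        then show ?thesis using Cons ns \<open>ms' = []\<close> mneg jn
          by (intro exI[of _ m]) (auto simp: j_def[symmetric] simp del: upt_Suc)
      qed
    qed
  qed
qed

end

section \<open>Normal forms as chains of brackets\<close>

text \<open>The explicit form of a chain for \<open>follows\<close>, the bridge to the case
  distinctions in form (S) and in the second type. The alternatives for \<open>bs\<close> mirror the
  two alternatives of form (S).\<close>

definition chain_shape :: "int list \<Rightarrow> int list \<Rightarrow> bool" where
  "chain_shape as bs \<longleftrightarrow> sorted_wrt (>) as \<and> (\<forall>a\<in>set as. 2 \<le> a) \<and>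
     ((\<forall>b\<in>set bs. \<bar>b\<bar> = 1) \<and> successively (\<noteq>) bs \<or>
      (\<exists>b. bs = [b] \<and> b \<le> 0 \<and> b \<noteq> - 1 \<and> (\<forall>a\<in>set as. - b < a)))"

context btilde
begin

lemma follows_chain_shape:
  assumes "successively follows zs"
  shows "\<exists>as bs. zs = as @ bs \<and> chain_shape as bs"
  using assms
proof (induction zs)
  case Nil
  show ?case by (intro exI[of _ "[]"]) (simp add: chain_shape_def)
next
  case (Cons x zs)
  show ?case
  proof (cases zs)
    case Nil
    consider "2 \<le> x" | "\<bar>x\<bar> = 1" | "x \<le> 0" "x \<noteq> -1" by linarith
    then show ?thesis
    proof cases
      case 1
      then show ?thesis using Nil by (intro exI[of _ "[x]"] exI[of _ "[]"]) (simp add: chain_shape_def)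
    next
      case 2
      then show ?thesis using Nil by (intro exI[of _ "[]"] exI[of _ "[x]"]) (simp add: chain_shape_def)
    next
      case 3
      then show ?thesis using Nil by (intro exI[of _ "[]"] exI[of _ "[x]"]) (simp add: chain_shape_def)
    qed
  next
    case (Cons y zs')
    then have xy: "follows x y" using Cons.prems by simp
    obtain as bs where ab: "zs = as @ bs" "chain_shape as bs" using Cons.IH Cons.prems Cons by auto
    show ?thesis
    proof (cases "2 \<le> x")
      case True
      then have y: "\<bar>y\<bar> < x" using xy by (auto simp: follows_def)
      have "chain_shape (x # as) bs"
      proof (cases as)
        case Nil
        then show ?thesis using ab y True Cons by (auto simp: chain_shape_def)
      next
        case as: (Cons a as')
        then have "a = y" using ab Cons by simp
        then show ?thesis using ab y True as by (auto simp: chain_shape_def)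
      qed
      then show ?thesis using ab by (intro exI[of _ "x # as"] exI[of _ bs]) simp
    next
      case False
      then have x: "\<bar>x\<bar> = 1" "y = - x" using xy by (auto simp: follows_def)
      have "as = []"
        using ab x Cons by (cases as) (auto simp: chain_shape_def)
      then have "chain_shape [] (x # bs)"
        using ab x Cons by (auto simp: chain_shape_def)
      then show ?thesis using ab \<open>as = []\<close> by (intro exI[of _ "[]"] exI[of _ "x # bs"]) simp
    qed
  qed
qed

lemma follows_descending:
  assumes "sorted_wrt (>) as" "\<forall>a\<in>set as. 2 \<le> a"
  shows "successively follows as"
  using assms
proof (induction as)
  case (Cons a as)
  then show ?case by (cases as) (auto simp: follows_def)
qed simp

lemma follows_alternating:
  assumes "\<forall>b\<in>set bs. \<bar>b\<bar> = 1" "successively (\<noteq>) bs"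
  shows "successively follows bs"
  using assms
proof (induction bs)
  case (Cons a bs)
  then show ?case by (cases bs) (auto simp: follows_def)
qed simp

lemma chain_shape_follows:
  assumes "chain_shape as bs"
  shows "successively follows (as @ bs)"
proof -
  have "successively follows as"
    by (rule follows_descending) (use assms in \<open>auto simp: chain_shape_def\<close>)
  moreover have "successively follows bs"
    using assms follows_alternating by (auto simp: chain_shape_def)
  moreover have "follows (last as) (hd bs)" if "as \<noteq> []" "bs \<noteq> []"
  proof -
    have "last as \<in> set as" "hd bs \<in> set bs" using that by auto
    then show ?thesis using assms by (auto simp: chain_shape_def follows_def)
  qed
  ultimately show ?thesis by (auto simp: successively_append_iff)
qed

text \<open>Form (S) amounts to a condition on adjacent indices, and that is exactly what goodness
  of a word delivers.\<close>

lemma form_S_iff: "form_S N ms ns \<longleftrightarrow> tops_ok ms ns N \<and> successively follows ms"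
proof
  assume f: "form_S N ms ns"
  have "\<exists>as bs. ms = as @ bs \<and> chain_shape as bs"
  proof -
    consider s where "s \<le> length ms" "sorted_wrt (>) (take s ms)" "\<forall>m\<in>set (take s ms). m > 1"
        "\<forall>m\<in>set (drop s ms). \<bar>m\<bar> = 1"
      | "ms \<noteq> []" "sorted_wrt (>) (butlast ms)" "\<forall>m\<in>set (butlast ms). m > - last ms \<and> m > 1"
        "- last ms \<ge> 0" "last ms \<noteq> - 1"
      using f unfolding form_S_def by blast
    then show ?thesis
    proof cases
      case 1
      have "filter (\<lambda>m. \<bar>m\<bar> = 1) ms = filter (\<lambda>m. \<bar>m\<bar> = 1) (take s ms) @ filter (\<lambda>m. \<bar>m\<bar> = 1) (drop s ms)"
        by (metis append_take_drop_id filter_append)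
      moreover have "filter (\<lambda>m. \<bar>m\<bar> = 1) (take s ms) = []" using 1(3) by (auto simp: filter_empty_conv)
      moreover have "filter (\<lambda>m. \<bar>m\<bar> = 1) (drop s ms) = drop s ms" using 1(4) by simp
      ultimately have "successively (\<noteq>) (drop s ms)" using f by (simp add: form_S_def)
      then have "chain_shape (take s ms) (drop s ms)"
        using 1 unfolding chain_shape_def by (auto dest!: bspec)
      then show ?thesis by (metis append_take_drop_id)
    next
      case 2
      then have "chain_shape (butlast ms) [last ms]"
        unfolding chain_shape_def by (auto dest!: bspec)
      then show ?thesis using 2 by (metis append_butlast_last_id)
    qed
  qed
  then show "tops_ok ms ns N \<and> successively follows ms"
    using f form_S_tops_ok chain_shape_follows by blast
next
  assume t: "tops_ok ms ns N \<and> successively follows ms"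
  then obtain as bs where ab: "ms = as @ bs" "chain_shape as bs" using follows_chain_shape by blast
  have as: "filter (\<lambda>m. \<bar>m\<bar> = 1) as = []" using ab by (auto simp: filter_empty_conv chain_shape_def)
  have alt: "successively (\<noteq>) (filter (\<lambda>m. \<bar>m\<bar> = 1) ms)"
    using ab as by (auto simp: chain_shape_def)
  have b: "length ms = length ns \<and> sorted_wrt (>) ns \<and> set ns \<subseteq> {1..N} \<and>
      (\<forall>i<length ms. \<bar>ms ! i\<bar> \<le> int (ns ! i))"
    using t by (auto simp: tops_ok_def list_all2_conv_all_nth)
  have "(\<exists>s\<le>length ms. sorted_wrt (>) (take s ms) \<and> (\<forall>m\<in>set (take s ms). m > 1) \<and>
          (\<forall>m\<in>set (drop s ms). \<bar>m\<bar> = 1)) \<or>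
      (ms \<noteq> [] \<and> sorted_wrt (>) (butlast ms) \<and> (\<forall>m\<in>set (butlast ms). m > - last ms \<and> m > 1) \<and>
       - last ms \<ge> 0 \<and> last ms \<noteq> - 1)"
  proof -
    consider "\<forall>b\<in>set bs. \<bar>b\<bar> = 1"
      | b where "bs = [b]" "b \<le> 0" "b \<noteq> - 1" "\<forall>a\<in>set as. - b < a"
      using ab(2) unfolding chain_shape_def by blast
    then show ?thesis
    proof cases
      case 1
      then show ?thesis using ab
        by (intro disjI1 exI[of _ "length as"]) (auto simp: chain_shape_def)
    next
      case 2
      then show ?thesis using ab by (intro disjI2) (auto simp: chain_shape_def)
    qed
  qed
  then show "form_S N ms ns" using alt b unfolding form_S_def by blast
qed

lemma NF_D_iff: "v \<in> NF_D n \<longleftrightarrow> (\<exists>ms ns. v = word_S ms ns \<and> tops_ok ms ns (n - 1) \<and> successively follows ms)"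
  by (auto simp: NF_D_def form_S_iff)

lemma alternating_powers:
  assumes "\<forall>b\<in>set bs. \<bar>b\<bar> = (1::int)" "successively (\<noteq>) bs"
  shows "\<exists>a::nat. \<forall>i<length bs. bs ! i = (- 1) ^ (a + Suc i)"
  using assms
proof (induction bs)
  case (Cons b bs)
  then obtain a where a: "\<forall>i<length bs. bs ! i = (- 1) ^ (a + Suc i)"
    by (cases bs) auto
  show ?case
  proof (cases bs)
    case Nil
    have "b = 1 \<or> b = -1" using Cons.prems by auto
    then show ?thesis
    proof
      assume "b = 1"
      then show ?thesis using Nil by (intro exI[of _ 1]) simp
    next
      assume "b = -1"
      then show ?thesis using Nil by (intro exI[of _ 0]) simp
    qed
  next
    case c: (Cons c bs')
    then have "c = (- 1) ^ Suc a" using a by force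
    moreover have "\<bar>b\<bar> = 1" "\<bar>c\<bar> = 1" "b \<noteq> c" using Cons.prems c by auto
    then have "b = - c" by linarith
    ultimately have b: "b = (- 1) ^ a" by simp
    \<comment> \<open>Prepending an entry calls for the exponent a - 1; \<open>Suc a\<close> has the
      same parity and stays a natural number.\<close>
    have "(b # bs) ! i = (- 1) ^ (Suc a + Suc i)" if "i < length (b # bs)" for i
      using that a b by (cases i) auto
    then show ?thesis by blast
  qed
qed simp

lemma follows_index_list:
  assumes "is \<noteq> []" "sorted_wrt (>) (butlast is)"
    "length is \<ge> 2 \<longrightarrow> is ! (length is - 2) > \<bar>last is\<bar> \<and> is ! (length is - 2) > 1"
  shows "successively follows is \<and> (\<forall>x\<in>set (butlast is). 2 \<le> x)"
proof (cases "butlast is = []")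
  case True
  then show ?thesis using assms(1) by (cases "is") (auto split: if_splits)
next
  case False
  define bs where "bs = butlast is"
  have bs: "bs \<noteq> []" and isb: "is = bs @ [last is]" using False assms(1) by (simp_all add: bs_def)
  have len: "length is = Suc (length bs)" by (subst isb) simp
  have "is ! (length is - 2) = last bs"
    using bs len by (subst isb) (simp add: nth_append last_conv_nth numeral_2_eq_2)
  moreover have "2 \<le> length is" using len bs by (cases bs) auto
  ultimately have lb: "last bs > \<bar>last is\<bar>" "last bs > 1" using assms(3) by auto
  have "sorted_wrt (>) (butlast bs @ [last bs])" using assms(2) bs by (simp add: bs_def)
  then have "\<forall>x\<in>set (butlast bs). x > last bs" by (simp add: sorted_wrt_append)
  moreover have "set bs = set (butlast bs @ [last bs])" using bs by simp
  ultimately have ge: "\<forall>x\<in>set bs. 2 \<le> x" using lb by fastforce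
  have "successively follows bs"
    by (rule follows_descending) (use assms(2) ge in \<open>auto simp: bs_def\<close>)
  then have "successively follows (bs @ [last is])"
    using lb by (auto simp: successively_append_iff follows_def)
  then show ?thesis using isb ge bs_def by metis
qed

text \<open>In a word of the second type the brackets of the tail continue the chain formed by the
  blocks. Together with at least two blocks, this one condition describes the same words as the case
  distinctions of \<open>NF_second\<close>.\<close>

definition second_blocks :: "int list \<Rightarrow> int list \<Rightarrow> nat list \<Rightarrow> bool" where
  "second_blocks xs ms ns \<longleftrightarrow> set xs \<subseteq> {- int (n - 1)..int n} \<and> - int (n - 1) \<notin> set xs \<and>
     tops_ok ms ns (n - 1) \<and> successively follows (xs @ ms)"

lemma NF_second_blocks:
  assumes "u \<in> NF_second n"
  obtains xs ms ns where "u = concat (map (bracket_t n) xs) @ word_S ms ns" "2 \<le> length xs"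
    "second_blocks xs ms ns"
proof -
  obtain "is" js v where u: "u = concat (map (bracket_t n) is) @ concat (map (bracket_t n) js) @ v"
    and len: "length is + length js \<ge> 2" and v: "v \<in> NF_D n"
    and js: "js \<noteq> [] \<longrightarrow>
           (\<exists>a::nat. (\<forall>s\<in>{1..length js}. js ! (s - 1) = (- 1) ^ (a + s)) \<and>
              (\<exists>rs. sorted_wrt (>) rs \<and> set rs \<subseteq> {1..n - 1} \<and>
                 v = word_S (map (\<lambda>q. (- 1) ^ (a + length js + q)) [1..<Suc (length rs)]) rs))"
    and is1: "is \<noteq> [] \<longrightarrow>
           set is \<subseteq> {- int (n - 1)..int n} \<and>
           sorted_wrt (>) (butlast is) \<and> \<bar>last is\<bar> \<noteq> 1 \<and>
           (length is \<ge> 2 \<longrightarrow> is ! (length is - 2) > \<bar>last is\<bar> \<and> is ! (length is - 2) > 1)"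
    and is2: "is \<noteq> [] \<and> last is \<le> 0 \<longrightarrow> js = [] \<and> v = [] \<and> last is \<noteq> - int (n - 1)"
    and is3: "js = [] \<and> last is > 0 \<longrightarrow>
           (\<exists>ms ns. form_S (n - 1) ms ns \<and> v = word_S ms ns \<and>
                    (ms \<noteq> [] \<longrightarrow> \<bar>hd ms\<bar> < last is))"
    using assms unfolding NF_second_def by blast
  have fis: "successively follows is \<and> (\<forall>x\<in>set (butlast is). 2 \<le> x)"
    using follows_index_list[of "is"] is1 by (cases "is = []") auto
  have set_is: "set is = insert (last is) (set (butlast is))" if "is \<noteq> []"
    using that append_butlast_last_id[OF that] by (metis list.set(1) list.set(2) set_append
        Un_insert_right sup_bot_right)
  have is_ok: "set is \<subseteq> {- int (n - 1)..int n} \<and> - int (n - 1) \<notin> set is"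
  proof (cases "is = []")
    case False
    have "last is \<noteq> - int (n - 1)" using is2 False n3 by (cases "last is \<le> 0") auto
    moreover have "- int (n - 1) \<notin> set (butlast is)" using fis by force
    ultimately show ?thesis using is1 False set_is by auto
  qed simp
  show thesis
  proof (cases "js = []")
    case True
    \<comment> \<open>With no \<open>js\<close> the total length forces \<open>is\<close> to be
      nonempty, so \<open>last is\<close> is a genuine entry in the clauses used next.\<close>
    then have ne: "is \<noteq> []" using len by auto
    show ?thesis
    proof (cases "last is \<le> 0")
      case True
      then show ?thesis
        using that[of "is" "[]" "[]"] u len is2 ne fis is_ok \<open>js = []\<close> by (simp add: second_blocks_def)
    next
      case False
      then obtain ms ns where m: "form_S (n - 1) ms ns" "v = word_S ms ns"
          "ms \<noteq> [] \<longrightarrow> \<bar>hd ms\<bar> < last is"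
        using is3 True by auto
      then have t: "tops_ok ms ns (n - 1)" "successively follows ms" by (auto simp: form_S_iff)
      have "2 \<le> last is" using False is1 ne by auto
      then have "successively follows (is @ ms)"
        using t m ne fis by (auto simp: successively_append_iff follows_def)
      then show ?thesis using that[of "is" ms ns] u len True t m is_ok by (simp add: second_blocks_def)
    qed
  next
    case False
    obtain a rs where a: "\<forall>s\<in>{1..length js}. js ! (s - 1) = (- 1) ^ (a + s)"
      and rs: "sorted_wrt (>) rs" "set rs \<subseteq> {1..n - 1}"
        "v = word_S (map (\<lambda>q. (- 1) ^ (a + length js + q)) [1..<Suc (length rs)]) rs"
      using js False by blast
    define ms :: "int list" where "ms = map (\<lambda>q. (- 1) ^ (a + length js + q)) [1..<Suc (length rs)]"
    have jsn: "js ! i = (- 1) ^ (a + Suc i)" if "i < length js" for i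
      using bspec[OF a, of "Suc i"] that by simp
    have nth: "(js @ ms) ! i = (- 1) ^ (a + Suc i)" if "i < length (js @ ms)" for i
    proof (cases "i < length js")
      case True
      then show ?thesis using jsn by (simp add: nth_append)
    next
      case False
      have "[1..<Suc (length rs)] ! (i - length js) = Suc (i - length js)"
        by (subst nth_upt) (use that False in \<open>auto simp: ms_def simp del: upt_Suc\<close>)
      then show ?thesis using that False by (simp add: nth_append ms_def del: upt_Suc)
    qed
    have abs1: "\<bar>b\<bar> = 1" if "b \<in> set (js @ ms)" for b
      using that nth by (metis in_set_conv_nth power_abs abs_minus_cancel abs_one power_one)
    have "successively (\<noteq>) (js @ ms)"
      unfolding successively_conv_nth using nth by simp
    then have fj: "successively follows (js @ ms)" using follows_alternating abs1 by blast
    have lis: "2 \<le> last is" if "is \<noteq> []" using is1 is2 that False by auto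
    have "hd (js @ ms) \<in> set (js @ ms)" using False by simp
    then have "\<bar>hd (js @ ms)\<bar> = 1" by (rule abs1)
    then have "successively follows (is @ js @ ms)"
      using fis fj lis by (auto simp: successively_append_iff follows_def)
    moreover have "tops_ok ms rs (n - 1)"
      using rs abs1 by (auto simp: tops_ok_def list_all2_conv_all_nth ms_def power_abs simp del: upt_Suc
          dest!: subsetD[OF _ nth_mem])
    moreover have "set (is @ js) \<subseteq> {- int (n - 1)..int n}" "- int (n - 1) \<notin> set (is @ js)"
      using is_ok abs1 n3 by (force simp: abs_if split: if_splits)+
    ultimately show ?thesis
      using that[of "is @ js" ms rs] u len rs(3) by (simp add: second_blocks_def ms_def del: upt_Suc)
  qed
qed

text \<open>The chain is cut where its descending part ends. If that is not before the end of the
  blocks, there are no \<open>js\<close>. Otherwise the remaining blocks are the alternating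
  \<open>js\<close>, or there is one last nonpositive index and the tail is empty.\<close>

lemma blocks_NF_second:
  assumes "2 \<le> length xs" "second_blocks xs ms ns"
  shows "concat (map (bracket_t n) xs) @ word_S ms ns \<in> NF_second n"
proof -
  let ?v = "word_S ms ns"
  have t: "tops_ok ms ns (n - 1)" and f: "successively follows (xs @ ms)"
    and r: "set xs \<subseteq> {- int (n - 1)..int n}" "- int (n - 1) \<notin> set xs"
    using assms(2) by (auto simp: second_blocks_def)
  have fm: "successively follows ms" using f by (simp add: successively_append_iff)
  have vD: "?v \<in> NF_D n" using t fm by (auto simp: NF_D_iff)
  \<comment> \<open>\<open>bs'\<close> is independent of \<open>bs\<close> because \<open>is\<close>
    may be only a part of the chain, the rest going to \<open>js\<close> and to the tail.\<close>
  have idx: "sorted_wrt (>) (butlast is) \<and>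
      (length is \<ge> 2 \<longrightarrow> is ! (length is - 2) > \<bar>last is\<bar> \<and> is ! (length is - 2) > 1)"
    if "is = as @ bs" "chain_shape as bs'" "bs = [] \<or> bs = [b] \<and> (\<forall>a\<in>set as. \<bar>b\<bar> < a)" for "is" as bs bs' b
  proof -
    have as: "sorted_wrt (>) as" "\<forall>a\<in>set as. 2 \<le> a" using that(2) by (auto simp: chain_shape_def)
    show ?thesis
    proof (cases "bs = []")
      case True
      have "sorted_wrt (>) (butlast as)" using as(1) by (simp add: butlast_conv_take sorted_wrt_take)
      moreover have "as ! (length as - 2) > \<bar>last as\<bar> \<and> as ! (length as - 2) > 1" if "length as \<ge> 2"
      proof -
        have "as ! (length as - 1) < as ! (length as - 2)"
          using sorted_wrt_nth_less[OF as(1), of "length as - 2" "length as - 1"] that by simp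
        moreover have "last as = as ! (length as - 1)" using that by (intro last_conv_nth) auto
        moreover have "2 \<le> last as" using as(2) that by (metis last_in_set list.size(3) not_numeral_le_zero)
        ultimately show ?thesis by simp
      qed
      ultimately show ?thesis using True that(1) by simp
    next
      case False
      then have b: "bs = [b]" "\<forall>a\<in>set as. \<bar>b\<bar> < a" using that by auto
      have "is ! (length is - 2) = last as" if "as \<noteq> []"
        using that \<open>is = as @ bs\<close> b by (simp add: nth_append last_conv_nth numeral_2_eq_2)
      moreover have "1 < last as \<and> \<bar>b\<bar> < last as" if "as \<noteq> []"
        using as(2)[rule_format, of "last as"] b(2)[rule_format, of "last as"] that by simp
      ultimately show ?thesis using \<open>is = as @ bs\<close> b(1) as(1) by (cases "as = []") auto
    qed
  qed
  obtain as bs where ab: "xs @ ms = as @ bs" "chain_shape as bs" using follows_chain_shape[OF f] by blast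
  have as2: "\<forall>a\<in>set as. 2 \<le> a" using ab(2) by (simp add: chain_shape_def)
  have intro: "concat (map (bracket_t n) is) @ concat (map (bracket_t n) js) @ v \<in> NF_second n"
    if "length is + length js \<ge> 2 \<and>
        v \<in> NF_D n \<and>
        (js \<noteq> [] \<longrightarrow>
           (\<exists>a::nat. (\<forall>s\<in>{1..length js}. js ! (s - 1) = (- 1) ^ (a + s)) \<and>
              (\<exists>rs. sorted_wrt (>) rs \<and> set rs \<subseteq> {1..n - 1} \<and>
                 v = word_S (map (\<lambda>q. (- 1) ^ (a + length js + q)) [1..<Suc (length rs)]) rs))) \<and>
        (is \<noteq> [] \<longrightarrow>
           set is \<subseteq> {- int (n - 1)..int n} \<and>
           sorted_wrt (>) (butlast is) \<and> \<bar>last is\<bar> \<noteq> 1 \<and>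
           (length is \<ge> 2 \<longrightarrow> is ! (length is - 2) > \<bar>last is\<bar> \<and> is ! (length is - 2) > 1)) \<and>
        (is \<noteq> [] \<and> last is \<le> 0 \<longrightarrow> js = [] \<and> v = [] \<and> last is \<noteq> - int (n - 1)) \<and>
        (js = [] \<and> last is > 0 \<longrightarrow>
           (\<exists>ms ns. form_S (n - 1) ms ns \<and> v = word_S ms ns \<and>
                    (ms \<noteq> [] \<longrightarrow> \<bar>hd ms\<bar> < last is)))" for "is" js v
    using that unfolding NF_second_def by blast
  show ?thesis
  proof (cases "length xs \<le> length as")
    case True
    then obtain cs where cs: "as = xs @ cs" using ab(1)
      by (metis append_eq_append_conv_if append_take_drop_id)
    have ne: "xs \<noteq> []" using assms(1) by auto
    have sx: "chain_shape xs []" using ab(2) cs by (auto simp: chain_shape_def sorted_wrt_append)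
    have lx: "2 \<le> last xs" using as2 cs ne by simp
    have "\<bar>hd ms\<bar> < last xs" if "ms \<noteq> []"
      using f ne that lx by (auto simp: successively_append_iff follows_def)
    moreover have "form_S (n - 1) ms ns" using t fm form_S_iff by blast
    ultimately show ?thesis
      using intro[of xs "[]" ?v] assms(1) vD idx[of xs xs "[]" "[]"] sx r lx by auto
  next
    case False
    then obtain cs where cs: "xs = as @ cs" "bs = cs @ ms" "cs \<noteq> []" using ab(1)
      by (metis append_eq_append_conv2 append.right_neutral le_add1 length_append order_refl)
    consider (alt) "\<forall>b\<in>set bs. \<bar>b\<bar> = 1" "successively (\<noteq>) bs"
      | (neg) b where "bs = [b]" "b \<le> 0" "b \<noteq> - 1" "\<forall>a\<in>set as. - b < a"
      using ab(2) unfolding chain_shape_def by blast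
    then show ?thesis
    proof cases
      case neg
      then have c: "cs = [b]" "ms = []" using cs by (auto simp: append_eq_Cons_conv)
      then have "?v = []" by simp
      moreover have "\<forall>a\<in>set as. \<bar>b\<bar> < a" using neg by auto
      ultimately show ?thesis
        using intro[of xs "[]" ?v] assms(1) vD idx[of xs as "[b]" bs b] ab(2) r neg c cs(1) by auto
    next
      case alt
      obtain a where a: "\<forall>i<length bs. bs ! i = (- 1) ^ (a + Suc i)"
        using alternating_powers[OF alt] by blast
      have a1: "cs ! (s - 1) = (- 1) ^ (a + s)" if "s \<in> {1..length cs}" for s
      proof -
        obtain r where "s = Suc r" "r < length cs" using \<open>s \<in> {1..length cs}\<close> by (cases s) auto
        then show ?thesis using a[rule_format, of r] cs(2) by (simp add: nth_append)
      qed
      have len: "length ms = length ns" using t by (auto simp: tops_ok_def list_all2_lengthD)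
      have "ms = map (\<lambda>q. (- 1) ^ (a + length cs + q)) [1..<Suc (length ns)]"
      proof (rule nth_equalityI)
        fix i assume "i < length ms"
        then show "ms ! i = map (\<lambda>q. (- 1) ^ (a + length cs + q)) [1..<Suc (length ns)] ! i"
          using a[rule_format, of "length cs + i"] len cs(2) by (simp add: nth_append ac_simps del: upt_Suc)
      qed (simp add: len del: upt_Suc)
      moreover have "sorted_wrt (>) ns" "set ns \<subseteq> {1..n - 1}" using t by (auto simp: tops_ok_def)
      ultimately have js: "\<exists>a::nat. (\<forall>s\<in>{1..length cs}. cs ! (s - 1) = (- 1) ^ (a + s)) \<and>
              (\<exists>rs. sorted_wrt (>) rs \<and> set rs \<subseteq> {1..n - 1} \<and>
                 ?v = word_S (map (\<lambda>q. (- 1) ^ (a + length cs + q)) [1..<Suc (length rs)]) rs)"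
        using a1 by (intro exI[of _ a] conjI ballI exI[of _ ns]) auto
      have la: "2 \<le> last as" if "as \<noteq> []" using as2 that by simp
      have "concat (map (bracket_t n) as) @ concat (map (bracket_t n) cs) @ ?v \<in> NF_second n"
        by (rule intro) (use assms(1) cs vD js la idx[of as as "[]" bs] ab(2) r in auto)
      then show ?thesis using cs(1) by simp
    qed
  qed
qed

end

section \<open>Full commutativity of the normal forms\<close>

context small_coxeter
begin

definition okx :: "'g \<Rightarrow> 'g \<Rightarrow> 'g list \<Rightarrow> bool" where
  "okx e s u \<longleftrightarrow> (s \<in> set u \<longrightarrow> 2 \<le> length (nbs s u) \<or> s = e \<and> (\<exists>x. nbs s u = [x] \<and> m s x = 4))"

text \<open>A strengthening of full commutativity in which only e may enclose a single neighbour; it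
  rules out factors s x s x without looking at them.\<close>

fun fcx :: "'g \<Rightarrow> 'g list \<Rightarrow> bool" where
  "fcx e [] \<longleftrightarrow> True"
| "fcx e (s # u) \<longleftrightarrow> okx e s u \<and> fcx e u"

text \<open>What the rest of a word has to contribute when the letters in front of it already supply
  one neighbour of \<open>s\<close>.\<close>

definition ready :: "'g \<Rightarrow> 'g list \<Rightarrow> bool" where
  "ready s u \<longleftrightarrow> (s \<in> set u \<longrightarrow> nbs s u \<noteq> [])"

lemma fcx_appendD: "fcx e (a @ b) \<Longrightarrow> fcx e b"
  by (induction a) auto

text \<open>If \<open>e\<close> encloses a single x, then x differs from \<open>e\<close> and must
  itself enclose two neighbours at its next recurrence, so e x e cannot be extended to e x e
  x.\<close>

lemma fcx_fc: "fcx e u \<Longrightarrow> fc u"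
proof (induction u)
  case (Cons s u)
  have "ok s u"
    unfolding ok_def
  proof (intro impI)
    assume s: "s \<in> set u"
    consider "2 \<le> length (nbs s u)" | x where "s = e" "nbs s u = [x]" "m s x = 4"
      using Cons.prems s by (auto simp: okx_def)
    then show "2 \<le> length (nbs s u) \<or>
        (\<exists>x. nbs s u = [x] \<and> m s x = 4 \<and> \<not> (x \<in> set (after x u) \<and> nbs x (after x u) = [s]))"
    proof cases
      case 2
      have "x \<in> set (nbs s u)" using 2 by simp
      then have "x \<in> set u" by (auto simp: nbs_def dest: set_takeWhileD)
      then obtain P Q where PQ: "u = P @ x # Q" "x \<notin> set P" by (meson split_list_first)
      then have "after x u = Q" by (induction P arbitrary: u) auto
      moreover have "okx e x Q" using Cons.prems fcx_appendD[of e P "x # Q"] PQ by simp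
      moreover have "x \<noteq> e" using 2 m_one[of s x] by auto
      ultimately have "\<not> (x \<in> set (after x u) \<and> nbs x (after x u) = [s])"
        by (auto simp: okx_def)
      then show ?thesis using 2 by blast
    qed simp
  qed
  then show ?case using Cons by simp
qed simp

lemma distinct_fcx: "distinct u \<Longrightarrow> fcx e u"
  by (induction u) (auto simp: okx_def)

text \<open>In a good word single neighbours are enclosed only along edges labelled 4. By the
  hypothesis any end of such an edge other than \<open>e\<close> occurs once and encloses
  nothing.\<close>

lemma fc_fcx_no_four:
  assumes "fc u" "\<And>s x. s \<in> set u \<Longrightarrow> x \<in> set u \<Longrightarrow> m s x = 4 \<Longrightarrow> s = e \<or> count_list u s = 1"
  shows "fcx e u"
proof -
  have "fcx e v" if "fc v" "u = w @ v" for w v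
    using that
  proof (induction v arbitrary: w)
    case (Cons s v)
    have "okx e s v"
      unfolding okx_def
    proof
      assume s: "s \<in> set v"
      then have "2 \<le> length (nbs s v) \<or> (\<exists>x. nbs s v = [x] \<and> m s x = 4)"
        using Cons.prems by (auto simp: ok_def)
      moreover have "s = e" if x: "nbs s v = [x]" "m s x = 4" for x
      proof -
        have "x \<in> set (nbs s v)" using x by simp
        then have "x \<in> set v" by (auto simp: nbs_def dest: set_takeWhileD)
        moreover have "count_list v s \<noteq> 0" using s by (simp add: count_list_0_iff)
        then have "count_list u s \<noteq> 1" using Cons.prems(2) by simp
        ultimately show ?thesis using assms(2)[of s x] x Cons.prems(2) by auto
      qed
      ultimately show "2 \<le> length (nbs s v) \<or> s = e \<and> (\<exists>x. nbs s v = [x] \<and> m s x = 4)" by blast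
    qed
    then show ?case using Cons.IH[of "w @ [s]"] Cons.prems by simp
  qed simp
  then show ?thesis using assms(1) by simp
qed

lemma ready_Nil [simp]: "ready s []"
  by (simp add: ready_def)

lemma ready_notin: "s \<notin> set u \<Longrightarrow> ready s u"
  by (simp add: ready_def)

lemma okx_notin: "s \<notin> set u \<Longrightarrow> okx e s u"
  by (simp add: okx_def)

lemma okx_ready:
  assumes "ready s u" "filter (\<lambda>x. 3 \<le> m s x) P \<noteq> []" "s \<notin> set P"
  shows "okx e s (P @ u)"
proof -
  have "2 \<le> length (filter (\<lambda>x. 3 \<le> m s x) P @ nbs s u)" if "s \<in> set u"
    using assms(1,2) that
    by (cases "filter (\<lambda>x. 3 \<le> m s x) P"; cases "nbs s u") (auto simp: ready_def)
  then show ?thesis using assms(3) unfolding okx_def by (simp add: nbs_append nbs_notin)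
qed

lemma ready_filter:
  "filter (\<lambda>x. 3 \<le> m s x) P \<noteq> [] \<Longrightarrow> s \<notin> set P \<Longrightarrow> ready s (P @ u)"
  by (auto simp: ready_def nbs_append nbs_notin)

lemma ready_append: "s \<notin> set P \<Longrightarrow> ready s u \<Longrightarrow> ready s (P @ u)"
  by (auto simp: ready_def nbs_append)

end

lemma bracket_split:
  assumes "1 \<le> j" "j \<le> k" "\<bar>m\<bar> \<le> int j"
  shows "bracket m k = bracket m j @ map Sigma [Suc j..<Suc k]"
proof -
  have u: "map Sigma [a..<Suc k] = map Sigma [a..<Suc j] @ map Sigma [Suc j..<Suc k]" if "a \<le> Suc j" for a
    using upt_append[of a "Suc j" "Suc k"] that assms by (simp del: upt_Suc)
  show ?thesis
  proof (cases m rule: bracket_cases)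
    case (1 a)
    then show ?thesis using u[of a] assms by (simp add: bracket_pos del: upt_Suc)
  next
    case 2
    then show ?thesis using u[of 2] assms by (simp add: bracket_0 del: upt_Suc)
  next
    case 3
    then show ?thesis using u[of 2] assms by (simp add: bracket_m1 del: upt_Suc)
  next
    case (4 i)
    then show ?thesis using u[of 2] assms by (simp add: bracket_neg del: upt_Suc)
  qed
qed

context btilde
begin

lemma adj_next: "1 \<le> j \<Longrightarrow> j < n - 1 \<Longrightarrow> adj (Sigma (Suc j)) (Sigma j)"
  by (simp add: cox_B_simps)

lemma bracket_has_adj:
  assumes "1 \<le> j" "j < n - 1" "\<bar>m\<bar> \<le> int j"
  shows "filter (adj (Sigma (Suc j))) (bracket m j) \<noteq> []"
proof (cases "j = 1")
  case True
  then have "m = 1 \<or> m = 0 \<or> m = -1" using assms(3) by linarith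
  then show ?thesis using True assms
    by (auto simp: bracket_def cox_B_simps)
next
  case False
  then have "2 \<le> j" "m \<le> int j" using assms by auto
  then obtain X where "bracket m j = X @ [Sigma j]" using bracket_last by blast
  then show ?thesis using adj_next[OF assms(1,2)] by simp
qed

text \<open>Inside the run \<sigma>_j is followed by \<sigma>_(j+1), so the rest has to add one
  neighbour only. The top letter gets none from the run.\<close>

lemma fcx_ascending:
  assumes "1 \<le> a" "a \<le> Suc k" "k \<le> n - 1" "fcx e R" "okx e (Sigma k) R"
    "\<And>j. a \<le> j \<Longrightarrow> j < k \<Longrightarrow> ready (Sigma j) R"
  shows "fcx e (map Sigma [a..<Suc k] @ R)"
  using assms(1,2,6)
proof (induction "Suc k - a" arbitrary: a)
  case (Suc d)
  then have u: "[a..<Suc k] = a # [Suc a..<Suc k]" by (intro upt_conv_Cons) simp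
  have "fcx e (map Sigma [Suc a..<Suc k] @ R)"
    using Suc.hyps(1)[of "Suc a"] Suc.hyps(2) Suc.prems by auto
  moreover have "okx e (Sigma a) (map Sigma [Suc a..<Suc k] @ R)"
  proof (cases "a = k")
    case True
    then show ?thesis using assms(5) by simp
  next
    case False
    then have ak: "a < k" using Suc.hyps(2) by simp
    show ?thesis
      by (rule okx_ready)
        (use ak Suc.prems filter_adj_above[of a k] assms(3) in \<open>auto simp del: upt_Suc\<close>)
  qed
  ultimately show ?case using u by (simp del: upt_Suc)
qed (use assms in simp)

text \<open>A letter \<sigma>_i that recurs in the ascending run encloses \<sigma>_(i-1) twice, or
  both letters of \<open>X\<close> when i = 2. Letters above \<open>k\<close> are allowed only with
  \<open>R\<close> empty and then do not recur. The two orders of \<open>X\<close> serve brackets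
  and reversed brackets.\<close>

lemma fcx_descending:
  assumes "X = [Sigma 1, SigmaBar] \<or> X = [SigmaBar, Sigma 1]" "k \<le> n - 1" "l \<le> n - 1" "l \<le> k \<or> R = []"
    "fcx e (X @ map Sigma [2..<Suc k] @ R)"
  shows "fcx e (rev (map Sigma [2..<Suc l]) @ X @ map Sigma [2..<Suc k] @ R)"
  using assms(3,4)
proof (induction l)
  case (Suc l)
  show ?case
  proof (cases "l = 0")
    case True
    then show ?thesis using assms(5) by simp
  next
    case l: False
    let ?i = "Suc l"
    have eq: "rev (map Sigma [2..<Suc ?i]) = Sigma ?i # rev (map Sigma [2..<?i])" using l by simp
    have fcx: "fcx e (rev (map Sigma [2..<?i]) @ X @ map Sigma [2..<Suc k] @ R)"
      using Suc by auto
    have XX: "set X = {Sigma 1, SigmaBar}" using assms(1) by auto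
    have "okx e (Sigma ?i) (rev (map Sigma [2..<?i]) @ X @ map Sigma [2..<Suc k] @ R)"
    proof (cases "?i \<le> k")
      case True
      then have u: "map Sigma [2..<Suc k] = map Sigma [2..<?i] @ Sigma ?i # map Sigma [Suc ?i..<Suc k]"
        using upt_split[of 2 ?i "Suc k"] l by simp
      let ?P = "rev (map Sigma [2..<?i]) @ X @ map Sigma [2..<?i]"
      have f1: "filter (adj (Sigma ?i)) (map Sigma [2..<?i]) = (if 2 < ?i then [Sigma l] else [])"
        using filter_adj_ascending[of 2 ?i] Suc.prems l by simp
      have f2: "filter (adj (Sigma ?i)) X = (if ?i = 2 then X else [])"
        using assms(1) Suc.prems l by (auto simp: cox_B_simps)
      have "2 \<le> length (filter (adj (Sigma ?i)) ?P)"
      proof (cases "?i = 2")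
        case True
        have "2 \<le> length X" using assms(1) by auto
        then show ?thesis using True f2 by (simp only: filter_append length_append) simp
      next
        case False
        then have "filter (adj (Sigma ?i)) (map Sigma [2..<?i]) = [Sigma l]" using f1 l by simp
        then show ?thesis by (simp only: filter_append length_append rev_filter[symmetric]) simp
      qed
      moreover have "Sigma ?i \<notin> set X" using l by (simp add: XX)
      then have "Sigma ?i \<notin> set ?P" by (simp only: set_append set_rev set_map Un_iff image_iff) auto
      moreover have "nbs (Sigma ?i) (P @ Sigma ?i # Q) = filter (adj (Sigma ?i)) P"
        if "Sigma ?i \<notin> set P" for P Q
        using that by (simp add: nbs_append nbs_notin)
      ultimately have "2 \<le> length (nbs (Sigma ?i) (?P @ Sigma ?i # map Sigma [Suc ?i..<Suc k] @ R))"
        by metis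
      then show ?thesis unfolding u okx_def by (simp only: append_assoc append_Cons) blast
    next
      case False
      then have "R = []" using Suc.prems by auto
      moreover have "Sigma ?i \<notin> set X" using l by (simp add: XX)
      ultimately have "Sigma ?i \<notin> set (rev (map Sigma [2..<?i]) @ X @ map Sigma [2..<Suc k] @ R)"
        using False by (simp only: set_append set_rev set_map Un_iff image_iff) auto
      then show ?thesis by (rule okx_notin)
    qed
    then show ?thesis using fcx eq by (simp del: upt_Suc)
  qed
qed (use assms in simp)

text \<open>Only the top letter lacks a neighbour to its right in the bracket, so it carries the
  stronger requirement. For k = 1 the letters of the bracket commute, and all of them carry
  it.\<close>

lemma fcx_bracket:
  assumes k: "1 \<le> k" "k \<le> n - 1" and m: "- int k \<le> m" "m \<le> int k + 1" and R: "fcx e R"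
    and top: "\<And>s. s \<in> set (bracket m k) \<Longrightarrow> s = Sigma k \<or> k = 1 \<Longrightarrow> okx e s R"
    and low: "\<And>s. s \<in> set (bracket m k) \<Longrightarrow> s \<noteq> Sigma k \<Longrightarrow> k \<noteq> 1 \<Longrightarrow> ready s R"
  shows "fcx e (bracket m k @ R)"
proof -
  have bar: "fcx e (SigmaBar # map Sigma [2..<Suc k] @ R)"
    if sub: "insert SigmaBar (set (map Sigma [2..<Suc k])) \<subseteq> set (bracket m k)"
  proof (cases "k = 1")
    case True
    then show ?thesis using R top[of SigmaBar] sub by simp
  next
    case False
    have "ready (Sigma j) R" if "2 \<le> j" "j < k" for j
      by (rule low) (use that sub False in auto)
    moreover have "okx e (Sigma k) R" by (rule top) (use sub False k in auto)
    ultimately have "fcx e (map Sigma [2..<Suc k] @ R)"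
      by (intro fcx_ascending[OF _ _ k(2) R]) (use False k in auto)
    moreover have "okx e SigmaBar (map Sigma [2..<Suc k] @ R)"
      by (rule okx_ready) (use False k sub low[of SigmaBar] filter_adj_bar[of k] in \<open>auto simp del: upt_Suc\<close>)
    ultimately show ?thesis by simp
  qed
  have zero: "fcx e (Sigma 1 # SigmaBar # map Sigma [2..<Suc k] @ R)"
    if sub: "{Sigma 1, SigmaBar} \<union> set (map Sigma [2..<Suc k]) \<subseteq> set (bracket m k)"
  proof -
    have "okx e (Sigma 1) (SigmaBar # map Sigma [2..<Suc k] @ R)"
    proof (cases "k = 1")
      case True
      then show ?thesis using top[of "Sigma 1"] sub by (auto simp: okx_def cox_B_simps)
    next
      case False
      have "filter (adj (Sigma 1)) (map Sigma [2..<Suc k]) = [Sigma 2]"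
        using filter_adj_above[of 1 k] False k by (simp add: numeral_2_eq_2 del: upt_Suc)
      then have "okx e (Sigma 1) ((SigmaBar # map Sigma [2..<Suc k]) @ R)"
        by (intro okx_ready) (use False k sub low[of "Sigma 1"] in \<open>auto simp: cox_B_simps simp del: upt_Suc\<close>)
      then show ?thesis by simp
    qed
    then show ?thesis using bar sub by auto
  qed
  show ?thesis
  proof (cases m rule: bracket_cases)
    case (1 a)
    show ?thesis
    proof (cases "a = Suc k")
      case True
      then have "m = int k + 1" using 1 by simp
      then have "bracket m k = []" using bracket_empty[OF k(1)] by (simp only:)
      then show ?thesis using R by simp
    next
      case False
      then have B: "bracket m k = map Sigma [a..<Suc k]" "a \<le> k" using 1 m by (auto simp: bracket_pos)
      have "ready (Sigma j) R" if "a \<le> j" "j < k" for j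
        by (rule low) (use that B 1 in auto)
      moreover have "okx e (Sigma k) R" by (rule top) (use B in auto)
      ultimately have "fcx e (map Sigma [a..<Suc k] @ R)"
        by (intro fcx_ascending[OF 1(2) _ k(2) R]) (use B in auto)
      then show ?thesis using B by simp
    qed
  next
    case 2
    then show ?thesis using zero by (simp add: bracket_0 del: upt_Suc)
  next
    case 3
    then show ?thesis using bar by (simp add: bracket_m1 del: upt_Suc)
  next
    case (4 i)
    have B: "bracket m k = rev (map Sigma [2..<Suc i]) @ [Sigma 1, SigmaBar] @ map Sigma [2..<Suc k]"
      using 4 bracket_neg by simp
    have "fcx e (Sigma 1 # SigmaBar # map Sigma [2..<Suc k] @ R)"
      by (rule zero) (auto simp: B simp del: upt_Suc)
    then have "fcx e ([Sigma 1, SigmaBar] @ map Sigma [2..<Suc k] @ R)" by (simp del: upt_Suc)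
    then have "fcx e (rev (map Sigma [2..<Suc i]) @ [Sigma 1, SigmaBar] @ map Sigma [2..<Suc k] @ R)"
      by (intro fcx_descending) (use 4 m k in auto)
    then show ?thesis using B by simp
  qed
qed

lemma successively_ConsD: "successively P (x # xs) \<Longrightarrow> successively P xs"
  by (cases xs) auto

text \<open>When j exceeds |y|, the letter \<sigma>_j in the next bracket is preceded by
  \<sigma>_(j-1), or for j = 2 by \<sigma>_1 or \<open>SigmaBar\<close>. The relation
  \<open>follows\<close> makes j that large, except for the initial letter of an alternating
  bracket, which does not recur before \<sigma>_2 has appeared.\<close>

lemma ready_bracket:
  assumes xy: "follows x y" and s: "s \<in> set (bracket x k)" and k: "k \<le> n - 1"
    and k': "1 \<le> k'" "k' \<le> n - 1" "\<bar>y\<bar> \<le> int k'"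
    and R: "k' = n - 1 \<or> R \<in> lists (D_letters (k' - 1))"
  shows "ready s (bracket y k' @ R)"
proof -
  have high: "ready (Sigma j) (bracket y k' @ R)" if j: "\<bar>y\<bar> < int j" "2 \<le> j" "j \<le> n - 1" for j
  proof (cases "j \<le> k'")
    case True
    define i where "i = j - 1"
    have i: "j = Suc i" "1 \<le> i" "i < n - 1" "\<bar>y\<bar> \<le> int i" using j by (auto simp: i_def)
    have "bracket y k' = bracket y i @ map Sigma [j..<Suc k']"
      using bracket_split[of i k' y] i True by simp
    moreover have "set (bracket y i) \<subseteq> D_letters i" by (rule set_bracket) (use i in auto)
    then have "Sigma j \<notin> set (bracket y i)" using i(1) by (auto simp: D_letters_def split: if_splits)
    ultimately show ?thesis
      using ready_filter[of "Sigma j" "bracket y i"] bracket_has_adj[OF i(2-4)] i(1) by simp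
  next
    case False
    then have "R \<in> lists (D_letters (k' - 1))" using R j by auto
    moreover have "set (bracket y k') \<subseteq> D_letters k'" by (rule set_bracket) (use k' in auto)
    ultimately have "Sigma j \<notin> set (bracket y k' @ R)"
      using False by (auto simp: D_letters_def lists_eq_set split: if_splits)
    then show ?thesis by (rule ready_notin)
  qed
  \<comment> \<open>\<open>D_letters 0\<close> is empty, and k' = N is impossible because N is at
    least 2.\<close>
  have k1: "R = []" if "k' = 1"
    using R that n3 by (auto simp: D_letters_def)
  consider "2 \<le> x" "\<bar>y\<bar> < x" | "x = 1" "y = -1" | "x = -1" "y = 1"
    using xy by (auto simp: follows_def abs_if split: if_splits)
  then show ?thesis
  proof cases
    case 1
    then obtain j where "s = Sigma j" "x \<le> int j" "j \<le> k"
      using s by (auto simp: bracket_def)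
    then show ?thesis using high[of j] 1 k by auto
  next
    case 2
    then obtain j where j: "s = Sigma j" "1 \<le> j" "j \<le> k" using s by (auto simp: bracket_def)
    show ?thesis
    proof (cases "j = 1")
      case True
      show ?thesis
      proof (cases "k' = 1")
        case k1': True
        then have "bracket y k' @ R = [SigmaBar]" using k1 2 by (simp add: bracket_m1)
        then show ?thesis using j True ready_notin by simp
      next
        case False
        then have "bracket y k' = [SigmaBar, Sigma 2] @ map Sigma [3..<Suc k']"
          using 2 k' by (simp add: bracket_m1 upt_conv_Cons del: upt_Suc)
        then show ?thesis
          using j True n2 ready_filter[of "Sigma 1" "[SigmaBar, Sigma 2]"]
          by (simp add: cox_B_simps del: upt_Suc)
      qed
    next
      case False
      then show ?thesis using high[of j] j k 2 by auto
    qed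
  next
    case 3
    then consider "s = SigmaBar" | j where "s = Sigma j" "2 \<le> j" "j \<le> k" using s by (auto simp: bracket_def)
    then show ?thesis
    proof cases
      case 1
      show ?thesis
      proof (cases "k' = 1")
        case True
        then have "bracket y k' @ R = [Sigma 1]" using k1 3 by (simp add: bracket_def)
        then show ?thesis using 1 ready_notin by simp
      next
        case False
        then have "bracket y k' = [Sigma 1, Sigma 2] @ map Sigma [3..<Suc k']"
          using 3 k' bracket_pos[of 1 k'] by (simp add: upt_conv_Cons numeral_3_eq_3 numeral_2_eq_2 del: upt_Suc)
        then show ?thesis
          using 1 n2 ready_filter[of SigmaBar "[Sigma 1, Sigma 2]"]
          by (simp add: cox_B_simps del: upt_Suc)
      qed
    next
      case 2
      then show ?thesis using high[of j] k 3 by auto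
    qed
  qed
qed

lemma fcx_word_S:
  assumes "tops_ok ms ns k" "k \<le> n - 1" "successively follows ms"
  shows "fcx e (word_S ms ns)"
  using assms
proof (induction ms arbitrary: ns k)
  case (Cons a ms)
  obtain b ns' where ns: "ns = b # ns'" and b: "\<bar>a\<bar> \<le> int b" "1 \<le> b" "b \<le> k" "tops_ok ms ns' (b - 1)"
    using Cons.prems(1) by (auto simp: tops_ok_Cons)
  have l: "word_S ms ns' \<in> lists (D_letters (b - 1))" using word_S_lists[OF b(4)] .
  have f: "fcx e (word_S ms ns')"
    using Cons.IH[OF b(4)] Cons.prems b successively_ConsD[of follows a ms] by simp
  have "fcx e (bracket a b @ word_S ms ns')"
  proof (rule fcx_bracket[OF b(2) _ _ _ f])
    fix s assume "s \<in> set (bracket a b)" "s = Sigma b \<or> b = 1"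
    then have "s \<notin> set (word_S ms ns')" using l by (auto simp: D_letters_def lists_eq_set split: if_splits)
    then show "okx e s (word_S ms ns')" by (rule okx_notin)
  next
    fix s assume s: "s \<in> set (bracket a b)" "s \<noteq> Sigma b" "b \<noteq> 1"
    show "ready s (word_S ms ns')"
    proof (cases ms)
      case Nil
      then show ?thesis by simp
    next
      case (Cons c ms')
      then obtain d ns'' where d: "ns' = d # ns''" "\<bar>c\<bar> \<le> int d" "1 \<le> d" "d \<le> b - 1" "tops_ok ms' ns'' (d - 1)"
        using b(4) by (auto simp: tops_ok_Cons)
      have "follows a c" using Cons.prems(3) Cons by simp
      then have "ready s (bracket c d @ word_S ms' ns'')"
        by (rule ready_bracket[OF _ s(1)]) (use d b Cons.prems word_S_lists in auto)
      then show ?thesis using Cons d by simp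
    qed
  qed (use b Cons.prems in auto)
  then show ?case using ns by simp
qed simp

lemma follows_le:
  assumes "follows x y" "x \<le> int n" shows "y \<le> int (n - 1)"
  using assms n3 by (auto simp: follows_def)

lemma ready_blocks:
  assumes "successively follows (x # xs @ ms)" "set (x # xs) \<subseteq> {- int (n - 1)..int n}" "tops_ok ms ns (n - 1)"
    "s \<in> set (bracket x (n - 1))"
  shows "ready s (concat (map (bracket_t n) xs) @ word_S ms ns)"
proof (cases xs)
  case (Cons y ys)
  have xy: "follows x y" using assms(1) Cons by simp
  then have "y \<le> int (n - 1)" using follows_le assms(2) by auto
  then have "\<bar>y\<bar> \<le> int (n - 1)" using assms(2) Cons by auto
  then have "ready s (bracket y (n - 1) @ Tgen n # concat (map (bracket_t n) ys) @ word_S ms ns)"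
    by (intro ready_bracket[OF xy assms(4)]) (use n3 in auto)
  then show ?thesis using Cons by (simp add: bracket_t_def[of n y])
next
  case Nil
  show ?thesis
  proof (cases ms)
    case ms: Nil
    then show ?thesis using Nil by simp
  next
    case (Cons c ms')
    then obtain d ns' where d: "ns = d # ns'" "\<bar>c\<bar> \<le> int d" "1 \<le> d" "d \<le> n - 1" "tops_ok ms' ns' (d - 1)"
      using assms(3) by (auto simp: tops_ok_Cons)
    have "follows x c" using assms(1) Cons Nil by simp
    then have "ready s (bracket c d @ word_S ms' ns')"
      by (rule ready_bracket[OF _ assms(4)]) (use d word_S_lists in auto)
    then show ?thesis using Cons d Nil by simp
  qed
qed

lemma t_adj_iff: "s \<in> gens_B n \<Longrightarrow> adj (Tgen n) s \<longleftrightarrow> s = Sigma (n - 1)"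
  by (auto simp: gens_B_def gens_D_def cox_B_simps split: if_splits)

text \<open>The letter \<sigma>_N of a block has t_n behind it and, if it recurs, finds another
  neighbour in the next block or in the tail. Consecutive t_n may enclose a single \<sigma>_N; this
  is the exception granted to t_n.\<close>

lemma fcx_second_blocks:
  assumes "successively follows (xs @ ms)" "set xs \<subseteq> {- int (n - 1)..int n}" "tops_ok ms ns (n - 1)"
  shows "fcx (Tgen n) (concat (map (bracket_t n) xs) @ word_S ms ns)"
  using assms
proof (induction xs)
  case Nil
  then show ?case using fcx_word_S by simp
next
  case (Cons x xs)
  let ?W = "concat (map (bracket_t n) xs) @ word_S ms ns"
  have fW: "fcx (Tgen n) ?W"
    using Cons.IH Cons.prems successively_ConsD[of follows x "xs @ ms"] by simp
  have rdy: "ready s ?W" if "s \<in> set (bracket x (n - 1))" for s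
    by (rule ready_blocks[OF _ Cons.prems(2,3) that]) (use Cons.prems(1) in simp)
  have "okx (Tgen n) (Tgen n) ?W"
  proof (cases xs)
    case Nil
    have "Tgen n \<notin> set (word_S ms ns)" using word_S_lists[OF Cons.prems(3)] by (auto simp: lists_eq_set)
    then show ?thesis using Nil okx_notin by simp
  next
    case xs: (Cons y ys)
    then have "follows x y" using Cons.prems(1) by simp
    then have y: "y \<le> int (n - 1)" "- int (n - 1) \<le> y" using follows_le Cons.prems(2) xs by auto
    then obtain X where X: "bracket y (n - 1) = X @ [Sigma (n - 1)]" using bracket_last[OF n2] by blast
    have t: "Tgen n \<notin> set (bracket y (n - 1))" using t_notin_bracket y by simp
    have lists: "bracket y (n - 1) \<in> lists (gens_B n)"
      using D_lists_gens[OF _ bracket_lists[of "n - 1" y]] y n2 by simp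
    define F where "F = filter (adj (Tgen n)) (bracket y (n - 1))"
    have "nbs (Tgen n) ?W = F"
      using t xs by (simp add: bracket_t_def[of n y] nbs_append nbs_notin F_def)
    moreover have "F \<noteq> []" unfolding F_def X using n3 by (simp add: cox_B_simps)
    moreover have "\<forall>x\<in>set F. x = Sigma (n - 1)" using lists t_adj_iff by (auto simp: F_def lists_eq_set)
    moreover have "cox_B n (Tgen n) (Sigma (n - 1)) = 4" by (simp add: cox_B_simps)
    ultimately show ?thesis
      unfolding okx_def by (cases F; cases "tl F") auto
  qed
  then have ft: "fcx (Tgen n) (Tgen n # ?W)" using fW by simp
  have xr: "- int (n - 1) \<le> x" "x \<le> int (n - 1) + 1" using Cons.prems(2) n3 by auto
  have n1: "1 \<le> n - 1" using n3 by simp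
  have "fcx (Tgen n) (bracket x (n - 1) @ Tgen n # ?W)"
  proof (rule fcx_bracket[OF n1 le_refl xr ft])
    fix s assume s: "s \<in> set (bracket x (n - 1))" "s = Sigma (n - 1) \<or> n - 1 = 1"
    then have "s = Sigma (n - 1)" using n3 by auto
    then have "okx (Tgen n) s ([Tgen n] @ ?W)"
      by (intro okx_ready rdy[OF s(1)]) (auto simp: cox_B_simps)
    then show "okx (Tgen n) s (Tgen n # ?W)" by simp
  next
    fix s assume s: "s \<in> set (bracket x (n - 1))"
    then have "s \<noteq> Tgen n" using t_notin_bracket[of x] xr n3 by auto
    then have "ready s ([Tgen n] @ ?W)" by (intro ready_append rdy[OF s]) auto
    then show "ready s (Tgen n # ?W)" by simp
  qed
  then show ?case by (simp add: bracket_t_def[of n x])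
qed

text \<open>What \<open>fcx_bracket\<close> and t_n ask of the part behind a block, collected into
  an invariant that survives a further block \<langle>-N, N] t_n. The exceptional letter is
  \<sigma>_N, which encloses only t_n in \<sigma>_N t_n \<sigma>_N.\<close>

definition first_tail :: "gen list \<Rightarrow> bool" where
  "first_tail R \<longleftrightarrow> fcx (Sigma (n - 1)) R \<and>
     (\<forall>s\<in>D_letters (n - 1). s \<noteq> Sigma (n - 1) \<longrightarrow> ready s R) \<and>
     okx (Sigma (n - 1)) (Sigma (n - 1)) (Tgen n # R) \<and> okx (Sigma (n - 1)) (Tgen n) R"

lemma fcx_first_block:
  assumes R: "first_tail R" and i: "- int (n - 1) \<le> i" "i \<le> int n"
  shows "fcx (Sigma (n - 1)) (bracket_t n i @ R)"
proof -
  have n1: "1 \<le> n - 1" and i': "i \<le> int (n - 1) + 1" using n3 i by auto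
  have "fcx (Sigma (n - 1)) (bracket i (n - 1) @ Tgen n # R)"
  proof (rule fcx_bracket[OF n1 le_refl i(1) i'])
    show "fcx (Sigma (n - 1)) (Tgen n # R)" using R by (simp add: first_tail_def)
  next
    fix s assume "s = Sigma (n - 1) \<or> n - 1 = 1"
    then have "s = Sigma (n - 1)" using n3 by auto
    then show "okx (Sigma (n - 1)) s (Tgen n # R)" using R by (simp add: first_tail_def)
  next
    fix s assume s: "s \<in> set (bracket i (n - 1))" "s \<noteq> Sigma (n - 1)"
    then have "s \<in> D_letters (n - 1)" "s \<noteq> Tgen n"
      using set_bracket[OF n1 i(1) i'] by auto
    then have "ready s ([Tgen n] @ R)"
      using R s by (intro ready_append) (auto simp: first_tail_def)
    then show "ready s (Tgen n # R)" by simp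
  qed
  then show ?thesis by (simp add: bracket_t_def)
qed

lemma okx_first:
  assumes "R = [] \<or> R = Sigma (n - 1) # R'"
  shows "okx (Sigma (n - 1)) (Sigma (n - 1)) (Tgen n # R)"
  using assms by (auto simp: okx_def cox_B_simps)

text \<open>The run meets \<sigma>_(j+1) before \<sigma>_j, and \<sigma>_2 before any
  \<open>SigmaBar\<close>, whatever comes behind it.\<close>

lemma ready_descending:
  assumes "s \<in> D_letters (n - 1)" "s \<noteq> Sigma (n - 1)"
  shows "ready s (rev (map Sigma [2..<Suc (n - 1)]) @ X)"
proof -
  consider "s = SigmaBar" | j where "s = Sigma j" "1 \<le> j" "j < n - 1"
    using assms by (auto simp: D_letters_def split: if_splits) (metis le_neq_implies_less)
  then show ?thesis
  proof cases
    case 1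
    then show ?thesis
      by (intro ready_filter) (use filter_adj_bar_rev[OF n2] in \<open>auto simp del: upt_Suc\<close>)
  next
    case 2
    have a: "2 \<le> Suc j" "Suc j \<le> Suc (n - 1)" using 2 by auto
    have "map Sigma [2..<Suc (n - 1)] = map Sigma [2..<Suc j] @ map Sigma [Suc j..<Suc (n - 1)]"
      unfolding upt_append[OF a] by simp
    then have "rev (map Sigma [2..<Suc (n - 1)]) @ X =
        rev (map Sigma [Suc j..<Suc (n - 1)]) @ rev (map Sigma [2..<Suc j]) @ X" by simp
    moreover have "ready s (rev (map Sigma [Suc j..<Suc (n - 1)]) @ rev (map Sigma [2..<Suc j]) @ X)"
      by (rule ready_filter) (use filter_adj_above_rev[of j "n - 1"] 2 in \<open>auto simp del: upt_Suc\<close>)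
    ultimately show ?thesis by simp
  qed
qed

lemma first_tail_bracket:
  assumes f: "- int (n - 1) \<le> f" "f \<le> int n"
  shows "first_tail (rev (bracket f (n - 1)))"
proof -
  let ?N = "n - 1"
  let ?R = "rev (bracket f ?N)"
  have Rset: "set ?R \<subseteq> D_letters ?N" using set_bracket[of ?N f] f n3 by auto
  then have "okx (Sigma ?N) (Tgen n) ?R" by (intro okx_notin) auto
  moreover have "\<exists>R'. ?R = [] \<or> ?R = Sigma ?N # R'"
  proof (cases "f = int n")
    case True
    then have "?R = []" using bracket_empty[of ?N] n3 by simp
    then show ?thesis by blast
  next
    case False
    then have "f \<le> int ?N" using f by linarith
    then obtain X where "bracket f ?N = X @ [Sigma ?N]" using bracket_last[OF n2] by blast
    then show ?thesis by simp
  qed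
  then have "okx (Sigma ?N) (Sigma ?N) (Tgen n # ?R)" using okx_first by blast
  moreover have "ready s ?R" if s: "s \<in> D_letters ?N" "s \<noteq> Sigma ?N" for s
  proof (cases f rule: bracket_cases)
    case (1 a)
    show ?thesis
    proof (cases "s \<in> set ?R")
      case True
      then obtain j where j: "s = Sigma j" "a \<le> j" "j < ?N"
        using s 1 by (auto simp: bracket_pos simp del: upt_Suc) (metis le_neq_implies_less less_Suc_eq_le)
      then have a: "a \<le> Suc j" "Suc j \<le> Suc ?N" by auto
      have "bracket f ?N = map Sigma [a..<Suc j] @ map Sigma [Suc j..<Suc ?N]"
        using upt_append[OF a] 1 by (simp add: bracket_pos del: upt_Suc)
      then have "?R = rev (map Sigma [Suc j..<Suc ?N]) @ rev (map Sigma [a..<Suc j])" by simp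
      moreover have "ready s (rev (map Sigma [Suc j..<Suc ?N]) @ rev (map Sigma [a..<Suc j]))"
        by (rule ready_filter) (use filter_adj_above_rev[of j ?N] j 1 in \<open>auto simp del: upt_Suc\<close>)
      ultimately show ?thesis by simp
    next
      case False
      then show ?thesis by (rule ready_notin)
    qed
  next
    case 2
    then show ?thesis using ready_descending[OF s, of "[SigmaBar, Sigma 1]"]
      by (simp add: bracket_0 del: upt_Suc)
  next
    case 3
    then show ?thesis using ready_descending[OF s, of "[SigmaBar]"]
      by (simp add: bracket_m1 del: upt_Suc)
  next
    case (4 i)
    then show ?thesis using ready_descending[OF s, of "[SigmaBar, Sigma 1] @ map Sigma [2..<Suc i]"]
      by (simp add: bracket_neg del: upt_Suc)
  qed
  moreover have "fcx (Sigma ?N) ?R"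
  proof (cases f rule: bracket_cases)
    case (1 a)
    then show ?thesis by (intro distinct_fcx) (simp add: bracket_pos distinct_map inj_on_def del: upt_Suc)
  next
    case 2
    then show ?thesis by (intro distinct_fcx) (auto simp: bracket_0 distinct_map inj_on_def simp del: upt_Suc)
  next
    case 3
    then show ?thesis by (intro distinct_fcx) (auto simp: bracket_m1 distinct_map inj_on_def simp del: upt_Suc)
  next
    case (4 i)
    have "fcx (Sigma ?N) ([SigmaBar, Sigma 1] @ map Sigma [2..<Suc i] @ [])"
      by (intro distinct_fcx) (auto simp: distinct_map inj_on_def simp del: upt_Suc)
    then have "fcx (Sigma ?N) (rev (map Sigma [2..<Suc ?N]) @ [SigmaBar, Sigma 1] @ map Sigma [2..<Suc i] @ [])"
      by (intro fcx_descending) (use 4 f in auto)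
    then show ?thesis using 4 by (simp add: bracket_neg del: upt_Suc)
  qed
  ultimately show ?thesis by (auto simp: first_tail_def)
qed

lemma first_tail_step:
  assumes R: "first_tail R"
  shows "first_tail (bracket_t n (- int (n - 1)) @ R)"
proof -
  let ?N = "n - 1"
  let ?b = "bracket (- int ?N) ?N"
  have b: "?b = rev (map Sigma [2..<Suc ?N]) @ [Sigma 1, SigmaBar] @ map Sigma [2..<Suc ?N]"
    using bracket_neg[OF n2, of ?N] by simp
  have fcx: "fcx (Sigma ?N) (bracket_t n (- int ?N) @ R)" by (rule fcx_first_block[OF R]) auto
  obtain X where X: "?b = Sigma ?N # X" using bracket_extreme[OF n2, of "- int ?N"] by auto
  have r2: "\<forall>s\<in>D_letters ?N. s \<noteq> Sigma ?N \<longrightarrow> ready s (bracket_t n (- int ?N) @ R)"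
    unfolding bracket_t_def b append_assoc by (intro ballI impI ready_descending)
  have r3: "okx (Sigma ?N) (Sigma ?N) (Tgen n # bracket_t n (- int ?N) @ R)"
    using okx_first[of _ "X @ Tgen n # R"] X by (simp add: bracket_t_def)
  have t: "Tgen n \<notin> set ?b" using t_notin_bracket[of "- int ?N"] by simp
  \<comment> \<open>This exposes \<sigma>_N at both ends of the bracket, the two neighbours of
    t_n.\<close>
  have "[2..<Suc ?N] = [2..<?N] @ [?N]" by (rule upt_Suc_append[OF n2])
  then have "2 \<le> length (filter (adj (Tgen n)) ?b)"
    unfolding b by (simp add: cox_B_simps del: upt_Suc)
  then have "2 \<le> length (nbs (Tgen n) (bracket_t n (- int ?N) @ R))"
    using t by (simp add: bracket_t_def nbs_append nbs_notin)
  then have "okx (Sigma ?N) (Tgen n) (bracket_t n (- int ?N) @ R)" by (simp add: okx_def)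
  then show ?thesis using fcx r2 r3 unfolding first_tail_def by blast
qed

lemma fcx_NF_first:
  assumes "u \<in> NF_first n"
  shows "fcx (Sigma (n - 1)) u"
proof -
  obtain i k f where u: "u = bracket_t n i @ concat (replicate k (bracket_t n (- int (n - 1)))) @
      rev (bracket f (n - 1))" and i: "- int (n - 1) \<le> i" "i \<le> int n"
    and f: "- int (n - 1) \<le> f" "f \<le> int n"
    using assms unfolding NF_first_def by blast
  have "first_tail (concat (replicate k (bracket_t n (- int (n - 1)))) @ rev (bracket f (n - 1)))"
    by (induction k) (use first_tail_bracket[OF f] first_tail_step in auto)
  then show ?thesis using fcx_first_block i u by blast
qed

lemma fcx_NF_second:
  assumes "u \<in> NF_second n"
  shows "fcx (Tgen n) u"
proof -
  obtain xs ms ns where "u = concat (map (bracket_t n) xs) @ word_S ms ns" "second_blocks xs ms ns"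
    using NF_second_blocks[OF assms] .
  then show ?thesis using fcx_second_blocks by (auto simp: second_blocks_def)
qed

end

section \<open>The normal form of a fully commutative element\<close>

context btilde
begin

lemma range_block: "set xs \<subseteq> {- int (n - 1)..int n} \<Longrightarrow> concat (map (bracket_t n) xs) \<in> lists (gens_B n)"
  using bracket_t_lists by (induction xs) auto

lemma count_t_D: "v \<in> lists (D_letters k) \<Longrightarrow> count_list v (Tgen j) = 0"
  by (auto simp: count_list_0_iff lists_eq_set)

lemma count_blocks:
  assumes "set xs \<subseteq> {- int (n - 1)..int n}" "v \<in> lists (D_letters (n - 1))"
  shows "count_list (concat (map (bracket_t n) xs) @ v) (Tgen n) = length xs"
  using assms(1)
proof (induction xs)
  case Nil
  then show ?case using count_t_D[OF assms(2)] by simp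
next
  case (Cons x xs)
  then have "count_list (bracket x (n - 1)) (Tgen n) = 0"
    using t_notin_bracket[of x] by (simp add: count_list_0_iff)
  then show ?case using Cons by (simp add: bracket_t_def[of n x])
qed

lemma NF_first_blocks:
  assumes "u \<in> NF_first n"
  obtains i k f where "u = concat (map (bracket_t n) (i # replicate k (- int (n - 1)))) @ rev (bracket f (n - 1))"
    "1 \<le> k" "- int (n - 1) \<le> i" "i \<le> int n" "- int (n - 1) \<le> f" "f \<le> int n"
  using assms unfolding NF_first_def by (auto simp: map_replicate)

lemma blocks_NF_first:
  assumes "1 \<le> k" "- int (n - 1) \<le> i" "i \<le> int n" "- int (n - 1) \<le> f" "f \<le> int n"
  shows "concat (map (bracket_t n) (i # replicate k (- int (n - 1)))) @ rev (bracket f (n - 1)) \<in> NF_first n"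
proof -
  have "concat (map (bracket_t n) (i # replicate k (- int (n - 1)))) @ rev (bracket f (n - 1)) =
    bracket_t n i @ concat (replicate k (bracket_t n (- int (n - 1)))) @ rev (bracket f (n - 1))"
    by (simp add: map_replicate)
  then show ?thesis using assms unfolding NF_first_def by blast
qed

lemma rev_bracket_lists:
  assumes "- int (n - 1) \<le> f" "f \<le> int n"
  shows "rev (bracket f (n - 1)) \<in> lists (D_letters (n - 1))"
  using set_bracket[of "n - 1" f] assms n3 by (auto simp: lists_eq_set)

text \<open>The number of blocks is the number of t_n. From two blocks on, the presence of the index
  -N behind the first block decides the type.\<close>

lemma NF_exists:
  assumes "u \<in> lists (gens_B n)" "fc u"
  obtains v where "u \<sim> v" "count_list u (Tgen n) = 0 \<and> v \<in> NF_D n \<or>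
    count_list u (Tgen n) = 1 \<and> v \<in> NF_one n \<or>
    2 \<le> count_list u (Tgen n) \<and> v \<in> NF_first n \<union> NF_second n"
proof -
  let ?N = "n - 1"
  obtain xs ms ns where xs: "set xs \<subseteq> {- int ?N..int n}" and t: "tops_ok ms ns ?N"
    and uw: "u \<sim> concat (map (bracket_t n) xs) @ word_S ms ns"
    using block_decomposition[OF assms] .
  let ?w = "concat (map (bracket_t n) xs) @ word_S ms ns"
  have fw: "fc ?w" using ceq_fc[OF uw] assms(2) by simp
  have cnt: "count_list u (Tgen n) = length xs"
    using ceq_count[OF uw] count_blocks[OF xs word_S_lists[OF t]] by simp
  have fm: "successively follows ms" by (rule word_S_follows[OF fw t le_refl])
  have vD: "word_S ms ns \<in> NF_D n" using t fm NF_D_iff by blast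
  consider "xs = []" | x where "xs = [x]" | "2 \<le> length xs"
    by (cases xs; cases "tl xs") auto
  then show thesis
  proof cases
    case 1
    then show ?thesis using that[OF uw] cnt vD by simp
  next
    case (2 x)
    then have "- int ?N \<le> x" "x \<le> int n" using xs by auto
    then have "?w \<in> NF_one n" using 2 vD unfolding NF_one_def by auto
    then show ?thesis using that[OF uw] cnt 2 by simp
  next
    case 3
    then obtain x xs' where x: "xs = x # xs'" "xs' \<noteq> []" by (cases xs; cases "tl xs") auto
    show ?thesis
    proof (cases "- int ?N \<in> set xs'")
      case True
      have "xs' = replicate (length xs') (- int ?N)"
        by (rule blocks_first_type[of "[]" x xs' "word_S ms ns"]) (use fw xs x True in auto)
      then obtain k where k: "xs' = replicate (Suc k) (- int ?N)" using x by (cases xs') auto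
      define A where "A = concat (map (bracket_t n) (x # replicate k (- int ?N)))"
      \<comment> \<open>One block is split off at the end, so that \<langle>-N, N] t_n stands
        directly before the tail.\<close>
      have "replicate (Suc k) (- int ?N) = replicate k (- int ?N) @ [- int ?N]"
        by (simp add: replicate_append_same)
      then have w: "concat (map (bracket_t n) xs) = A @ bracket (- int ?N) ?N @ [Tgen n]"
        unfolding x k A_def by (simp add: bracket_t_def)
      have fw': "fc (A @ bracket (- int ?N) ?N @ [Tgen n] @
          rev (map Sigma [Suc ?N..<Suc ?N]) @ word_S ms ns)"
        using fw by (simp add: w)
      from first_type_tail[OF fw' t le_refl] obtain g where g: "- int ?N \<le> g" "g \<le> int n"
          "word_S ms ns \<sim> rev (bracket g ?N)" by auto
      have "?w \<sim> concat (map (bracket_t n) xs) @ rev (bracket g ?N)" by (rule ceq_left[OF g(3)])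
      then have "u \<sim> concat (map (bracket_t n) xs) @ rev (bracket g ?N)" using ceq_trans[OF uw] by blast
      moreover have "concat (map (bracket_t n) xs) @ rev (bracket g ?N) \<in> NF_first n"
        unfolding x k by (rule blocks_NF_first) (use g xs x in auto)
      ultimately show ?thesis using that 3 cnt by auto
    next
      case False
      have fx: "successively follows xs"
        by (rule blocks_second_type[of "[]" xs "word_S ms ns"]) (use fw xs x False in auto)
      \<comment> \<open>The first block has a successor under \<open>follows\<close>, and -N admits
        none.\<close>
      have xN: "x \<noteq> - int ?N"
        using fx x n3 by (cases xs') (auto simp: follows_def)
      have "successively follows (xs @ ms)"
      proof (cases ms)
        case Nil
        then show ?thesis using fx by simp
      next
        case (Cons m ms')
        \<comment> \<open>The comparison of the last block with the tail also needs the t_n of the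
          block before it.\<close>
        obtain ys z where yz: "xs = ys @ [z]" using x by (metis append_butlast_last_id list.distinct(1))
        then have "ys \<noteq> []" using 3 by auto
        then obtain ys' y where y: "ys = ys' @ [y]" by (metis append_butlast_last_id)
        have zs: "z \<in> set xs'" using yz y x by (cases ys') auto
        have "follows y z" using fx yz y by (simp add: successively_append_iff)
        moreover have "y \<le> int n" using yz y xs by auto
        ultimately have zN: "z \<le> int ?N" by (rule follows_le)
        have "- int ?N < z" using zs False xs x by (metis atLeastAtMost_iff insert_iff list.set(2)
              order_le_imp_less_or_eq subset_iff)
        moreover have "fc (concat (map (bracket_t n) ys') @ bracket_t n y @ bracket_t n z @ word_S (m # ms') ns)"
          using fw yz y Cons by simp
        ultimately have "follows z m" using last_block_follows zN t Cons by blast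
        then show ?thesis using fx fm yz Cons by (simp add: successively_append_iff)
      qed
      then have "second_blocks xs ms ns"
        using xs t False xN x by (auto simp: second_blocks_def)
      then show ?thesis using that[OF uw] blocks_NF_second 3 cnt by simp
    qed
  qed
qed

lemma NF_D_props: "u \<in> NF_D n \<Longrightarrow> u \<in> lists (gens_B n) \<and> count_list u (Tgen n) = 0"
  using NF_D_lists D_lists_gens count_t_D by blast

lemma NF_blocks:
  assumes "u \<in> NF_first n \<union> NF_second n"
  obtains xs v where "u = concat (map (bracket_t n) xs) @ v" "set xs \<subseteq> {- int (n - 1)..int n}"
    "v \<in> lists (D_letters (n - 1))" "2 \<le> length xs"
    "u \<in> NF_first n \<longrightarrow> - int (n - 1) \<in> set xs \<and>
       (\<exists>f. - int (n - 1) \<le> f \<and> f \<le> int n \<and> v = rev (bracket f (n - 1)))"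
    "u \<notin> NF_first n \<longrightarrow> - int (n - 1) \<notin> set xs \<and> v \<in> NF_D n"
proof (cases "u \<in> NF_first n")
  case True
  obtain i k f where *: "u = concat (map (bracket_t n) (i # replicate k (- int (n - 1)))) @ rev (bracket f (n - 1))"
    "1 \<le> k" "- int (n - 1) \<le> i" "i \<le> int n" "- int (n - 1) \<le> f" "f \<le> int n"
    using NF_first_blocks[OF True] .
  show ?thesis
    by (rule that[of "i # replicate k (- int (n - 1))" "rev (bracket f (n - 1))"])
      (use * rev_bracket_lists True in auto)
next
  case False
  then have "u \<in> NF_second n" using assms by simp
  then obtain xs ms ns where *: "u = concat (map (bracket_t n) xs) @ word_S ms ns" "2 \<le> length xs"
    "second_blocks xs ms ns" by (rule NF_second_blocks)
  have "word_S ms ns \<in> NF_D n"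
    using *(3) NF_D_iff by (auto simp: second_blocks_def successively_append_iff)
  then show ?thesis
    by (intro that[of xs "word_S ms ns"]) (use * NF_D_lists False in \<open>auto simp: second_blocks_def\<close>)
qed

lemma NF_props:
  assumes "u \<in> NF_first n \<union> NF_second n"
  shows "u \<in> lists (gens_B n) \<and> 2 \<le> count_list u (Tgen n) \<and> fc u"
proof -
  obtain xs v where *: "u = concat (map (bracket_t n) xs) @ v" "set xs \<subseteq> {- int (n - 1)..int n}"
    "v \<in> lists (D_letters (n - 1))" "2 \<le> length xs"
    using NF_blocks[OF assms] .
  have "u \<in> lists (gens_B n)" using * range_block[of xs] D_lists_gens[of "n - 1" v] by simp
  moreover have "2 \<le> count_list u (Tgen n)" using count_blocks[OF *(2,3)] * by simp
  moreover have "fc u" using assms fcx_NF_first fcx_NF_second fcx_fc by blast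
  ultimately show ?thesis by blast
qed

lemma NF_first_second_disjoint:
  assumes "u \<in> NF_first n" shows "u \<notin> NF_second n"
proof
  assume "u \<in> NF_second n"
  then obtain xs ms ns where s: "u = concat (map (bracket_t n) xs) @ word_S ms ns"
    "second_blocks xs ms ns" by (rule NF_second_blocks)
  obtain i k f where f: "u = concat (map (bracket_t n) (i # replicate k (- int (n - 1)))) @ rev (bracket f (n - 1))"
    "1 \<le> k" "- int (n - 1) \<le> i" "i \<le> int n" "- int (n - 1) \<le> f" "f \<le> int n"
    using NF_first_blocks[OF assms] .
  have "xs = i # replicate k (- int (n - 1))"
    using bracket_t_blocks_unique[of xs "word_S ms ns" "i # replicate k (- int (n - 1))" "rev (bracket f (n - 1))"]
      s f rev_bracket_lists word_S_lists by (auto simp: second_blocks_def)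
  then show False using s(2) f(2) by (auto simp: second_blocks_def)
qed

text \<open>Both words are good, so equality in the group is a commutation and the block indices
  agree. They reveal the type, and the tails are then compared in the group by the uniqueness of
  brackets or of products of brackets.\<close>

lemma NF_unique:
  assumes u: "u \<in> NF_first n \<union> NF_second n" and v: "v \<in> NF_first n \<union> NF_second n" and "u \<approx> v"
  shows "u = v"
proof -
  let ?N = "n - 1"
  have pu: "u \<in> lists (gens_B n)" "fc u" and pv: "v \<in> lists (gens_B n)" "fc v"
    using NF_props[OF u] NF_props[OF v] by auto
  have uv: "u \<sim> v" using cls_eq_cls_iff_ceq[OF pu(1) pv(1) pu(2) pv(2)] assms(3) cls_eq_iff[OF pu(1) pv(1)] by simp
  obtain xs a where a: "u = concat (map (bracket_t n) xs) @ a" "set xs \<subseteq> {- int ?N..int n}"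
    "a \<in> lists (D_letters ?N)" "2 \<le> length xs"
    and a1: "u \<in> NF_first n \<longrightarrow> - int ?N \<in> set xs \<and>
       (\<exists>f. - int ?N \<le> f \<and> f \<le> int n \<and> a = rev (bracket f ?N))"
    and a2: "u \<notin> NF_first n \<longrightarrow> - int ?N \<notin> set xs \<and> a \<in> NF_D n"
    using NF_blocks[OF u] .
  obtain ys b where b: "v = concat (map (bracket_t n) ys) @ b" "set ys \<subseteq> {- int ?N..int n}"
    "b \<in> lists (D_letters ?N)" "2 \<le> length ys"
    and b1: "v \<in> NF_first n \<longrightarrow> - int ?N \<in> set ys \<and>
       (\<exists>f. - int ?N \<le> f \<and> f \<le> int n \<and> b = rev (bracket f ?N))"
    and b2: "v \<notin> NF_first n \<longrightarrow> - int ?N \<notin> set ys \<and> b \<in> NF_D n"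
    using NF_blocks[OF v] .
  have eq: "xs = ys" and ab: "a \<sim> b"
    using bracket_t_blocks_unique[of xs a ys b] uv a b by auto
  have ab': "a \<approx> b" using ceq_eqv[OF ab] D_lists_gens a(3) by blast
  have "a = b"
  proof (cases "u \<in> NF_first n")
    case True
    then have "v \<in> NF_first n" using a1 b2 eq by blast
    then obtain f g where f: "- int ?N \<le> f" "f \<le> int n" "a = rev (bracket f ?N)"
        and g: "- int ?N \<le> g" "g \<le> int n" "b = rev (bracket g ?N)"
      using a1 b1 True by blast
    have "bracket f ?N \<approx> bracket g ?N" using eqv_rev[OF ab'] f g by simp
    then have "f = g" using bracket_inject[of ?N f g] act_eqv f g n3 by auto
    then show ?thesis using f g by simp
  next
    case False
    then have "v \<notin> NF_first n" using a2 b1 eq by blast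
    then show ?thesis using NF_D_unique ab' a2 b2 False by blast
  qed
  then show ?thesis using a b eq by simp
qed

text \<open>\<open>NF_one\<close> imposes no condition between bracket and tail and so contains
  words that are not good. The action on the origin covers these as well.\<close>

lemma NF_one_unique:
  assumes "u \<in> NF_one n" "v \<in> NF_one n" "u \<approx> v"
  shows "u = v"
proof -
  obtain i a where a: "u = bracket_t n i @ a" "- int (n - 1) \<le> i" "i \<le> int n" "a \<in> NF_D n"
    using assms(1) unfolding NF_one_def by blast
  obtain j b where b: "v = bracket_t n j @ b" "- int (n - 1) \<le> j" "j \<le> int n" "b \<in> NF_D n"
    using assms(2) unfolding NF_one_def by blast
  have "i = j \<and> a \<approx> b"
    using bracket_t_cancel[OF a(3) b(3) NF_D_lists[OF a(4)] NF_D_lists[OF b(4)]] assms(3) a b by simp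
  then show ?thesis using NF_D_unique a b by blast
qed

section \<open>Elements of the group: full commutativity, lengths and the parabolic subgroup\<close>

lemma Wc_B_obtain:
  assumes "w \<in> Wc_B n"
  obtains u where "u \<in> lists (gens_B n)" "w = class_B n u" "fc u"
proof -
  have "w \<in> carrier (coxeter_group (cox_B n) (gens_B n))" "fully_commutative (cox_B n) w"
    using assms by (auto simp: Wc_B_def W_B_def)
  then show thesis using reduced_word_exists fully_commutative_fc that by metis
qed

lemma class_in_Wc_B:
  assumes "u \<in> lists (gens_B n)" "fc u"
  shows "class_B n u \<in> Wc_B n"
  unfolding Wc_B_def W_B_def carrier_coxeter_group
  using fc_fully_commutative[OF assms] assms(1) by blast

lemma affine_length_class:
  assumes "u \<in> lists (gens_B n)" "fc u"
  shows "affine_length n (class_B n u) = count_list u (Tgen n)"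
proof -
  have cnt: "count_list v (Tgen n) = count_list u (Tgen n)" if "u \<sim> v" for v
    using ceq_count[OF that, of "Tgen n"] by simp
  show ?thesis
    unfolding affine_length_def reduced_expr_cls_iff[OF assms]
  proof (rule the_equality)
    show "\<forall>v. u \<sim> v \<longrightarrow> count_list v (Tgen n) = count_list u (Tgen n)" using cnt by blast
    show "k = count_list u (Tgen n)" if "\<forall>v. u \<sim> v \<longrightarrow> count_list v (Tgen n) = k" for k
      using that by blast
  qed
qed

lemma cox_length_class:
  assumes "u \<in> lists (gens_B n)" "fc u"
  shows "cox_length (class_B n u) = length u"
  using fc_reduced[OF assms] by (simp add: reduced_word_def reduced_expr_def)

lemma W_D_obtain:
  assumes "w \<in> W_D n"
  shows "\<exists>v\<in>lists (gens_D n). w = class_B n v"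
  using assms unfolding W_D_def
proof (induction rule: generate.induct)
  case one
  show ?case by (intro bexI[of _ "[]"]) (simp_all add: W_B_def one_coxeter_group)
next
  case (incl h)
  then obtain s where "s \<in> gens_D n" "h = class_B n [s]" by blast
  then show ?case by (intro bexI[of _ "[s]"]) simp_all
next
  case (inv h)
  then obtain s where s: "s \<in> gens_D n" "h = class_B n [s]" by blast
  have sB: "[s] \<in> lists (gens_B n)" using s by (simp add: gens_B_def)
  have c: "class_B n [s] \<in> carrier (W_B n)"
    unfolding W_B_def carrier_coxeter_group using sB by blast
  have "class_B n [s] \<otimes>\<^bsub>W_B n\<^esub> class_B n [s] = \<one>\<^bsub>W_B n\<^esub>"
    unfolding W_B_def mult_cox_class[OF sB sB] one_coxeter_group
    by (subst cls_eq_iff) (use sB rev_cancel[OF sB] in auto)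
  then have "inv\<^bsub>W_B n\<^esub> h = class_B n [s]"
    using group.inv_equality[OF group_W_B _ c c] s(2) by simp
  then show ?case using s by (intro bexI[of _ "[s]"]) simp_all
next
  case (eng h1 h2)
  then obtain v1 v2 where v: "v1 \<in> lists (gens_D n)" "h1 = class_B n v1"
      "v2 \<in> lists (gens_D n)" "h2 = class_B n v2" by blast
  have "v1 \<in> lists (gens_B n)" "v2 \<in> lists (gens_B n)"
    using v lists_mono[of "gens_D n" "gens_B n"] by (auto simp: gens_B_def)
  then have "h1 \<otimes>\<^bsub>W_B n\<^esub> h2 = class_B n (v1 @ v2)"
    unfolding v(2,4) W_B_def by (rule mult_cox_class)
  then show ?case using v by (intro bexI[of _ "v1 @ v2"]) simp_all
qed

lemma class_in_W_D:
  assumes "v \<in> lists (gens_D n)"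
  shows "class_B n v \<in> W_D n"
  using assms
proof (induction v)
  case Nil
  then show ?case using generate.one[of "W_B n"] by (simp add: W_D_def W_B_def one_coxeter_group)
next
  case (Cons s v)
  have l: "[s] \<in> lists (gens_B n)" "v \<in> lists (gens_B n)"
    using Cons.hyps lists_mono[of "gens_D n" "gens_B n"] by (auto simp: gens_B_def)
  have "class_B n [s] \<in> W_D n"
    unfolding W_D_def by (rule generate.incl) (use Cons.hyps in blast)
  then have "class_B n [s] \<otimes>\<^bsub>W_B n\<^esub> class_B n v \<in> W_D n"
    using Cons.IH unfolding W_D_def by (rule generate.eng)
  then show ?case using mult_cox_class[OF l, of "cox_B n"] by (simp add: W_B_def)
qed

text \<open>An element of the subgroup has a reduced word without t_n. Since \<open>u\<close> is
  good, that word differs from it by commutations, which preserve the number of t_n.\<close>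

lemma class_in_Wc_D_iff:
  assumes "u \<in> lists (gens_B n)" "fc u"
  shows "class_B n u \<in> Wc_D n \<longleftrightarrow> count_list u (Tgen n) = 0"
proof
  assume "class_B n u \<in> Wc_D n"
  then have "class_B n u \<in> W_D n" by (simp add: Wc_D_def)
  from W_D_obtain[OF this] obtain v where v: "v \<in> lists (gens_D n)" "class_B n u = class_B n v"
    by blast
  have sub: "gens_D n \<subseteq> gens_B n" by (auto simp: gens_B_def)
  obtain v' where v': "v' \<in> lists (gens_D n)" "v \<approx> v'" "reduced_word (cox_B n) (gens_B n) v'"
    using reduced_in_parabolic[OF v(1) sub] by blast
  have "class_B n u = class_B n v'" using v(2) v'(2) cls_eq_iff eqvD by metis
  then have "u \<sim> v'" using v'(3) reduced_expr_cls_iff[OF assms] by (simp add: reduced_word_def)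
  then have "count_list u (Tgen n) = count_list v' (Tgen n)" by (rule ceq_count)
  also have "\<dots> = 0" using v'(1) by (auto simp: count_list_0_iff lists_eq_set gens_D_def)
  finally show "count_list u (Tgen n) = 0" .
next
  assume "count_list u (Tgen n) = 0"
  then have "u \<in> lists (gens_D n)"
    using assms(1) by (auto simp: count_list_0_iff lists_eq_set gens_B_def)
  then show "class_B n u \<in> Wc_D n"
    using class_in_W_D fc_fully_commutative[OF assms] by (simp add: Wc_D_def)
qed

lemma Wc_D_subset: "Wc_D n \<subseteq> Wc_B n"
proof
  fix w assume w: "w \<in> Wc_D n"
  then have "w \<in> W_D n" by (simp add: Wc_D_def)
  from W_D_obtain[OF this] obtain v where v: "v \<in> lists (gens_D n)" "w = class_B n v" by blast
  then have "v \<in> lists (gens_B n)" using lists_mono[of "gens_D n" "gens_B n"] by (auto simp: gens_B_def)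
  then show "w \<in> Wc_B n"
    using v w unfolding Wc_B_def Wc_D_def W_B_def carrier_coxeter_group by blast
qed

lemma fc_fcx_D:
  assumes "fc u" "u \<in> lists (gens_B n)" "count_list u (Tgen n) = 0"
  shows "fcx e u"
proof (rule fc_fcx_no_four[OF assms(1)])
  fix s x assume *: "s \<in> set u" "x \<in> set u" "cox_B n s x = 4"
  then have "s \<noteq> Tgen n" "x \<noteq> Tgen n" using assms(3) by (auto simp: count_list_0_iff)
  moreover have "s \<in> gens_B n" "x \<in> gens_B n" using * assms(2) by (auto simp: lists_eq_set)
  ultimately show "s = e \<or> count_list u s = 1"
    using *(3) by (auto simp: gens_B_def gens_D_def cox_B_simps split: if_splits)
qed

lemma fc_fcx_one:
  assumes "fc u" "u \<in> lists (gens_B n)" "count_list u (Tgen n) = 1"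
  shows "fcx (Sigma (n - 1)) u"
proof (rule fc_fcx_no_four[OF assms(1)])
  fix s x assume *: "s \<in> set u" "x \<in> set u" "cox_B n s x = 4"
  have "s \<in> gens_B n" "x \<in> gens_B n" using * assms(2) by (auto simp: lists_eq_set)
  then have "s = Sigma (n - 1) \<or> s = Tgen n"
    using *(3) by (auto simp: gens_B_def gens_D_def cox_B_simps split: if_splits)
  then show "s = Sigma (n - 1) \<or> count_list u s = 1" using assms(3) by auto
qed

text \<open>Resolves the definite description once and collects what is used of normal forms. Case
  \<open>first\<close> includes affine length 1. The cases differ in the exceptional letter:
  \<sigma>_(n-1) for \<open>first\<close>, t_n for \<open>second\<close>.\<close>

lemma normal_form_cases:
  assumes "w \<in> Wc_B n"
  defines "u \<equiv> normal_form n w"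
  obtains (D) "u \<in> lists (gens_B n)" "fc u" "w = class_B n u" "w \<in> Wc_D n" "w \<notin> Wc1 n" "w \<notin> Wc2 n"
      "count_list u (Tgen n) = 0"
    | (first) "u \<in> lists (gens_B n)" "fc u" "w = class_B n u" "w \<notin> Wc_D n" "w \<in> Wc1 n" "w \<notin> Wc2 n"
      "1 \<le> count_list u (Tgen n)" "fcx (Sigma (n - 1)) u" "w \<in> first_type n \<longleftrightarrow> u \<in> NF_first n"
    | (second) "u \<in> lists (gens_B n)" "fc u" "w = class_B n u" "w \<notin> Wc_D n" "w \<notin> Wc1 n" "w \<in> Wc2 n"
      "2 \<le> count_list u (Tgen n)" "fcx (Tgen n) u" "u \<in> NF_second n"
proof -
  obtain u0 where u0: "u0 \<in> lists (gens_B n)" "w = class_B n u0" "fc u0" using Wc_B_obtain[OF assms(1)] .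
  obtain v where uv: "u0 \<sim> v" and v: "count_list u0 (Tgen n) = 0 \<and> v \<in> NF_D n \<or>
    count_list u0 (Tgen n) = 1 \<and> v \<in> NF_one n \<or>
    2 \<le> count_list u0 (Tgen n) \<and> v \<in> NF_first n \<union> NF_second n"
    using NF_exists[OF u0(1,3)] .
  have vl: "v \<in> lists (gens_B n)" "fc v" "u0 \<approx> v" "count_list v (Tgen n) = count_list u0 (Tgen n)"
    using ceq_lists[OF uv u0(1)] ceq_fc[OF uv] u0 ceq_eqv[OF uv] ceq_count[OF uv] by auto
  have wv: "w = class_B n v" using u0(2) vl(3) cls_eq_iff[OF u0(1) vl(1)] by simp
  have vw: "v \<in> w" using wv cox_class_self[OF vl(1)] by simp
  have aff: "affine_length n w = count_list v (Tgen n)" using affine_length_class[OF vl(1,2)] wv by simp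
  have inD: "w \<in> Wc_D n \<longleftrightarrow> count_list v (Tgen n) = 0" using class_in_Wc_D_iff[OF vl(1,2)] wv by simp
  have eqv: "v \<approx> v'" if "v' \<in> w" for v' using that unfolding wv mem_cls_iff .
  have nf: "u = v"
    unfolding u_def normal_form_def
  proof (rule the_equality)
    show "v \<in> w \<and> v \<in> (if w \<in> Wc_D n then NF_D n else if affine_length n w = 1 then NF_one n
        else NF_first n \<union> NF_second n)"
      using v vw inD aff vl(4) by auto
  next
    fix v' assume v': "v' \<in> w \<and> v' \<in> (if w \<in> Wc_D n then NF_D n else if affine_length n w = 1
        then NF_one n else NF_first n \<union> NF_second n)"
    then have e: "v \<approx> v'" using eqv by blast
    show "v' = v"
      using v
    proof (elim disjE)
      assume "count_list u0 (Tgen n) = 0 \<and> v \<in> NF_D n"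
      then show ?thesis using v' inD vl(4) NF_D_unique[of v v'] e by simp
    next
      assume "count_list u0 (Tgen n) = 1 \<and> v \<in> NF_one n"
      then show ?thesis using v' inD aff vl(4) NF_one_unique[of v v'] e by simp
    next
      assume *: "2 \<le> count_list u0 (Tgen n) \<and> v \<in> NF_first n \<union> NF_second n"
      then have "v' \<in> NF_first n \<union> NF_second n" using v' inD aff vl(4) by auto
      then show ?thesis using NF_unique[of v v'] * e by simp
    qed
  qed
  show thesis
    using v
  proof (elim disjE)
    assume "count_list u0 (Tgen n) = 0 \<and> v \<in> NF_D n"
    then show ?thesis using D nf vl wv inD aff by (simp add: Wc1_def Wc2_def first_type_def)
  next
    assume *: "count_list u0 (Tgen n) = 1 \<and> v \<in> NF_one n"
    then have "v \<notin> NF_first n" using NF_props[of v] vl(4) by auto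
    then show ?thesis using * first nf vl wv inD aff assms(1) fc_fcx_one[OF vl(2,1)]
      by (simp add: Wc1_def Wc2_def first_type_def)
  next
    assume *: "2 \<le> count_list u0 (Tgen n) \<and> v \<in> NF_first n \<union> NF_second n"
    have uniq: "v' = v" if "v' \<in> w" "v' \<in> NF_first n \<union> NF_second n" for v'
      using NF_unique[of v v'] * eqv that by simp
    show ?thesis
    proof (cases "v \<in> NF_first n")
      case True
      then have "v \<notin> NF_second n" by (rule NF_first_second_disjoint)
      then have "w \<notin> Wc2 n" using uniq by (auto simp: Wc2_def)
      moreover have "w \<in> first_type n" using True * vl aff assms(1) vw by (auto simp: first_type_def)
      ultimately show ?thesis using first nf vl wv inD * True fcx_NF_first[OF True] by (simp add: Wc1_def)
    next
      case False
      then have s: "v \<in> NF_second n" using * by simp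
      have "w \<notin> Wc1 n" using uniq False aff * vl by (auto simp: Wc1_def first_type_def)
      moreover have "w \<in> Wc2 n" using s * vl aff assms(1) vw by (auto simp: Wc2_def)
      ultimately show ?thesis using second nf vl wv inD * s fcx_NF_second[OF s] by simp
    qed
  qed
qed

end

section \<open>Passing from B-tilde n to B-tilde (n + 1)\<close>

text \<open>Recovers one letter from each of the two letters \<sigma>_n that replace t_n in first type elements.\<close>

fun keep_odd :: "'a \<Rightarrow> bool \<Rightarrow> 'a list \<Rightarrow> 'a list" where
  "keep_odd a b [] = []"
| "keep_odd a b (x # u) =
     (if x = a then (if b then [x] else []) @ keep_odd a (\<not> b) u else x # keep_odd a b u)"

text \<open>At most one of two swapped letters is \<open>a\<close>, so both orders make the same
  selection and leave the same flag.\<close>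

lemma (in small_coxeter) ceq_keep_odd: "u \<sim> v \<Longrightarrow> keep_odd a b u \<sim> keep_odd a b v"
proof (induction rule: rtranclp_induct)
  case (step y z)
  obtain c d p q where *: "m p q = 2" "y = c @ p # q # d" "z = c @ q # p # d"
    using step(2) unfolding commutation_step_def by auto
  have "p \<noteq> q" using *(1) m_one[of p q] by auto
  then have "keep_odd a b (c @ p # q # d) \<sim> keep_odd a b (c @ q # p # d)" for b
  proof (induction c arbitrary: b)
    case Nil
    then show ?case using ceq_swap[OF *(1)] by auto
  next
    case (Cons x c)
    then show ?case using ceq_Cons by auto
  qed
  with step.IH show ?case using * ceq_trans by blast
qed simp

lemma subst_t_Nil [simp]: "subst_t n r [] = []"
  by (simp add: subst_t_def)

lemma subst_t_Cons [simp]: "subst_t n r (s # u) = (if s = Tgen n then r else [s]) @ subst_t n r u"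
  by (simp add: subst_t_def)

lemma subst_t_append [simp]: "subst_t n r (u @ v) = subst_t n r u @ subst_t n r v"
  by (simp add: subst_t_def)

lemma subst_t_id: "Tgen n \<notin> set u \<Longrightarrow> subst_t n r u = u"
  by (induction u) auto

lemma set_subst_t: "set (subst_t n r u) = set u - {Tgen n} \<union> (if Tgen n \<in> set u then set r else {})"
  by (induction u) auto

lemma length_subst_t_ge:
  assumes "r \<noteq> []"
  shows "length u \<le> length (subst_t n r u)"
proof (induction u)
  case (Cons x u)
  have "Suc 0 \<le> length r" using assms by (simp add: Suc_leI)
  then show ?case using Cons by auto
qed simp

lemma count_subst_t:
  "s \<noteq> Tgen n \<Longrightarrow> count_list (subst_t n r u) s = count_list u s + count_list r s * count_list u (Tgen n)"
  by (induction u) auto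

lemma length_subst_t:
  "length (subst_t n r u) + count_list u (Tgen n) = length u + length r * count_list u (Tgen n)"
  by (induction u) auto

locale btilde_step = btilde n + S: btilde "Suc n" for n
begin

abbreviation "rI \<equiv> [Sigma n, Tgen (Suc n)]"
abbreviation "rJ \<equiv> [Tgen (Suc n), Sigma n]"
abbreviation "rF \<equiv> [Sigma n, Tgen (Suc n), Sigma n]"

lemma gens_B_cases': "x \<in> gens_B n \<Longrightarrow> x = Tgen n \<or> x \<in> D_letters (n - 1)"
  by (simp add: gens_B_letters)

lemma D_neq_new:
  "x \<in> D_letters (n - 1) \<Longrightarrow> x \<noteq> Tgen n \<and> x \<noteq> Sigma n \<and> x \<noteq> Tgen (Suc n)"
  using n3 by (auto simp: D_letters_def split: if_splits)

lemma gens_B_lists_induct [consumes 1, case_names Nil t D]: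
  assumes "u \<in> lists (gens_B n)" "P []"
    "\<And>u. u \<in> lists (gens_B n) \<Longrightarrow> P u \<Longrightarrow> P (Tgen n # u)"
    "\<And>x u. x \<in> D_letters (n - 1) \<Longrightarrow> x \<noteq> Tgen n \<Longrightarrow> x \<noteq> Sigma n \<Longrightarrow> x \<noteq> Tgen (Suc n) \<Longrightarrow>
       u \<in> lists (gens_B n) \<Longrightarrow> P u \<Longrightarrow> P (x # u)"
  shows "P u"
  using assms(1)
proof (induction u)
  case (Cons x u)
  then show ?case using assms(3,4) gens_B_cases'[of x] D_neq_new[of x] by blast
qed (rule assms(2))

lemma cox_B_Suc_D:
  "x \<in> D_letters (n - 1) \<Longrightarrow> y \<in> D_letters (n - 1) \<Longrightarrow> cox_B (Suc n) x y = cox_B n x y"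
  using n3 by (auto simp: D_letters_def cox_B_simps split: if_splits)

lemma adj_Sigma_n: "x \<in> D_letters (n - 1) \<Longrightarrow> S.adj (Sigma n) x \<longleftrightarrow> adj (Tgen n) x"
  using n3 by (auto simp: D_letters_def cox_B_simps split: if_splits)

lemma not_adj_new_t: "x \<in> D_letters (n - 1) \<Longrightarrow> \<not> S.adj (Tgen (Suc n)) x"
  using n3 by (auto simp: D_letters_def cox_B_simps split: if_splits)

section \<open>Neighbours under the substitutions\<close>

lemma S_nbs_low:
  assumes "s \<in> D_letters (n - 1)" "s \<noteq> Sigma (n - 1)" "set r \<subseteq> {Sigma n, Tgen (Suc n)}"
    "R \<in> lists (gens_B n)"
  shows "S.nbs s (subst_t n r R) = nbs s R"
proof -
  have new: "\<not> S.adj s y" "y \<noteq> s" if "y \<in> set r" for y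
    using that assms(1-3) n3 by (auto simp: D_letters_def cox_B_simps split: if_splits)
  then have r: "S.nbs s (r @ W) = S.nbs s W" for W
    by (induction r) auto
  have "\<not> adj s (Tgen n)" "s \<noteq> Tgen n"
    using assms(1,2) by (auto simp: D_letters_def cox_B_simps split: if_splits)
  with assms(4) show ?thesis
    by (induction R rule: gens_B_lists_induct) (auto simp: r cox_B_Suc_D[OF assms(1)])
qed

lemma Sigma_top_D: "Sigma (n - 1) \<in> D_letters (n - 1)"
  using n3 by (auto simp: D_letters_def)

text \<open>Each t_n seen by \<sigma>_(n-1) turns into the letters \<sigma>_n of \<open>r\<close>:
  one for \<open>rI\<close> and \<open>rJ\<close>, two for \<open>rF\<close>.\<close>

lemma S_nbs_top:
  assumes "set r \<subseteq> {Sigma n, Tgen (Suc n)}" "R \<in> lists (gens_B n)"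
  shows "S.nbs (Sigma (n - 1)) (subst_t n r R) =
    subst_t n (filter (S.adj (Sigma (n - 1))) r) (nbs (Sigma (n - 1)) R)"
proof -
  have "Sigma (n - 1) \<notin> set r" using assms(1) n3 by auto
  then have r: "S.nbs (Sigma (n - 1)) (r @ W) = filter (S.adj (Sigma (n - 1))) r @ S.nbs (Sigma (n - 1)) W" for W
    by (simp add: S.nbs_append S.nbs_notin)
  have "adj (Sigma (n - 1)) (Tgen n)" by (simp add: cox_B_simps)
  with assms(2) show ?thesis
    using r cox_B_Suc_D[OF Sigma_top_D] by (induction R rule: gens_B_lists_induct) auto
qed

text \<open>Among the old letters \<sigma>_n has the neighbours of t_n, and as first letter of the
  replacing word it ends the search at the same place.\<close>

lemma S_nbs_Sigma_n:
  "R \<in> lists (gens_B n) \<Longrightarrow> S.nbs (Sigma n) (subst_t n (Sigma n # r) R) = nbs (Tgen n) R"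
  by (induction R rule: gens_B_lists_induct) (auto simp: adj_Sigma_n)

lemma S_nbs_Sigma_n_J:
  "R \<in> lists (gens_B n) \<Longrightarrow> Tgen n \<in> set R \<Longrightarrow>
    S.nbs (Sigma n) (subst_t n rJ R) = nbs (Tgen n) R @ [Tgen (Suc n)]"
  by (induction R rule: gens_B_lists_induct) (auto simp: adj_Sigma_n cox_B_simps)

lemma S_nbs_new_t:
  "R \<in> lists (gens_B n) \<Longrightarrow> Tgen n \<in> set R \<Longrightarrow>
    S.nbs (Tgen (Suc n)) (subst_t n (Sigma n # Tgen (Suc n) # r) R) = [Sigma n]"
  by (induction R rule: gens_B_lists_induct) (auto simp: not_adj_new_t cox_B_simps)

lemma S_nbs_new_t_J:
  "R \<in> lists (gens_B n) \<Longrightarrow> S.nbs (Tgen (Suc n)) (subst_t n rJ R) = []"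
  by (induction R rule: gens_B_lists_induct) (auto simp: not_adj_new_t)

lemma set_subst_new:
  assumes "R \<in> lists (gens_B n)" "set r = {Sigma n, Tgen (Suc n)}"
  shows "Sigma n \<in> set (subst_t n r R) \<longleftrightarrow> Tgen n \<in> set R"
    "Tgen (Suc n) \<in> set (subst_t n r R) \<longleftrightarrow> Tgen n \<in> set R"
    "x \<in> D_letters (n - 1) \<Longrightarrow> x \<in> set (subst_t n r R) \<longleftrightarrow> x \<in> set R"
proof -
  have "Sigma n \<notin> set R" "Tgen (Suc n) \<notin> set R"
    using assms(1) gens_B_cases' D_neq_new by (fastforce simp: lists_eq_set)+
  then show "Sigma n \<in> set (subst_t n r R) \<longleftrightarrow> Tgen n \<in> set R"
    "Tgen (Suc n) \<in> set (subst_t n r R) \<longleftrightarrow> Tgen n \<in> set R"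
    using assms(2) by (auto simp: set_subst_t)
  show "x \<in> D_letters (n - 1) \<Longrightarrow> x \<in> set (subst_t n r R) \<longleftrightarrow> x \<in> set R"
    using assms(2) D_neq_new[of x] by (auto simp: set_subst_t)
qed

text \<open>Old letters enclose no fewer neighbours than before, as every t_n leaves some
  \<sigma>_n. In the first type \<sigma>_(n-1) may have enclosed t_n alone; it loses the label 4 but
  gains a second neighbour from the two \<sigma>_n of \<open>rF\<close>. So there are always two
  neighbours, whatever \<open>e'\<close> is.\<close>

lemma S_okx_D:
  assumes x: "x \<in> D_letters (n - 1)" and R: "R \<in> lists (gens_B n)" and r: "set r = {Sigma n, Tgen (Suc n)}"
    and ok: "okx e x R" and e: "e = Tgen n \<or> e = Sigma (n - 1) \<and> r = rF"
  shows "S.okx e' x (subst_t n r R)"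
proof -
  have "2 \<le> length (S.nbs x (subst_t n r R))" if xR: "x \<in> set R"
  proof (cases "x = Sigma (n - 1)")
    case False
    then have "2 \<le> length (nbs x R)" using ok e xR D_neq_new[OF x] by (auto simp: okx_def)
    then show ?thesis using S_nbs_low[OF x False _ R, of r] r by simp
  next
    case True
    let ?r = "filter (S.adj (Sigma (n - 1))) r"
    have eq: "S.nbs x (subst_t n r R) = subst_t n ?r (nbs x R)"
      using S_nbs_top[OF _ R, of r] r True by simp
    have "S.adj (Sigma (n - 1)) (Sigma n)" using n3 by (auto simp: cox_B_simps)
    moreover have "Sigma n \<in> set r" using r by simp
    ultimately have r0: "?r \<noteq> []" by (auto simp: filter_empty_conv)
    consider "2 \<le> length (nbs x R)" | y where "x = e" "nbs x R = [y]" "cox_B n x y = 4"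
      using ok xR by (auto simp: okx_def)
    then show ?thesis
    proof cases
      case 1
      then show ?thesis using length_subst_t_ge[OF r0, of "nbs x R" n] eq by simp
    next
      case 2
      then have "r = rF" using e True by auto
      moreover have "y = Tgen n" using 2 True by (cases y) (auto simp: cox_B_simps split: if_splits)
      ultimately show ?thesis using eq 2 \<open>S.adj (Sigma (n - 1)) (Sigma n)\<close> by simp
    qed
  qed
  then show ?thesis using set_subst_new(3)[OF R r x] by (auto simp: S.okx_def)
qed

lemma four: "cox_B (Suc n) (Tgen (Suc n)) (Sigma n) = 4" "cox_B (Suc n) (Sigma n) (Tgen (Suc n)) = 4"
  by (simp_all add: cox_B_simps)

text \<open>Consecutive \<sigma>_n enclose t_(n+1) and at least one old neighbour of t_n.
  Consecutive t_(n+1) enclose a single \<sigma>_n, so t_(n+1) takes over the exceptional role of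
  t_n.\<close>

lemma S_fcx_I:
  assumes "u \<in> lists (gens_B n)" "fcx (Tgen n) u"
  shows "S.fcx (Tgen (Suc n)) (subst_t n rI u)"
  using assms
proof (induction u rule: gens_B_lists_induct)
  case (t R)
  have "S.okx (Tgen (Suc n)) (Tgen (Suc n)) (subst_t n rI R)"
    using S_nbs_new_t[OF t(1), of "[]"] set_subst_new(2)[OF t(1), of rI] four by (auto simp: S.okx_def)
  moreover have "2 \<le> length (S.nbs (Sigma n) (Tgen (Suc n) # subst_t n rI R))" if "Tgen n \<in> set R"
    using t(3) that S_nbs_Sigma_n[OF t(1), of "[Tgen (Suc n)]"] four by (auto simp: okx_def)
  then have "S.okx (Tgen (Suc n)) (Sigma n) (Tgen (Suc n) # subst_t n rI R)"
    using set_subst_new(1)[OF t(1), of rI] by (auto simp: S.okx_def)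
  ultimately show ?case using t by simp
next
  case (D x R)
  then show ?case using S_okx_D[OF D(1,5), of rI] by simp
qed simp

text \<open>As for \<open>rI\<close>, except that the t_(n+1) between consecutive \<sigma>_n comes
  from the later of the two replacing words.\<close>

lemma S_fcx_J:
  assumes "u \<in> lists (gens_B n)" "fcx (Tgen n) u"
  shows "S.fcx (Tgen (Suc n)) (subst_t n rJ u)"
  using assms
proof (induction u rule: gens_B_lists_induct)
  case (t R)
  have rJ: "set rJ = {Sigma n, Tgen (Suc n)}" by auto
  have "S.okx (Tgen (Suc n)) (Tgen (Suc n)) (Sigma n # subst_t n rJ R)"
    using S_nbs_new_t_J[OF t(1)] four by (auto simp: S.okx_def)
  moreover have "2 \<le> length (S.nbs (Sigma n) (subst_t n rJ R))" if "Tgen n \<in> set R"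
    using t(3) that S_nbs_Sigma_n_J[OF t(1) that] by (auto simp: okx_def)
  then have "S.okx (Tgen (Suc n)) (Sigma n) (subst_t n rJ R)"
    using set_subst_new(1)[OF t(1) rJ] by (auto simp: S.okx_def)
  ultimately show ?case using t by simp
next
  case (D x R)
  have "set rJ = {Sigma n, Tgen (Suc n)}" by auto
  then show ?case using S_okx_D[OF D(1,5), of rJ] D by simp
qed simp

text \<open>Inside \<open>rF\<close> the letters \<sigma>_n enclose t_(n+1) alone, so \<sigma>_n is
  exceptional. From one \<open>rF\<close> to the next they enclose two neighbours, because t_n was
  not exceptional before. Consecutive t_(n+1) enclose two \<sigma>_n.\<close>

lemma S_fcx_F:
  assumes "u \<in> lists (gens_B n)" "fcx (Sigma (n - 1)) u"
  shows "S.fcx (Sigma n) (subst_t n rF u)"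
  using assms
proof (induction u rule: gens_B_lists_induct)
  case (t R)
  have rF: "set rF = {Sigma n, Tgen (Suc n)}" by auto
  have "2 \<le> length (S.nbs (Sigma n) (subst_t n rF R))" if "Tgen n \<in> set R"
    using t(3) that S_nbs_Sigma_n[OF t(1), of "[Tgen (Suc n), Sigma n]"] by (auto simp: okx_def)
  then have "S.okx (Sigma n) (Sigma n) (subst_t n rF R)"
    using set_subst_new(1)[OF t(1) rF] by (auto simp: S.okx_def)
  moreover have "S.okx (Sigma n) (Tgen (Suc n)) (Sigma n # subst_t n rF R)"
    using set_subst_new(2)[OF t(1) rF] S_nbs_new_t[OF t(1), of "[Sigma n]"] four by (auto simp: S.okx_def)
  moreover have "S.okx (Sigma n) (Sigma n) (Tgen (Suc n) # Sigma n # subst_t n rF R)"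
    using four by (auto simp: S.okx_def)
  ultimately show ?case using t by simp
next
  case (D x R)
  have "set rF = {Sigma n, Tgen (Suc n)}" by auto
  then show ?case using S_okx_D[OF D(1,5), of rF "Sigma (n - 1)"] D by simp
qed simp

section \<open>Recovering a word from its substitution\<close>

definition rename_t :: "gen \<Rightarrow> gen" where "rename_t x = (if x = Tgen n then Sigma n else x)"
definition restore_t :: "gen \<Rightarrow> gen" where "restore_t x = (if x = Sigma n then Tgen n else x)"

lemma restore_rename: "u \<in> lists (gens_B n) \<Longrightarrow> map restore_t (map rename_t u) = u"
  by (induction u rule: gens_B_lists_induct) (auto simp: rename_t_def restore_t_def)

lemma rename_lists: "u \<in> lists (gens_B n) \<Longrightarrow> map rename_t u \<in> lists (D_letters n)"
proof (induction u rule: gens_B_lists_induct)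
  case (D x u)
  then show ?case using D_letters_mono[of "n - 1" n] by (auto simp: rename_t_def)
qed (use n3 in \<open>auto simp: rename_t_def D_letters_def\<close>)

lemma strip_IJ:
  assumes "u \<in> lists (gens_B n)" "r = rI \<or> r = rJ"
  shows "filter (\<lambda>x. x \<noteq> Tgen (Suc n)) (subst_t n r u) = map rename_t u"
  using assms by (induction u rule: gens_B_lists_induct) (auto simp: rename_t_def)

lemma strip_F:
  "u \<in> lists (gens_B n) \<Longrightarrow>
    keep_odd (Sigma n) True (filter (\<lambda>x. x \<noteq> Tgen (Suc n)) (subst_t n rF u)) = map rename_t u"
  by (induction u rule: gens_B_lists_induct) (auto simp: rename_t_def)

text \<open>Among the letters left after the deletion of t_(n+1), \<sigma>_n commutes with the same
  ones as t_n does in the smaller group; only the label of its edge to \<sigma>_(n-1)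
  differs.\<close>

lemma ceq_restore:
  assumes "S.ceq_B a b" "a \<in> lists (D_letters n)"
  shows "map restore_t a \<sim> map restore_t b"
  using assms(1)
proof (induction rule: rtranclp_induct)
  case (step y z)
  obtain c d p q where *: "cox_B (Suc n) p q = 2" "y = c @ [p, q] @ d" "z = c @ [q, p] @ d"
    using step(2) unfolding commutation_step_def by blast
  have "set y = set a" using S.ceq_set[OF step(1)] by simp
  then have "p \<in> D_letters n" "q \<in> D_letters n" using assms(2) * by (auto simp: lists_eq_set)
  then have "cox_B n (restore_t p) (restore_t q) = 2"
    using *(1) n3 by (auto simp: restore_t_def D_letters_def cox_B_simps split: if_splits)
  then have "map restore_t y \<sim> map restore_t z"
    using ceq_left[OF ceq_swap, of "restore_t p" "restore_t q" "map restore_t c" "map restore_t d"] * by simp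
  with step.IH show ?case by (rule ceq_trans)
qed simp

lemma ceq_subst_inject:
  assumes "S.ceq_B (subst_t n r u) (subst_t n r v)" "r \<in> {rI, rJ, rF}"
    "u \<in> lists (gens_B n)" "v \<in> lists (gens_B n)"
  shows "u \<sim> v"
proof -
  have f: "S.ceq_B (filter (\<lambda>x. x \<noteq> Tgen (Suc n)) (subst_t n r u))
      (filter (\<lambda>x. x \<noteq> Tgen (Suc n)) (subst_t n r v))"
    by (rule S.ceq_filter[OF assms(1)])
  have "S.ceq_B (map rename_t u) (map rename_t v)"
  proof (cases "r = rF")
    case True
    show ?thesis
      using S.ceq_keep_odd[OF f, of "Sigma n" True] strip_F[OF assms(3)] strip_F[OF assms(4)] True by simp
  next
    case False
    then have "r = rI \<or> r = rJ" using assms(2) by auto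
    then show ?thesis using f strip_IJ[OF assms(3), of r] strip_IJ[OF assms(4), of r] by simp
  qed
  then show ?thesis
    using ceq_restore[OF _ rename_lists[OF assms(3)]] restore_rename assms(3,4) by metis
qed

lemma subst_lists:
  assumes "u \<in> lists (gens_B n)" "set r \<subseteq> {Sigma n, Tgen (Suc n)}"
  shows "subst_t n r u \<in> lists (gens_B (Suc n))"
proof -
  have "D_letters (n - 1) \<subseteq> gens_B (Suc n)" by (rule S.D_gens) simp
  moreover have "{Sigma n, Tgen (Suc n)} \<subseteq> gens_B (Suc n)" using n3 by (auto simp: gens_B_def gens_D_def)
  moreover have "set u - {Tgen n} \<subseteq> D_letters (n - 1)"
    using assms(1) gens_B_cases' by (auto simp: lists_eq_set)
  ultimately show ?thesis using assms(2) by (auto simp: lists_eq_set set_subst_t split: if_splits)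
qed

section \<open>Images of the normal forms\<close>

lemma bracket_Suc:
  assumes "- int (n - 1) \<le> i" "i \<le> int n"
  shows "bracket i n = bracket i (n - 1) @ [Sigma n]"
  by (rule bracket_snoc) (use assms n3 in auto)

lemma subst_bracket_t:
  assumes "- int (n - 1) \<le> i" "i \<le> int n"
  shows "subst_t n r (bracket_t n i) = bracket i (n - 1) @ r"
  using t_notin_bracket[OF assms] by (simp add: bracket_t_def subst_t_id)

text \<open>The new \<sigma>_n raises the top of each bracket from n - 1 to n and leaves its index
  unchanged.\<close>

lemma subst_blocks_I:
  assumes "set xs \<subseteq> {- int (n - 1)..int n}" "Tgen n \<notin> set v"
  shows "subst_t n rI (concat (map (bracket_t n) xs) @ v) = concat (map (bracket_t (Suc n)) xs) @ v"
  using assms(1)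
proof (induction xs)
  case Nil
  then show ?case using subst_t_id[OF assms(2)] by simp
next
  case (Cons x xs)
  then show ?case using subst_bracket_t[of x rI] bracket_Suc[of x] by (simp add: bracket_t_def[of "Suc n"])
qed

lemma subst_blocks_J:
  assumes "set xs \<subseteq> {- int (n - 1)..int n}" "Tgen n \<notin> set v"
  shows "S.ceq_B (subst_t n rJ (concat (map (bracket_t n) xs) @ v))
    (concat (map (\<lambda>i. Tgen (Suc n) # bracket i n) xs) @ v)"
  using assms(1)
proof (induction xs)
  case Nil
  then show ?case using subst_t_id[OF assms(2)] by simp
next
  case (Cons x xs)
  let ?W = "subst_t n rJ (concat (map (bracket_t n) xs) @ v)"
  let ?V = "concat (map (\<lambda>i. Tgen (Suc n) # bracket i n) xs) @ v"
  have x: "- int (n - 1) \<le> x" "x \<le> int n" using Cons.prems by auto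
  have "cox_B (Suc n) (Tgen (Suc n)) y = 2" if "y \<in> set (bracket x (n - 1))" for y
  proof -
    have "set (bracket x (n - 1)) \<subseteq> D_letters (n - 1)" by (rule set_bracket) (use x n3 in auto)
    then have "y \<in> D_letters (n - 1)" using that by blast
    then show ?thesis using n3 by (auto simp: D_letters_def cox_B_simps split: if_splits)
  qed
  then have "S.ceq_B (Tgen (Suc n) # bracket x (n - 1) @ Sigma n # ?V)
      (bracket x (n - 1) @ Tgen (Suc n) # Sigma n # ?V)"
    by (rule S.ceq_shift)
  then have "S.ceq_B (bracket x (n - 1) @ Tgen (Suc n) # Sigma n # ?V)
      (Tgen (Suc n) # bracket x (n - 1) @ Sigma n # ?V)"
    by (rule S.ceq_sym)
  moreover have "S.ceq_B (bracket x (n - 1) @ rJ @ ?W) (bracket x (n - 1) @ rJ @ ?V)"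
    by (intro S.ceq_left) (use Cons in auto)
  ultimately show ?case
    using S.ceq_trans subst_bracket_t[OF x, of rJ] bracket_Suc[OF x] by simp
qed

text \<open>Moves the block boundaries by one letter: blocks beginning with \<open>t\<close> become
  blocks ending with \<open>t\<close>, at the cost of a lone \<open>t\<close> in front and a bare
  bracket at the end.\<close>

lemma rotate_blocks:
  "concat (map (\<lambda>i. t # f i) (ys @ [x])) = t # concat (map (\<lambda>i. f i @ [t]) ys) @ f x"
  by (induction ys) auto

lemma NF_second_I:
  assumes "u \<in> NF_second n"
  shows "subst_t n rI u \<in> NF_second (Suc n)"
proof -
  obtain xs ms ns where u: "u = concat (map (bracket_t n) xs) @ word_S ms ns" "2 \<le> length xs"
    "second_blocks xs ms ns" using NF_second_blocks[OF assms] .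
  have t: "Tgen n \<notin> set (word_S ms ns)"
    using u(3) word_S_lists[of ms ns "n - 1"] Tgen_notin_D_letters[of n "n - 1"]
    by (auto simp: second_blocks_def lists_eq_set)
  have "S.second_blocks xs ms ns"
    using u(3) tops_ok_mono[of ms ns "n - 1" n] n3 by (auto simp: second_blocks_def S.second_blocks_def)
  then have "concat (map (bracket_t (Suc n)) xs) @ word_S ms ns \<in> NF_second (Suc n)"
    using S.blocks_NF_second u(2) by blast
  then show ?thesis using subst_blocks_I[OF _ t] u by (simp add: second_blocks_def)
qed

text \<open>The lone t_(n+1) in front is a block with the empty bracket, of index n + 1, and the
  last bracket joins the tail with top n. The number of blocks is unchanged, and the chain of
  indices only gains a larger first entry.\<close>

lemma NF_second_J:
  assumes "u \<in> NF_second n"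
  shows "\<exists>v\<in>NF_second (Suc n). S.ceq_B (subst_t n rJ u) v"
proof -
  obtain xs ms ns where u: "u = concat (map (bracket_t n) xs) @ word_S ms ns" "2 \<le> length xs"
    "second_blocks xs ms ns" using NF_second_blocks[OF assms] .
  have t: "Tgen n \<notin> set (word_S ms ns)"
    using u(3) word_S_lists[of ms ns "n - 1"] Tgen_notin_D_letters[of n "n - 1"]
    by (auto simp: second_blocks_def lists_eq_set)
  have "xs \<noteq> []" using u(2) by auto
  then obtain ys x where xs: "xs = ys @ [x]" by (metis append_butlast_last_id)
  have r: "set xs \<subseteq> {- int (n - 1)..int n}" and tm: "tops_ok ms ns (n - 1)"
    and f: "successively follows (xs @ ms)"
    using u(3) by (auto simp: second_blocks_def)
  let ?xs = "int (Suc n) # ys" and ?ms = "x # ms" and ?ns = "n # ns"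
  have "S.ceq_B (subst_t n rJ u) (concat (map (\<lambda>i. Tgen (Suc n) # bracket i n) xs) @ word_S ms ns)"
    using subst_blocks_J[OF r t] u(1) by simp
  also have "concat (map (\<lambda>i. Tgen (Suc n) # bracket i n) xs) @ word_S ms ns =
      concat (map (bracket_t (Suc n)) ?xs) @ word_S ?ms ?ns"
  proof -
    have "bracket_t (Suc n) = (\<lambda>i. bracket i n @ [Tgen (Suc n)])"
      by (simp add: fun_eq_iff bracket_t_def)
    moreover have "bracket (1 + int n) n = []" using bracket_empty[of n] n3 by (simp add: add.commute)
    ultimately show ?thesis unfolding xs rotate_blocks by simp
  qed
  finally have ceq: "S.ceq_B (subst_t n rJ u) (concat (map (bracket_t (Suc n)) ?xs) @ word_S ?ms ?ns)" .
  have "tops_ok ?ms ?ns n" using tm r xs n3 by (auto simp: tops_ok_Cons)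
  moreover have "follows (int (Suc n)) (hd (xs @ ms))"
    using xs r n3 by (cases ys) (auto simp: follows_def)
  then have "successively follows (?xs @ ?ms)" using f xs by (cases ys) auto
  ultimately have "S.second_blocks ?xs ?ms ?ns"
    using r xs n3 by (auto simp: S.second_blocks_def)
  then have "concat (map (bracket_t (Suc n)) ?xs) @ word_S ?ms ?ns \<in> NF_second (Suc n)"
    by (intro S.blocks_NF_second) (use u(2) xs in auto)
  then show ?thesis using ceq by blast
qed

text \<open>The second \<sigma>_n of each replacing word belongs to what comes next: it turns a
  following \<langle>-(n-1), n-1] \<sigma>_n into \<langle>-n, n], and the last one raises the top
  of the reversed bracket.\<close>

lemma NF_first_F:
  assumes "u \<in> NF_first n"
  shows "subst_t n rF u \<in> NF_first (Suc n)"
proof -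
  let ?N = "n - 1"
  obtain i k f where u: "u = concat (map (bracket_t n) (i # replicate k (- int ?N))) @ rev (bracket f ?N)"
    "1 \<le> k" "- int ?N \<le> i" "i \<le> int n" "- int ?N \<le> f" "f \<le> int n"
    using NF_first_blocks[OF assms] .
  have tf: "Tgen n \<notin> set (rev (bracket f ?N))" using t_notin_bracket u by simp
  have "[2..<Suc n] = [2..<Suc ?N] @ [n]" using n3 upt_Suc_append[of 2 n] by simp
  then have neg: "Sigma n # bracket (- int ?N) ?N @ [Sigma n] = bracket (- int n) n"
    using bracket_neg[OF n2, of ?N] bracket_neg[of n n] n3 by (simp del: upt_Suc)
  \<comment> \<open>The \<sigma>_n left over from the preceding block is part of the statement,
    which lets the induction on the number of blocks go through.\<close>
  have tail: "Sigma n # subst_t n rF (concat (map (bracket_t n) (replicate k (- int ?N))) @ rev (bracket f ?N)) =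
      concat (map (bracket_t (Suc n)) (replicate k (- int n))) @ rev (bracket f n)" for k
  proof (induction k)
    case 0
    then show ?case using subst_t_id[OF tf] bracket_Suc u by simp
  next
    case (Suc k)
    have "subst_t n rF (bracket_t n (- int ?N)) = bracket (- int ?N) ?N @ rF"
      by (rule subst_bracket_t) auto
    moreover have "Sigma n # bracket (- int ?N) ?N @ Sigma n # W = bracket (- int n) n @ W" for W
      using neg by (metis append.assoc append_Cons append_Nil)
    ultimately show ?case using Suc.IH by (simp add: bracket_t_def[of "Suc n"])
  qed
  have "subst_t n rF u = bracket_t (Suc n) i @
      Sigma n # subst_t n rF (concat (map (bracket_t n) (replicate k (- int ?N))) @ rev (bracket f ?N))"
    using u(1) subst_bracket_t[OF u(3,4), of rF] bracket_Suc[OF u(3,4)]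
    by (simp add: bracket_t_def[of "Suc n"])
  then have "subst_t n rF u =
      concat (map (bracket_t (Suc n)) (i # replicate k (- int n))) @ rev (bracket f n)"
    unfolding tail by simp
  moreover have "concat (map (bracket_t (Suc n)) (i # replicate k (- int (Suc n - 1)))) @ rev (bracket f (Suc n - 1)) \<in> NF_first (Suc n)"
    by (rule S.blocks_NF_first) (use u n3 in auto)
  ultimately show ?thesis by simp
qed

text \<open>The maps I and J differ only in the word that replaces t_n in second type elements. With
  this word as a parameter, the statements about either map are proved once.\<close>

definition image_expr :: "gen list \<Rightarrow> gen list set \<Rightarrow> gen list" where
  "image_expr r w = (if w \<in> Wc2 n then subst_t n r (normal_form n w)
      else if w \<in> Wc1 n then subst_t n rF (normal_form n w) else normal_form n w)"

definition image_map :: "gen list \<Rightarrow> gen list set \<Rightarrow> gen list set" where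
  "image_map r w = class_B (Suc n) (image_expr r w)"

lemma I_map_image: "I_expr n = image_expr rI" "I_map n = image_map rI"
  by (auto simp: I_expr_def I_map_def image_expr_def image_map_def fun_eq_iff)

lemma J_map_image: "J_expr n = image_expr rJ" "J_map n = image_map rJ"
  by (auto simp: J_expr_def J_map_def image_expr_def image_map_def fun_eq_iff)

lemma image_good:
  assumes "w \<in> Wc_B n" "r \<in> {rI, rJ}"
  shows "image_expr r w \<in> lists (gens_B (Suc n)) \<and> S.fc (image_expr r w)"
  using assms(1)
proof (cases w rule: normal_form_cases)
  case D
  let ?u = "normal_form n w"
  have "Tgen n \<notin> set ?u" using D by (simp add: count_list_0_iff)
  \<comment> \<open>A word without t_n is its own substitution, so the results on substitutions also
    apply to W(D_n).\<close>
  then have id: "subst_t n rI ?u = ?u" by (rule subst_t_id)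
  have "S.fc (subst_t n rI ?u)" using S.fcx_fc S_fcx_I fc_fcx_D D by blast
  moreover have "subst_t n rI ?u \<in> lists (gens_B (Suc n))" by (rule subst_lists) (use D in auto)
  ultimately show ?thesis using D id by (simp add: image_expr_def)
next
  case first
  have "S.fc (subst_t n rF (normal_form n w))" using S.fcx_fc S_fcx_F first by blast
  moreover have "subst_t n rF (normal_form n w) \<in> lists (gens_B (Suc n))"
    by (rule subst_lists) (use first in auto)
  ultimately show ?thesis using first by (simp add: image_expr_def)
next
  case second
  have "S.fc (subst_t n r (normal_form n w))" using S.fcx_fc S_fcx_I S_fcx_J second assms(2) by blast
  moreover have "subst_t n r (normal_form n w) \<in> lists (gens_B (Suc n))"
    by (rule subst_lists) (use second assms(2) in auto)
  ultimately show ?thesis using second by (simp add: image_expr_def)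
qed

lemma image_good':
  assumes "w \<in> Wc_B n" "r \<in> {rI, rJ}"
  shows "image_expr r w \<in> lists (gens_B (Suc n))" "S.fc (image_expr r w)"
  using image_good[OF assms] by auto

lemma count_new:
  assumes "u \<in> lists (gens_B n)"
  shows "count_list u (Tgen (Suc n)) = 0" "count_list u (Sigma n) = 0"
  using assms gens_B_cases' D_neq_new by (fastforce simp: count_list_0_iff lists_eq_set)+

lemma image_counts:
  assumes "w \<in> Wc_B n" "r \<in> {rI, rJ}"
  defines "L \<equiv> count_list (normal_form n w) (Tgen n)"
  shows "count_list (image_expr r w) (Tgen (Suc n)) = L"
    "count_list (image_expr r w) (Sigma n) = (if w \<in> Wc2 n then L else 2 * L)"
    "length (image_expr r w) = length (normal_form n w) + (if w \<in> Wc2 n then L else 2 * L)"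
proof -
  have "count_list (image_expr r w) (Tgen (Suc n)) = L \<and>
    count_list (image_expr r w) (Sigma n) = (if w \<in> Wc2 n then L else 2 * L) \<and>
    length (image_expr r w) = length (normal_form n w) + (if w \<in> Wc2 n then L else 2 * L)"
    using assms(1)
  proof (cases w rule: normal_form_cases)
    case D
    then show ?thesis using count_new[of "normal_form n w"] by (simp add: image_expr_def L_def)
  next
    case first
    then show ?thesis using count_new[of "normal_form n w"] length_subst_t[of n rF "normal_form n w"]
      by (simp add: image_expr_def L_def count_subst_t)
  next
    case second
    then show ?thesis using count_new[of "normal_form n w"] length_subst_t[of n r "normal_form n w"] assms(2)
      by (auto simp: image_expr_def L_def count_subst_t)
  qed
  then show "count_list (image_expr r w) (Tgen (Suc n)) = L"
    "count_list (image_expr r w) (Sigma n) = (if w \<in> Wc2 n then L else 2 * L)"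
    "length (image_expr r w) = length (normal_form n w) + (if w \<in> Wc2 n then L else 2 * L)"
    by auto
qed

lemma affine_length_nf:
  assumes "w \<in> Wc_B n"
  shows "affine_length n w = count_list (normal_form n w) (Tgen n)"
    "cox_length w = length (normal_form n w)"
proof -
  have u: "normal_form n w \<in> lists (gens_B n)" "fc (normal_form n w)" "w = class_B n (normal_form n w)"
    using assms by (cases w rule: normal_form_cases; blast)+
  show "affine_length n w = count_list (normal_form n w) (Tgen n)"
    "cox_length w = length (normal_form n w)"
    using affine_length_class[OF u(1,2)] cox_length_class[OF u(1,2)] u(3) by auto
qed

lemma image_in_Wc_B:
  assumes "w \<in> Wc_B n" "r \<in> {rI, rJ}"
  shows "image_map r w \<in> Wc_B (Suc n)"
    "reduced_word (cox_B (Suc n)) (gens_B (Suc n)) (image_expr r w)"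
    "affine_length (Suc n) (image_map r w) = affine_length n w"
    "cox_length (image_map r w) = cox_length w + (if w \<in> Wc2 n then affine_length n w else 2 * affine_length n w)"
  using S.class_in_Wc_B[OF image_good'[OF assms]] S.fc_reduced[OF image_good'[OF assms]]
    S.affine_length_class[OF image_good'[OF assms]] S.cox_length_class[OF image_good'[OF assms]]
    image_counts[OF assms] affine_length_nf[OF assms(1)]
  by (simp_all add: image_map_def)

lemma image_eq_iff:
  assumes "w \<in> Wc_B n" "r \<in> {rI, rJ}" "w' \<in> Wc_B n" "r' \<in> {rI, rJ}"
    "image_map r w = image_map r' w'"
  shows "S.ceq_B (image_expr r w) (image_expr r' w')"
  using assms(5) S.cls_eq_cls_iff_ceq[OF image_good'(1)[OF assms(1,2)] image_good'(1)[OF assms(3,4)]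
      image_good'(2)[OF assms(1,2)] image_good'(2)[OF assms(3,4)]]
  by (simp add: image_map_def)

text \<open>Counting letters reveals the type: the image has as many \<sigma>_n as t_(n+1) in the
  second type, twice as many in the first, and neither letter for W(D_n). Both counts are invariant
  under commutations.\<close>

lemma image_same_type:
  assumes "w \<in> Wc_B n" "r \<in> {rI, rJ}" "w' \<in> Wc_B n" "r' \<in> {rI, rJ}"
    "image_map r w = image_map r' w'"
  shows "(w \<in> Wc1 n \<longleftrightarrow> w' \<in> Wc1 n) \<and> (w \<in> Wc2 n \<longleftrightarrow> w' \<in> Wc2 n)"
proof -
  let ?L = "count_list (normal_form n w) (Tgen n)" and ?L' = "count_list (normal_form n w') (Tgen n)"
  note ceq = image_eq_iff[OF assms]
  have "?L = ?L'" "(if w \<in> Wc2 n then ?L else 2 * ?L) = (if w' \<in> Wc2 n then ?L' else 2 * ?L')"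
    using S.ceq_count[OF ceq, of "Tgen (Suc n)"] S.ceq_count[OF ceq, of "Sigma n"]
      image_counts[OF assms(1,2)] image_counts[OF assms(3,4)] by auto
  moreover have "?L = 0 \<and> w \<notin> Wc1 n \<and> w \<notin> Wc2 n \<or> 1 \<le> ?L \<and> (w \<in> Wc1 n \<longleftrightarrow> w \<notin> Wc2 n)"
    using assms(1) by (cases w rule: normal_form_cases) auto
  moreover have "?L' = 0 \<and> w' \<notin> Wc1 n \<and> w' \<notin> Wc2 n \<or> 1 \<le> ?L' \<and> (w' \<in> Wc1 n \<longleftrightarrow> w' \<notin> Wc2 n)"
    using assms(3) by (cases w' rule: normal_form_cases) auto
  ultimately show ?thesis by (auto split: if_splits)
qed

lemma image_inj:
  assumes "r \<in> {rI, rJ}"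
  shows "inj_on (image_map r) (Wc_B n)"
proof (rule inj_onI)
  fix w w' assume w: "w \<in> Wc_B n" and w': "w' \<in> Wc_B n" and eq: "image_map r w = image_map r w'"
  note ceq = image_eq_iff[OF w assms w' assms eq] and type = image_same_type[OF w assms w' assms eq]
  let ?u = "normal_form n w" and ?u' = "normal_form n w'"
  have u: "?u \<in> lists (gens_B n)" "fc ?u" "w = class_B n ?u"
    using w by (cases w rule: normal_form_cases; blast)+
  have u': "?u' \<in> lists (gens_B n)" "fc ?u'" "w' = class_B n ?u'"
    using w' by (cases w' rule: normal_form_cases; blast)+
  have D: "Tgen n \<notin> set (normal_form n v)" if "v \<in> Wc_B n" "v \<notin> Wc1 n" "v \<notin> Wc2 n" for v
    using that by (cases v rule: normal_form_cases) (auto simp: count_list_0_iff)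
  consider "w \<in> Wc2 n" | "w \<notin> Wc2 n" "w \<in> Wc1 n" | "w \<notin> Wc2 n" "w \<notin> Wc1 n" by blast
  then have "\<exists>r'\<in>{rI, rJ, rF}. S.ceq_B (subst_t n r' ?u) (subst_t n r' ?u')"
  proof cases
    case 1
    then show ?thesis using ceq type assms by (intro bexI[of _ r]) (auto simp: image_expr_def)
  next
    case 2
    then show ?thesis using ceq type by (intro bexI[of _ rF]) (auto simp: image_expr_def)
  next
    case 3
    then have "subst_t n rI ?u = ?u" "subst_t n rI ?u' = ?u'"
      using D[OF w] D[OF w'] type subst_t_id by blast+
    then show ?thesis using 3 ceq type by (intro bexI[of _ rI]) (auto simp: image_expr_def)
  qed
  then have "?u \<sim> ?u'" using ceq_subst_inject u(1) u'(1) by blast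
  then show "w = w'" using u u' cls_eq_cls_iff_ceq by metis
qed

lemma projection_subst:
  assumes "u \<in> lists (gens_B n)" "r \<in> {rI, rJ}"
  shows "filter (\<lambda>x. x \<in> {Sigma n, Tgen (Suc n)}) (subst_t n r u) = concat (replicate (count_list u (Tgen n)) r)"
  using assms by (induction u rule: gens_B_lists_induct) auto

lemma I_J_differ:
  assumes "w \<in> Wc2 n" "w' \<in> Wc2 n"
  shows "image_map rI w \<noteq> image_map rJ w'"
proof
  assume eq: "image_map rI w = image_map rJ w'"
  have w: "w \<in> Wc_B n" "w' \<in> Wc_B n" using assms by (auto simp: Wc2_def)
  let ?u = "normal_form n w" and ?u' = "normal_form n w'"
  have u: "?u \<in> lists (gens_B n)" "2 \<le> count_list ?u (Tgen n)"
    using w(1) assms(1) by (cases w rule: normal_form_cases; simp)+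
  have u': "?u' \<in> lists (gens_B n)" "2 \<le> count_list ?u' (Tgen n)"
    using w(2) assms(2) by (cases w' rule: normal_form_cases; simp)+
  have ceq: "S.ceq_B (subst_t n rI ?u) (subst_t n rJ ?u')"
    using image_eq_iff[OF w(1) _ w(2) _ eq] assms by (simp add: image_expr_def)
  have "concat (replicate (count_list ?u (Tgen n)) rI) = concat (replicate (count_list ?u' (Tgen n)) rJ)"
    using S.ceq_projection[OF ceq, of "Sigma n" "Tgen (Suc n)"] four
      projection_subst[OF u(1), of rI] projection_subst[OF u'(1), of rJ] by simp
  moreover obtain a b where "count_list ?u (Tgen n) = Suc a" "count_list ?u' (Tgen n) = Suc b"
    using u(2) u'(2) by (metis Suc_le_D numeral_2_eq_2)
  ultimately show False by simp
qed

text \<open>A common image forces equal types, and \<open>I_J_differ\<close> excludes the second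
  one. On all other elements the two maps agree by definition.\<close>

lemma image_intersection:
  "image_map rI ` Wc_B n \<inter> image_map rJ ` Wc_B n = image_map rI ` (Wc1 n \<union> Wc_D n)"
proof (intro equalityI subsetI)
  fix x assume "x \<in> image_map rI ` Wc_B n \<inter> image_map rJ ` Wc_B n"
  then obtain w w' where w: "w \<in> Wc_B n" "x = image_map rI w" "w' \<in> Wc_B n" "x = image_map rJ w'" by blast
  have w2: "w \<notin> Wc2 n"
    using image_same_type[OF w(1) _ w(3), of rI rJ] I_J_differ w by auto
  have "w \<in> Wc1 n \<union> Wc_D n" using w(1) by (cases w rule: normal_form_cases) (use w2 in auto)
  then show "x \<in> image_map rI ` (Wc1 n \<union> Wc_D n)" using w by blast
next
  fix x assume "x \<in> image_map rI ` (Wc1 n \<union> Wc_D n)"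
  then obtain w where w: "w \<in> Wc1 n \<union> Wc_D n" "x = image_map rI w" by blast
  then have wB: "w \<in> Wc_B n" using Wc_D_subset by (auto simp: Wc1_def first_type_def)
  then have "w \<notin> Wc2 n" using w(1) by (cases w rule: normal_form_cases) auto
  then have "x = image_map rJ w" using w by (simp add: image_map_def image_expr_def)
  then show "x \<in> image_map rI ` Wc_B n \<inter> image_map rJ ` Wc_B n" using w wB by blast
qed

lemma image_first_type:
  assumes "r \<in> {rI, rJ}" "w \<in> first_type n"
  shows "image_map r w \<in> first_type (Suc n)"
proof -
  have w: "w \<in> Wc_B n" "w \<in> Wc1 n" "2 \<le> affine_length n w" using assms(2) by (auto simp: first_type_def Wc1_def)
  have nf: "normal_form n w \<in> NF_first n" "w \<notin> Wc2 n"
    using w(1) by (cases w rule: normal_form_cases; use w assms(2) in simp)+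
  then have "image_expr r w = subst_t n rF (normal_form n w)" using w by (simp add: image_expr_def)
  then have "image_expr r w \<in> NF_first (Suc n)" using NF_first_F nf by simp
  moreover have "image_expr r w \<in> image_map r w"
    using cox_class_self[OF image_good'(1)[OF w(1) assms(1)]] by (simp add: image_map_def)
  ultimately show ?thesis
    using image_in_Wc_B[OF w(1) assms(1)] w(3) by (auto simp: first_type_def)
qed

lemma image_Wc1:
  assumes "r \<in> {rI, rJ}" "w \<in> Wc1 n"
  shows "image_map r w \<in> Wc1 (Suc n)"
proof (cases "w \<in> first_type n")
  case True
  then show ?thesis using image_first_type[OF assms(1)] by (simp add: Wc1_def)
next
  case False
  then have w: "w \<in> Wc_B n" "affine_length n w = 1" using assms(2) by (auto simp: Wc1_def)
  then show ?thesis using image_in_Wc_B[OF w(1) assms(1)] by (simp add: Wc1_def)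
qed

lemma image_Wc2:
  assumes "r \<in> {rI, rJ}" "w \<in> Wc2 n"
  shows "image_map r w \<in> Wc2 (Suc n)"
proof -
  have w: "w \<in> Wc_B n" "2 \<le> affine_length n w" using assms(2) by (auto simp: Wc2_def)
  have nf: "normal_form n w \<in> NF_second n"
    using w(1) by (cases w rule: normal_form_cases) (use assms(2) in auto)
  have e: "image_expr r w = subst_t n r (normal_form n w)" using assms(2) by (simp add: image_expr_def)
  have "\<exists>v\<in>NF_second (Suc n). S.ceq_B (image_expr r w) v"
    using NF_second_I[OF nf] NF_second_J[OF nf] assms(1) unfolding e by blast
  then obtain v where v: "v \<in> NF_second (Suc n)" "S.ceq_B (image_expr r w) v" by blast
  have "v \<in> image_map r w"
    unfolding image_map_def S.mem_cls_iff by (rule S.ceq_eqv[OF v(2) image_good'(1)[OF w(1) assms(1)]])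
  then show ?thesis
    using image_in_Wc_B[OF w(1) assms(1)] w(2) v(1) by (auto simp: Wc2_def)
qed

end

theorem theorem5p2:
  fixes n :: nat
  assumes "n \<ge> 3"
  shows
    "(\<forall>w\<in>Wc_B n.
        reduced_word (cox_B (n + 1)) (gens_B (n + 1)) (I_expr n w) \<and>
        reduced_word (cox_B (n + 1)) (gens_B (n + 1)) (J_expr n w) \<and>
        I_map n w \<in> Wc_B (n + 1) \<and> J_map n w \<in> Wc_B (n + 1)) \<and>
     inj_on (I_map n) (Wc_B n) \<and> inj_on (J_map n) (Wc_B n) \<and>
     (\<forall>w\<in>Wc_B n.
        affine_length (n + 1) (I_map n w) = affine_length n w \<and>
        affine_length (n + 1) (J_map n w) = affine_length n w) \<and>
     (\<forall>w\<in>Wc2 n.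
        cox_length (I_map n w) = cox_length w + affine_length n w \<and>
        cox_length (J_map n w) = cox_length w + affine_length n w) \<and>
     (\<forall>w\<in>Wc1 n.
        cox_length (I_map n w) = cox_length w + 2 * affine_length n w \<and>
        cox_length (J_map n w) = cox_length w + 2 * affine_length n w) \<and>
     I_map n ` first_type n \<subseteq> first_type (n + 1) \<and>
     J_map n ` first_type n \<subseteq> first_type (n + 1) \<and>
     I_map n ` Wc1 n \<subseteq> Wc1 (n + 1) \<and> J_map n ` Wc1 n \<subseteq> Wc1 (n + 1) \<and>
     I_map n ` Wc2 n \<subseteq> Wc2 (n + 1) \<and> J_map n ` Wc2 n \<subseteq> Wc2 (n + 1) \<and>
     I_map n ` Wc_B n \<inter> J_map n ` Wc_B n = I_map n ` (Wc1 n \<union> Wc_D n)"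
proof -
  interpret btilde_step n
    by unfold_locales (use assms in auto)
  have r: "rI \<in> {rI, rJ}" "rJ \<in> {rI, rJ}" by simp_all
  have B1: "w \<in> Wc_B n" "w \<notin> Wc2 n" if "w \<in> Wc1 n" for w
  proof -
    show B: "w \<in> Wc_B n" using that by (auto simp: Wc1_def first_type_def)
    show "w \<notin> Wc2 n" using B by (cases w rule: normal_form_cases) (use that in auto)
  qed
  have B2: "w \<in> Wc_B n" if "w \<in> Wc2 n" for w using that by (simp add: Wc2_def)
  show ?thesis
    unfolding I_map_image J_map_image Suc_eq_plus1[symmetric]
    using image_in_Wc_B[OF _ r(1)] image_in_Wc_B[OF _ r(2)] image_inj[OF r(1)] image_inj[OF r(2)]
      image_first_type[OF r(1)] image_first_type[OF r(2)] image_Wc1[OF r(1)] image_Wc1[OF r(2)]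
      image_Wc2[OF r(1)] image_Wc2[OF r(2)] image_intersection B1 B2
    by (intro conjI ballI image_subsetI) (simp_all only: if_True if_False refl)
qed

end
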